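(* There exist constants $c_0,C>0$ depending only on $\alpha$, $\beta$, and $d$ (and the mesh regularity), and a quantity $C_{\tau,h}\eqsim\max\{\tau/h,h/\tau\}$, such that the following holds. Let $\vartheta>0$ and let $\ell\in\mathbb N$ satisfy $$\ell\ \ge\ c_0\,C_{\tau,h}\Big(\frac T\tau\log\Big(C_{\tau,h}\frac T\tau\Big)+|\log h|+|\log\vartheta|+\frac{t_{\mathrm{fin}}}{T}|\log H|\Big).$$ Let $(u_h^n)_n$ be the solution of the global Crank--Nicolson scheme and let $(\bar u_h^n)_n$ be the solution of the local superposition method with parameter $\ell$ and the same discrete initial data $u_h^0,u_h^1\in V_h$ and right-hand sides $f_h^n\in V_h$. Then for any $n\in\mathbb N_0$ with $n\le N:=t_{\mathrm{fin}}/\tau$, $$\|\bar u_h^{n+1/2}-u_h^{n+1/2}\|_{\mathcal E}\ \le\ C\,\vartheta\,\Big(\|u_h^{1/2}\|_{\mathcal E}+\sum_{j=1}^{N}\tau\,\big\|\widehat{f_h^{j}}\big\|\Big).$$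
   Context: Setting. $\Omega\subset\mathbb R^d$ is an open, bounded, connected Lipschitz polytope with $\operatorname{diam}(\Omega)\eqsim1$; $t_{\mathrm{fin}}>0$ is the final time. $A\in L^\infty(\Omega)$ is a scalar coefficient with $0<\alpha\le A(x)\le\beta$ for almost every $x\in\Omega$. For measurable $S\subseteq\Omega$ write $(\cdot,\cdot)_S$ and $\|\cdot\|_S$ for the inner product and norm of $L^2(S)$, $a_S(v,w):=(A\nabla v,\nabla w)_S$, $\|v\|_{a,S}^2:=a_S(v,v)$; the index is dropped if $S=\Omega$. Space discretization. $\mathcal T_H$ is a regular and quasi-uniform coarse mesh of $\Omega$ into parallelepipeds with mesh size $H$; $\mathcal T_h$ is a regular and quasi-uniform fine mesh with mesh size $h$ that is a refinement of $\mathcal T_H$, with $H/h\in\mathbb N$. $V_h\subset H^1_0(\Omega)$ is the first-order ($Q_1$) conforming finite element space on $\mathcal T_h$ with zero boundary values; for $S\subseteq\Omega$, $V_h(S):=\{v_h\in V_h:\operatorname{supp}(v_h)\subseteq\overline S\}$. $I_h$ denotes nodal interpolation onto the $Q_1$ finite elements on $\mathcal T_h$. $\Lambda_1,\dots,\Lambda_M$ are the nodal $Q_1$ basis functions of all vertices of $\mathcal T_H$, so that $\sum_i\Lambda_i\equiv1$, $0\le\Lambda_i\le1$, $\|\nabla\Lambda_i\|_{L^\infty(\Omega)}\lesssim H^{-1}$; $\omega_i:=\operatorname{supp}\Lambda_i$. Patches. For $\omega\subseteq\Omega$, $\mathtt N(\omega)=\mathtt N_1(\omega)$ is the interior of the union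 of all closed elements $\overline K$, $K\in\mathcal T_h$ (fine mesh), with $\overline K\cap\overline\omega\ne\emptyset$; $\mathtt N_\ell(\omega):=\mathtt N(\mathtt N_{\ell-1}(\omega))$ for $\ell\ge2$. Time discretization. $\tau>0$ is the fine time step, $T>0$ the coarse time step (reset time), with $T/\tau\in\mathbb N$ and $t_{\mathrm{fin}}/T\in\mathbb N$; $n_{\mathrm{res}}:=T/\tau$. For a sequence $(z^n)_n$ put $\hat\partial_\tau^2z^n:=\tau^{-2}(z^{n+1}-2z^n+z^{n-1})$, $\widehat{z^n}:=\frac14(z^{n+1}+2z^n+z^{n-1})$, $z^{n+1/2}:=\frac12(z^{n+1}+z^n)$, $D_\tau z^{n+1/2}:=\tau^{-1}(z^{n+1}-z^n)$. The energy norm is $$\|z^{n+1/2}\|_{\mathcal E}:=\big(\|D_\tau z^{n+1/2}\|^2+\|z^{n+1/2}\|_a^2\big)^{1/2}.$$ Global Crank--Nicolson scheme. Given $u_h^0,u_h^1\in V_h$ and $f_h^n\in V_h$ (approximations at time $n\tau$ of the right-hand side $f$ of the wave equation $\partial_t^2u-\nabla\cdot(A\nabla u)=f$), find $(u_h^n)_n\subset V_h$ such that for $n\ge1$ $$(\hat\partial_\tau^2u_h^n,v_h)+a(\widehat{u_h^n},v_h)=(\widehat{f_h^n},v_h)\quad\text{for all }v_h\in V_h.$$ Local superposition method (with parameter $\ell$). Set $\bar u_h^0:=u_h^0$, $\bar u_h^1:=u_h^1$, and $f_{h,i}^n:=I_h(\Lambda_if_h^n)$. For $k=0,1,\dots,t_{\mathrm{fin}}/T-1$,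 with $m:=k\,n_{\mathrm{res}}$: for each $i=1,\dots,M$ set $\bar u_{h,i}^{m}:=I_h(\Lambda_i\bar u_h^m)$, $\bar u_{h,i}^{m+1}:=I_h(\Lambda_i\bar u_h^{m+1})$ and compute $\bar u_{h,i}^{n+1}\in V_h(\mathtt N_\ell(\omega_i))$ for $n=m+1,\dots,m+n_{\mathrm{res}}$ from $$(\hat\partial_\tau^2\bar u_{h,i}^n,v_h)_{\mathtt N_\ell(\omega_i)}+a_{\mathtt N_\ell(\omega_i)}(\widehat{\bar u_{h,i}^n},v_h)=(\widehat{f_{h,i}^n},v_h)_{\mathtt N_\ell(\omega_i)}\quad\text{for all }v_h\in V_h(\mathtt N_\ell(\omega_i));$$ then set $\bar u_h^{n}:=\sum_{i=1}^M\bar u_{h,i}^{n}$ for $m+2\le n\le m+n_{\mathrm{res}}+1$. (The values $\bar u_h^{m+n_{\mathrm{res}}},\bar u_h^{m+n_{\mathrm{res}}+1}$ serve as initial data, again localized by the partition of unity, for the next value of $k$.) Convention. $\theta\lesssim\eta$ means $\theta\le c\,\eta$ with a generic constant $c>0$ depending only on $d$, $\alpha$, $\beta$ (and the mesh regularity); $\theta\eqsim\eta$ means $\theta\lesssim\eta\lesssim\theta$.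
   Formalization: The coarse mesh size is assumed to satisfy H ≤ H₀ for a fixed H₀ < 1, on which the constants may depend; for H = 1 the term (t_fin/T)|log H| vanishes and the bound fails as t_fin grows. *)

theory Defs
  imports "HOL-Analysis.Analysis"
begin

section \<open>Domains\<close>

text \<open>
  Near each boundary point, the domain is the strict hypograph, in some direction \<open>e\<close>, of a
  Lipschitz function of the component orthogonal to \<open>e\<close>.
\<close>

definition lipschitz_domain :: "(real ^ 'n) set \<Rightarrow> bool" where
  "lipschitz_domain \<Omega> \<longleftrightarrow>
     (\<forall>x \<in> frontier \<Omega>. \<exists>r e L (\<phi> :: real ^ 'n \<Rightarrow> real).
        0 < r \<and> norm e = 1 \<and> L-lipschitz_on UNIV \<phi> \<and>
        \<Omega> \<inter> ball x r = {y \<in> ball x r. y \<bullet> e < \<phi> (y - (y \<bullet> e) *\<^sub>R e)})"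

text \<open>
  A polytope in the sense of domains need not be convex, whereas the library's \<^const>\<open>polytope\<close>
  is the convex hull of a finite set.
\<close>

definition lipschitz_polytope :: "(real ^ 'n) set \<Rightarrow> bool" where
  "lipschitz_polytope \<Omega> \<longleftrightarrow>
     open \<Omega> \<and> bounded \<Omega> \<and> connected \<Omega> \<and> lipschitz_domain \<Omega> \<and>
     (\<exists>\<P>. finite \<P> \<and> (\<forall>P \<in> \<P>. polytope P) \<and> closure \<Omega> = \<Union>\<P>)"


section \<open>Inner products and norms\<close>

definition l2_inner :: "(real ^ 'n) set \<Rightarrow> (real ^ 'n \<Rightarrow> real) \<Rightarrow> (real ^ 'n \<Rightarrow> real) \<Rightarrow> real" where
  "l2_inner S v w = (LINT x:S|lebesgue. v x * w x)"

definition l2_norm :: "(real ^ 'n) set \<Rightarrow> (real ^ 'n \<Rightarrow> real) \<Rightarrow> real" where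
  "l2_norm S v = sqrt (l2_inner S v v)"

text \<open>
  The pointwise gradient. It is only applied to finite element functions, which are continuous
  and smooth on each element: there it exists off the (null) mesh skeleton and represents the
  weak gradient. The arbitrary values on the skeleton do not affect the integrals below.
\<close>

definition grad :: "(real ^ 'n \<Rightarrow> real) \<Rightarrow> real ^ 'n \<Rightarrow> real ^ 'n" where
  "grad v x = (THE D. GDERIV v x :> D)"

definition a_form ::
  "(real ^ 'n \<Rightarrow> real) \<Rightarrow> (real ^ 'n) set \<Rightarrow> (real ^ 'n \<Rightarrow> real) \<Rightarrow> (real ^ 'n \<Rightarrow> real) \<Rightarrow> real" where
  "a_form A S v w = (LINT x:S|lebesgue. (A x *\<^sub>R grad v x) \<bullet> grad w x)"

definition a_norm ::
  "(real ^ 'n \<Rightarrow> real) \<Rightarrow> (real ^ 'n) set \<Rightarrow> (real ^ 'n \<Rightarrow> real) \<Rightarrow> real" where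
  "a_norm A S v = sqrt (a_form A S v v)"


section \<open>Meshes of parallelepipeds\<close>

definition parallelepiped :: "(real ^ 'n) set \<Rightarrow> bool" where
  "parallelepiped K \<longleftrightarrow>
     (\<exists>b (B :: real ^ 'n ^ 'n). invertible B \<and> K = (\<lambda>y. b + B *v y) ` cbox 0 1)"

text \<open>
  Elements are closed. The face condition excludes hanging nodes; it includes the case of
  disjoint elements, since the empty set is a face.
\<close>

definition mesh_of :: "(real ^ 'n) set \<Rightarrow> (real ^ 'n) set set \<Rightarrow> bool" where
  "mesh_of \<Omega> \<T> \<longleftrightarrow>
     finite \<T> \<and> (\<forall>K \<in> \<T>. parallelepiped K) \<and> \<Union>\<T> = closure \<Omega> \<and>
     (\<forall>K \<in> \<T>. \<forall>K' \<in> \<T>. (K \<inter> K') face_of K \<and> (K \<inter> K') face_of K')"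

definition mesh_size :: "(real ^ 'n) set set \<Rightarrow> real" where
  "mesh_size \<T> = Max (diameter ` \<T>)"

text \<open>Shape regularity and quasi-uniformity with a common constant \<open>\<gamma>\<close>.\<close>

definition mesh_regular :: "real \<Rightarrow> (real ^ 'n) set set \<Rightarrow> bool" where
  "mesh_regular \<gamma> \<T> \<longleftrightarrow>
     (\<forall>K \<in> \<T>. (\<exists>x r. 0 < r \<and> cball x r \<subseteq> K \<and> diameter K \<le> \<gamma> * r) \<and>
               mesh_size \<T> \<le> \<gamma> * diameter K)"

definition mesh_refines :: "(real ^ 'n) set set \<Rightarrow> (real ^ 'n) set set \<Rightarrow> bool" where
  "mesh_refines \<T>h \<T>H \<longleftrightarrow> (\<forall>K \<in> \<T>h. \<exists>K' \<in> \<T>H. K \<subseteq> K')"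

definition mesh_vertices :: "(real ^ 'n) set set \<Rightarrow> (real ^ 'n) set" where
  "mesh_vertices \<T> = (\<Union>K \<in> \<T>. {x. x extreme_point_of K})"


section \<open>First-order finite elements\<close>

text \<open>
  On \<open>K\<close>, the function is a polynomial of degree at most one in each variable (a linear
  combination of the square-free monomials) in the coordinates of the reference cube.
\<close>

definition Q1_on :: "(real ^ 'n) set \<Rightarrow> (real ^ 'n \<Rightarrow> real) \<Rightarrow> bool" where
  "Q1_on K v \<longleftrightarrow>
     (\<exists>b (B :: real ^ 'n ^ 'n) (c :: 'n set \<Rightarrow> real).
        invertible B \<and> K = (\<lambda>y. b + B *v y) ` cbox 0 1 \<and>
        (\<forall>y \<in> cbox 0 1. v (b + B *v y) = (\<Sum>J \<in> UNIV. c J * (\<Prod>i \<in> J. y $ i))))"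

text \<open>
  Functions on the closed domain are represented by their extension by zero, so that equality
  of functions is equality on the domain.
\<close>

definition Q1_space :: "(real ^ 'n) set set \<Rightarrow> (real ^ 'n \<Rightarrow> real) set" where
  "Q1_space \<T> =
     {v. continuous_on (\<Union>\<T>) v \<and> (\<forall>K \<in> \<T>. Q1_on K v) \<and> (\<forall>x. x \<notin> \<Union>\<T> \<longrightarrow> v x = 0)}"

definition nodal_interp ::
  "(real ^ 'n) set set \<Rightarrow> (real ^ 'n \<Rightarrow> real) \<Rightarrow> real ^ 'n \<Rightarrow> real" where
  "nodal_interp \<T> w = (THE v. v \<in> Q1_space \<T> \<and> (\<forall>z \<in> mesh_vertices \<T>. v z = w z))"

definition nodal_basis :: "(real ^ 'n) set set \<Rightarrow> real ^ 'n \<Rightarrow> real ^ 'n \<Rightarrow> real" where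
  "nodal_basis \<T> z = nodal_interp \<T> (\<lambda>x. if x = z then 1 else 0)"

definition fe_space :: "(real ^ 'n) set \<Rightarrow> (real ^ 'n) set set \<Rightarrow> (real ^ 'n \<Rightarrow> real) set" where
  "fe_space \<Omega> \<T> = {v \<in> Q1_space \<T>. \<forall>x \<in> frontier \<Omega>. v x = 0}"

definition supp :: "(real ^ 'n \<Rightarrow> real) \<Rightarrow> (real ^ 'n) set" where
  "supp v = closure {x. v x \<noteq> 0}"

definition fe_space_on ::
  "(real ^ 'n) set \<Rightarrow> (real ^ 'n) set set \<Rightarrow> (real ^ 'n) set \<Rightarrow> (real ^ 'n \<Rightarrow> real) set" where
  "fe_space_on \<Omega> \<T> S = {v \<in> fe_space \<Omega> \<T>. supp v \<subseteq> closure S}"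

definition patch :: "(real ^ 'n) set set \<Rightarrow> (real ^ 'n) set \<Rightarrow> (real ^ 'n) set" where
  "patch \<T> \<omega> = interior (\<Union>{K \<in> \<T>. K \<inter> closure \<omega> \<noteq> {}})"

definition patches :: "(real ^ 'n) set set \<Rightarrow> nat \<Rightarrow> (real ^ 'n) set \<Rightarrow> (real ^ 'n) set" where
  "patches \<T> l \<omega> = (patch \<T> ^^ l) \<omega>"


section \<open>Time discretization\<close>

definition dtt ::
  "real \<Rightarrow> (nat \<Rightarrow> real ^ 'n \<Rightarrow> real) \<Rightarrow> nat \<Rightarrow> real ^ 'n \<Rightarrow> real" where
  "dtt \<tau> z n = (\<lambda>x. (z (n + 1) x - 2 * z n x + z (n - 1) x) / \<tau>\<^sup>2)"

definition tavg :: "(nat \<Rightarrow> real ^ 'n \<Rightarrow> real) \<Rightarrow> nat \<Rightarrow> real ^ 'n \<Rightarrow> real" where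
  "tavg z n = (\<lambda>x. (z (n + 1) x + 2 * z n x + z (n - 1) x) / 4)"

text \<open>In the next three definitions, the index \<open>n\<close> stands for the half step \<open>n + 1/2\<close>.\<close>

definition half_step :: "(nat \<Rightarrow> real ^ 'n \<Rightarrow> real) \<Rightarrow> nat \<Rightarrow> real ^ 'n \<Rightarrow> real" where
  "half_step z n = (\<lambda>x. (z (n + 1) x + z n x) / 2)"

definition half_diff ::
  "real \<Rightarrow> (nat \<Rightarrow> real ^ 'n \<Rightarrow> real) \<Rightarrow> nat \<Rightarrow> real ^ 'n \<Rightarrow> real" where
  "half_diff \<tau> z n = (\<lambda>x. (z (n + 1) x - z n x) / \<tau>)"

definition energy_norm ::
  "(real ^ 'n) set \<Rightarrow> (real ^ 'n \<Rightarrow> real) \<Rightarrow> real \<Rightarrow> (nat \<Rightarrow> real ^ 'n \<Rightarrow> real) \<Rightarrow> nat \<Rightarrow> real" where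
  "energy_norm \<Omega> A \<tau> z n =
     sqrt ((l2_norm \<Omega> (half_diff \<tau> z n))\<^sup>2 + (a_norm A \<Omega> (half_step z n))\<^sup>2)"

definition cn_equation ::
  "(real ^ 'n \<Rightarrow> real) \<Rightarrow> real \<Rightarrow> (real ^ 'n) set \<Rightarrow> (real ^ 'n \<Rightarrow> real) set \<Rightarrow>
   (nat \<Rightarrow> real ^ 'n \<Rightarrow> real) \<Rightarrow> (nat \<Rightarrow> real ^ 'n \<Rightarrow> real) \<Rightarrow> nat \<Rightarrow> bool" where
  "cn_equation A \<tau> S V f z n \<longleftrightarrow>
     (\<forall>v \<in> V. l2_inner S (dtt \<tau> z n) v + a_form A S (tavg z n) v = l2_inner S (tavg f n) v)"

text \<open>The initial data of the global scheme are \<open>u 0\<close> and \<open>u 1\<close>.\<close>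

definition global_cn ::
  "(real ^ 'n) set \<Rightarrow> (real ^ 'n \<Rightarrow> real) \<Rightarrow> (real ^ 'n) set set \<Rightarrow> real \<Rightarrow>
   (nat \<Rightarrow> real ^ 'n \<Rightarrow> real) \<Rightarrow> (nat \<Rightarrow> real ^ 'n \<Rightarrow> real) \<Rightarrow> bool" where
  "global_cn \<Omega> A \<T>h \<tau> f u \<longleftrightarrow>
     (\<forall>n. u n \<in> fe_space \<Omega> \<T>h) \<and> (\<forall>n\<ge>1. cn_equation A \<tau> \<Omega> (fe_space \<Omega> \<T>h) f u n)"

text \<open>
  The local problems are indexed by the vertices \<open>z\<close> of the coarse mesh. The local functions
  \<open>w k z n\<close> also carry the index \<open>k\<close> of the time interval between two resets, because at the
  two reset time steps the function is assigned once in each of the adjacent intervals. The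
  numbers of resets and of time steps between two resets are \<open>nper\<close> and \<open>nres\<close>.
\<close>

definition local_superposition ::
  "(real ^ 'n) set \<Rightarrow> (real ^ 'n \<Rightarrow> real) \<Rightarrow> (real ^ 'n) set set \<Rightarrow> (real ^ 'n) set set \<Rightarrow> real \<Rightarrow>
   nat \<Rightarrow> nat \<Rightarrow> nat \<Rightarrow> (nat \<Rightarrow> real ^ 'n \<Rightarrow> real) \<Rightarrow> (real ^ 'n \<Rightarrow> real) \<Rightarrow> (real ^ 'n \<Rightarrow> real) \<Rightarrow>
   (nat \<Rightarrow> real ^ 'n \<Rightarrow> real) \<Rightarrow> bool" where
  "local_superposition \<Omega> A \<T>H \<T>h \<tau> nres nper l f u0 u1 ub \<longleftrightarrow>
     ub 0 = u0 \<and> ub 1 = u1 \<and>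
     (\<exists>w :: nat \<Rightarrow> real ^ 'n \<Rightarrow> nat \<Rightarrow> real ^ 'n \<Rightarrow> real. \<forall>k<nper. let m = k * nres in
        (\<forall>z \<in> mesh_vertices \<T>H.
           let \<Lambda> = nodal_basis \<T>H z; S = patches \<T>h l (supp \<Lambda>);
               loc = (\<lambda>v. nodal_interp \<T>h (\<lambda>x. \<Lambda> x * v x))
           in w k z m = loc (ub m) \<and> w k z (m + 1) = loc (ub (m + 1)) \<and>
              (\<forall>n \<in> {m + 1..m + nres}.
                 w k z (n + 1) \<in> fe_space_on \<Omega> \<T>h S \<and>
                 cn_equation A \<tau> S (fe_space_on \<Omega> \<T>h S) (\<lambda>j. loc (f j)) (w k z) n)) \<and>
        (\<forall>n \<in> {m + 2..m + nres + 1}. ub n = (\<lambda>x. \<Sum>z \<in> mesh_vertices \<T>H. w k z n x)))"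

end

theory Submission
  imports Defs
begin

text \<open>
  One time step of the scheme reads \<open>B(W, v) = (R, v)\<close> with \<open>B = (\<cdot>, \<cdot>) + \<tau>\<^sup>2 / 4 a\<close>,
  \<open>W = z\<^sup>n\<^sup>+\<^sup>1 + 2 z\<^sup>n + z\<^sup>n\<^sup>-\<^sup>1\<close> and \<open>R\<close> given by known quantities. In nodal coordinates \<open>B\<close> is a
  symmetric sparse form of condition number \<open>O((1 + \<tau> / h)\<^sup>2)\<close>. Weighting the nodes by \<open>exp (\<mu> d)\<close>, where
  \<open>d\<close> counts the fine layers from the support of a coarse hat function, perturbs \<open>B\<close> only by the factors
  \<open>cosh (\<mu> (d p - d q)) - 1 = O(\<mu>\<^sup>2)\<close>, so the weighted norm of a local solution grows at most by a constant factor
  per step if \<open>\<mu>\<close> is a small multiple of the inverse of \<open>max (\<tau> / h) (h / \<tau>)\<close>. The local solutions therefore satisfy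
  the global equation up to a residual of size \<open>C\<^sup>n exp (- \<mu> l)\<close>, which is only seen by test functions near the
  boundary of the patch. Summing over the coarse vertices, the error solves the global scheme with this residual;
  as the scheme conserves energy, resets do not amplify the error. The remaining factors are powers of \<open>1 / h\<close>
  and \<open>max (\<tau> / h) (h / \<tau>)\<close> and are absorbed by the lower bound for \<open>l\<close>.
\<close>

section \<open>Multilinear shape functions on the unit cube\<close>

text \<open>Two circumstances shape the proof. The meshes are given as sets with a face condition,
  each element with charts of its own, and \<open>nodal_interp\<close> is a definite description; so
  no property of interpolants is available until the element shape functions are known to have
  chart-independent traces on common faces. The estimates, in turn, are carried out on nodal values.
  Membership in a patch space becomes the vanishing of nodal values, and weights and cut-offs
  multiply nodal values instead of functions; hence neither gradients of weights nor interpolation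
  errors of products have to be estimated. Only the decay rate \<open>\<mu>\<close> must have the
  right order, the inverse square root of the condition number. Every other constant enters the
  number of layers through its logarithm, which permits crude bounds: a Poincare inequality that
  loses powers of 1/h, and a growth factor per time step that ignores the energy balance of the
  local problems. Absorbing the mesh-independent constants requires |ln h| and |ln H| to stay away
  from 0, whence the bound \<open>H\<^sub>0\<close> on the coarse mesh size.\<close>

definition corners :: "(real ^ 'n) set" where
  "corners = {s. \<forall>i. s $ i = 0 \<or> s $ i = 1}"

text \<open>Indexing the vertices of the cube by sets of coordinates lets \<open>prod_add\<close>
  expand a product of two-term factors into a sum over vertices.\<close>

definition corner :: "'n set \<Rightarrow> real ^ 'n" where
  "corner S = (\<chi> i. if i \<in> S then 1 else 0)"

text \<open>The Q1 Lagrange basis function of the corner \<open>s\<close>, in one formula instead of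
  a case distinction on the coordinates of \<open>s\<close>.\<close>

definition cweight :: "real ^ 'n \<Rightarrow> real ^ 'n \<Rightarrow> real" where
  "cweight s y = (\<Prod>i\<in>UNIV. s $ i * y $ i + (1 - s $ i) * (1 - y $ i))"

lemma corner_nth [simp]: "corner S $ i = (if i \<in> S then 1 else 0)"
  by (simp add: corner_def)

lemma bij_betw_corner: "bij_betw corner UNIV (corners :: (real ^ 'n) set)"
  unfolding bij_betw_def
proof
  show "inj (corner :: 'n set \<Rightarrow> _)"
  proof (rule injI)
    fix S S' :: "'n set"
    assume "corner S = corner S'"
    hence "\<And>i. corner S $ i = corner S' $ i"
      by simp
    thus "S = S'"
      by (auto split: if_splits) (metis one_neq_zero)+
  qed
  show "range (corner :: 'n set \<Rightarrow> _) = corners"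
  proof
    show "corners \<subseteq> range (corner :: 'n set \<Rightarrow> _)"
    proof
      fix s :: "real ^ 'n" assume "s \<in> corners"
      hence "s = corner {i. s $ i = 1}"
        by (auto simp: corners_def vec_eq_iff)
      thus "s \<in> range corner" by blast
    qed
  qed (auto simp: corners_def)
qed

lemma sum_corners: "(\<Sum>s\<in>corners. f s) = (\<Sum>S\<in>UNIV. f (corner S))"
  using sum.reindex_bij_betw[OF bij_betw_corner] by metis

lemma finite_corners [simp]: "finite (corners :: (real ^ 'n) set)"
  using bij_betw_finite[OF bij_betw_corner] by simp

lemma card_corners: "card (corners :: (real ^ 'n) set) = 2 ^ CARD('n)"
  using bij_betw_same_card[OF bij_betw_corner, symmetric] card_Pow[of "UNIV :: 'n set"] by simp

lemma cweight_corner: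
  "cweight (corner S) y = (\<Prod>i\<in>S. y $ i) * (\<Prod>i\<in>-S. 1 - y $ i)"
proof -
  have "cweight (corner S) y = (\<Prod>i\<in>UNIV. if i \<in> S then y $ i else 1 - y $ i)"
    unfolding cweight_def by (intro prod.cong) auto
  also have "\<dots> = (\<Prod>i\<in>S. y $ i) * (\<Prod>i\<in>-S. 1 - y $ i)"
    by (simp add: prod.If_cases Collect_neg_eq)
  finally show ?thesis .
qed

text \<open>Write the factors as \<open>y $ i + 0\<close> for \<open>i\<close> in \<open>J\<close>
  and as 1 = \<open>y $ i + (1 - y $ i)\<close> otherwise, and expand: only the vertex sets that
  contain \<open>J\<close> survive. This passes from the monomial form in \<open>Q1_on\<close> to
  nodal values.\<close>

lemma monomial_eq_sum_cweight:
  fixes y :: "real ^ 'n"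
  shows "(\<Prod>i\<in>J. y $ i) = (\<Sum>s\<in>corners. (\<Prod>i\<in>J. s $ i) * cweight s y)"
proof -
  have prod_zero_one: "(\<Prod>i\<in>J. if i \<in> S then 1 else 0 :: real) = (if J \<subseteq> S then 1 else 0)"
    for S :: "'n set"
    by (auto simp: subset_eq intro: prod_zero prod.neutral)
  have "(\<Prod>i\<in>J. y $ i) = (\<Prod>i\<in>UNIV. y $ i + (if i \<in> J then 0 else 1 - y $ i))"
    by (rule prod.mono_neutral_cong_left) auto
  also have "\<dots> = (\<Sum>S\<in>UNIV. (\<Prod>i\<in>S. y $ i) * (\<Prod>i\<in>-S. if i \<in> J then 0 else 1 - y $ i))"
    by (subst prod_add) (auto simp: Compl_eq_Diff_UNIV)
  also have "\<dots> = (\<Sum>S\<in>UNIV. (\<Prod>i\<in>J. corner S $ i) * cweight (corner S) y)"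
  proof (rule sum.cong[OF refl])
    fix S :: "'n set"
    have "(\<Prod>i\<in>-S. if i \<in> J then 0 else 1 - y $ i) = (if J \<subseteq> S then \<Prod>i\<in>-S. 1 - y $ i else 0)"
      by (auto intro!: prod.cong prod_zero)
    thus "(\<Prod>i\<in>S. y $ i) * (\<Prod>i\<in>-S. if i \<in> J then 0 else 1 - y $ i)
        = (\<Prod>i\<in>J. corner S $ i) * cweight (corner S) y"
      by (simp add: cweight_corner prod_zero_one)
  qed
  finally show ?thesis by (simp only: sum_corners)
qed

lemma sum_cweight: "(\<Sum>s\<in>corners. cweight s y) = 1"
  using monomial_eq_sum_cweight[of y "{}"] by simp

text \<open>The converse conversion, which exhibits nodal sums as functions of the form demanded by
  \<open>Q1_on\<close>.\<close>

lemma cweight_eq_sum_monomials: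
  "cweight s y = (\<Sum>J\<in>UNIV. ((\<Prod>i\<in>J. 2 * s $ i - 1) * (\<Prod>i\<in>-J. 1 - s $ i)) * (\<Prod>i\<in>J. y $ i))"
proof -
  have "cweight s y = (\<Prod>i\<in>UNIV. (2 * s $ i - 1) * y $ i + (1 - s $ i))"
    unfolding cweight_def by (intro prod.cong refl) (simp add: algebra_simps)
  thus ?thesis
    by (subst (asm) prod_add) (auto simp: Compl_eq_Diff_UNIV prod.distrib mult_ac)
qed

lemma cweight_corners:
  assumes "s \<in> corners" "s' \<in> corners"
  shows "cweight s s' = (if s = s' then 1 else 0)"
proof (cases "s = s'")
  case True
  moreover have "s $ i * s $ i + (1 - s $ i) * (1 - s $ i) = 1" for i
    using assms(1) unfolding corners_def by (cases "s $ i = 0") auto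
  ultimately show ?thesis
    by (simp add: cweight_def)
next
  case False
  then obtain i where "s $ i \<noteq> s' $ i"
    by (auto simp: vec_eq_iff)
  hence "s $ i * s' $ i + (1 - s $ i) * (1 - s' $ i) = 0"
  proof -
    have "s $ i = 0 \<or> s $ i = 1" "s' $ i = 0 \<or> s' $ i = 1"
      using assms by (auto simp: corners_def)
    thus ?thesis
      using \<open>s $ i \<noteq> s' $ i\<close> by (elim disjE) simp_all
  qed
  thus ?thesis using False
    by (auto simp: cweight_def intro!: prod_zero)
qed

lemma mem_unit_cube: "y \<in> cbox 0 (1 :: real ^ 'n) \<longleftrightarrow> (\<forall>i. 0 \<le> y $ i \<and> y $ i \<le> 1)"
  by (auto simp: mem_box_cart)

lemma corners_subset_cube: "corners \<subseteq> cbox 0 (1 :: real ^ 'n)"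
proof
  fix s :: "real ^ 'n" assume "s \<in> corners"
  hence "0 \<le> s $ i \<and> s $ i \<le> 1" for i
    unfolding corners_def by (cases "s $ i = 0") auto
  thus "s \<in> cbox 0 1" by (simp add: mem_unit_cube)
qed

lemma cfactor_bounds:
  fixes s y :: real
  assumes "0 \<le> s" "s \<le> 1" "0 \<le> y" "y \<le> 1"
  shows "0 \<le> s * y + (1 - s) * (1 - y)" "s * y + (1 - s) * (1 - y) \<le> 1"
proof -
  show "0 \<le> s * y + (1 - s) * (1 - y)"
    using assms by simp
  have "s * y + (1 - s) * (1 - y) \<le> s * 1 + (1 - s) * 1"
    using assms by (intro add_mono mult_left_mono) auto
  thus "s * y + (1 - s) * (1 - y) \<le> 1" by simp
qed

lemma cweight_nonneg:
  assumes "s \<in> corners" "y \<in> cbox 0 (1 :: real ^ 'n)"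
  shows "0 \<le> cweight s y"
  using assms corners_subset_cube unfolding cweight_def
  by (intro prod_nonneg) (auto intro!: cfactor_bounds simp: mem_unit_cube subset_eq)

lemma cweight_le_1:
  assumes "s \<in> corners" "y \<in> cbox 0 (1 :: real ^ 'n)"
  shows "cweight s y \<le> 1"
  using assms corners_subset_cube unfolding cweight_def
  by (intro prod_le_1) (auto intro!: cfactor_bounds simp: mem_unit_cube subset_eq)

text \<open>A point with a coordinate strictly between 0 and 1 is the midpoint of a short segment
  along that axis. Conversely, a coordinate equal to 0 or 1 is shared by both ends of any segment in
  the cube that has the point in its interior.\<close>

lemma extreme_points_unit_cube: "{x. x extreme_point_of cbox 0 (1 :: real ^ 'n)} = corners"
proof (intro equalityI subsetI)
  fix y :: "real ^ 'n"
  assume y: "y \<in> {x. x extreme_point_of cbox 0 1}"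
  hence yc: "y \<in> cbox 0 1"
    by (simp add: extreme_point_of_def)
  show "y \<in> corners"
  proof (rule ccontr)
    assume "y \<notin> corners"
    then obtain i where i: "0 < y $ i" "y $ i < 1"
    proof -
      from \<open>y \<notin> corners\<close> obtain i where "y $ i \<noteq> 0" "y $ i \<noteq> 1"
        by (auto simp: corners_def)
      moreover have "0 \<le> y $ i" "y $ i \<le> 1"
        using yc by (auto simp: mem_unit_cube)
      ultimately show ?thesis
        using that[of i] by simp
    qed
    define e where "e = min (y $ i) (1 - y $ i)"
    have e: "0 < e" "e \<le> y $ i" "e \<le> 1 - y $ i"
      using i by (auto simp: e_def)
    have mem: "y - axis i e \<in> cbox 0 1" "y + axis i e \<in> cbox 0 1"
      using e yc by (auto simp: mem_unit_cube axis_def)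
    have ne: "y - axis i e \<noteq> y + axis i e"
      using e by (auto simp: vec_eq_iff axis_def)
    have "midpoint (y - axis i e) (y + axis i e) = y"
      by (simp add: midpoint_def flip: scaleR_2)
    hence "y \<in> open_segment (y - axis i e) (y + axis i e)"
      using ne by (metis midpoint_in_open_segment)
    thus False
      using y mem by (auto simp: extreme_point_of_def)
  qed
next
  fix s :: "real ^ 'n"
  assume s: "s \<in> corners"
  have "s \<notin> open_segment a b" if ab: "a \<in> cbox 0 1" "b \<in> cbox 0 1" for a b
  proof
    assume "s \<in> open_segment a b"
    then obtain t where t: "0 < t" "t < 1" "s = (1 - t) *\<^sub>R a + t *\<^sub>R b" "a \<noteq> b"
      by (auto simp: in_segment)
    have "a $ i = b $ i" for i
    proof -
      have eq: "s $ i = (1 - t) * a $ i + t * b $ i"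
        using t by simp
      have bd: "0 \<le> a $ i" "a $ i \<le> 1" "0 \<le> b $ i" "b $ i \<le> 1"
        using ab by (auto simp: mem_unit_cube)
      consider "s $ i = 0" | "s $ i = 1"
        using s by (auto simp: corners_def)
      thus ?thesis
      proof cases
        case 1
        hence "(1 - t) * a $ i = 0" "t * b $ i = 0"
          using eq t bd by (auto simp: add_nonneg_eq_0_iff)
        thus ?thesis using t by simp
      next
        case 2
        hence "(1 - t) * (1 - a $ i) + t * (1 - b $ i) = 0"
          using eq by (simp add: algebra_simps)
        hence "(1 - t) * (1 - a $ i) = 0" "t * (1 - b $ i) = 0"
          using t bd by (auto simp: add_nonneg_eq_0_iff)
        thus ?thesis using t by simp
      qed
    qed
    thus False using t by (simp add: vec_eq_iff)
  qed
  thus "s \<in> {x. x extreme_point_of cbox 0 1}"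
    using s corners_subset_cube by (auto simp: extreme_point_of_def)
qed

text \<open>The two corners of an edge in direction \<open>j\<close> share all factors but the \<open>j\<close>-th, and the
  derivative of that factor is plus or minus one.\<close>

lemma sum_cweight_deriv:
  fixes g :: "real ^ 'n \<Rightarrow> real" and y :: "real ^ 'n"
  shows "(\<Sum>s\<in>corners. g s * ((2 * s $ j - 1) * (\<Prod>i\<in>-{j}. s $ i * y $ i + (1 - s $ i) * (1 - y $ i))))
       = (\<Sum>s\<in>corners. (g (\<chi> i. if i = j then 1 else s $ i) - g (\<chi> i. if i = j then 0 else s $ i))
             * cweight s y)"
proof -
  define P where "P s = (\<Prod>i\<in>-{j}. s $ i * y $ i + (1 - s $ i) * (1 - y $ i))" for s :: "real ^ 'n"
  have cw: "cweight s y = (s $ j * y $ j + (1 - s $ j) * (1 - y $ j)) * P s" for s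
    unfolding cweight_def P_def by (subst prod.remove[of _ j]) (auto simp: Compl_eq_Diff_UNIV)
  define A where "A = {S :: 'n set. j \<notin> S}"
  have UN: "(UNIV :: 'n set set) = A \<union> insert j ` A"
  proof -
    have "S \<in> insert j ` A" if "j \<in> S" for S
      using that by (intro image_eqI[of _ _ "S - {j}"]) (auto simp: A_def)
    thus ?thesis by (auto simp: A_def)
  qed
  have split: "(\<Sum>s\<in>corners. f s) = (\<Sum>S\<in>A. f (corner S) + f (corner (insert j S)))"
    for f :: "real ^ 'n \<Rightarrow> real"
  proof -
    have inj: "inj_on (insert j) A"
      by (auto simp: inj_on_def A_def insert_ident)
    have "(\<Sum>s\<in>corners. f s) = (\<Sum>S\<in>A. f (corner S)) + (\<Sum>S\<in>insert j ` A. f (corner S))"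
      unfolding sum_corners UN by (rule sum.union_disjoint) (auto simp: A_def)
    thus ?thesis
      by (simp add: sum.reindex[OF inj] sum.distrib)
  qed
  have P_insert: "P (corner (insert j S)) = P (corner S)" for S
    unfolding P_def by (intro prod.cong) auto
  have c1: "(\<chi> i. if i = j then 1 else corner S $ i) = corner (insert j S)"
    and c0: "(\<chi> i. if i = j then 0 else corner S $ i) = corner (S - {j})" for S
    by (auto simp: vec_eq_iff)
  \<comment> \<open>The weights of the two ends of an edge in direction \<open>j\<close> add up to
    their common factor \<open>P\<close>, so the difference along the edge may be attached to both
    ends.\<close>
  show ?thesis
    unfolding split P_def[symmetric]
    by (intro sum.cong refl, unfold c0 c1 cw P_insert)
       (auto simp: A_def P_insert algebra_simps)
qed


section \<open>Parallelepipeds in affine coordinates\<close>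

definition chart :: "real ^ 'n \<Rightarrow> real ^ 'n ^ 'n \<Rightarrow> real ^ 'n \<Rightarrow> real ^ 'n" where
  "chart b B y = b + B *v y"

definition coords :: "real ^ 'n \<Rightarrow> real ^ 'n ^ 'n \<Rightarrow> real ^ 'n \<Rightarrow> real ^ 'n" where
  "coords b B x = matrix_inv B *v (x - b)"

context
  fixes b :: "real ^ 'n" and B :: "real ^ 'n ^ 'n"
  assumes B: "invertible B"
begin

lemma matrix_inv_inverse: "B ** matrix_inv B = mat 1" "matrix_inv B ** B = mat 1"
  using someI_ex[OF B[unfolded invertible_def]] by (simp_all add: matrix_inv_def)

lemma coords_chart [simp]: "coords b B (chart b B y) = y"
  using matrix_inv_inverse(2) by (simp add: coords_def chart_def matrix_vector_mul_assoc)

lemma chart_coords [simp]: "chart b B (coords b B x) = x"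
  using matrix_inv_inverse(1) by (simp add: coords_def chart_def matrix_vector_mul_assoc)

lemma coords_eq_iff: "coords b B x = coords b B x' \<longleftrightarrow> x = x'"
  by (metis chart_coords)

text \<open>Affinity in a form of which points on segments, reflections and combinations of edge
  vectors are all instances.\<close>

lemma coords_add_scaled_diff:
  "coords b B (x + t *\<^sub>R (z - w)) = coords b B x + t *\<^sub>R (coords b B z - coords b B w)"
proof -
  have "x + t *\<^sub>R (z - w) - b = (x - b) + t *\<^sub>R ((z - b) - (w - b))"
    by simp
  thus ?thesis
    unfolding coords_def
    by (simp only: matrix_vector_right_distrib matrix_vector_mult_diff_distrib
          matrix_vector_mult_scaleR)
qed

lemma mem_chart_image_iff: "x \<in> chart b B ` S \<longleftrightarrow> coords b B x \<in> S"
  by (metis coords_chart chart_coords image_iff)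

lemma chart_add_scaled_diff:
  "chart b B (x + t *\<^sub>R (z - w)) = chart b B x + t *\<^sub>R (chart b B z - chart b B w)"
  by (metis coords_add_scaled_diff coords_chart chart_coords)

lemma chart_mem_open_segment_iff:
  "chart b B y \<in> open_segment (chart b B u) (chart b B v) \<longleftrightarrow> y \<in> open_segment u v"
proof -
  have eq: "(1 - t) *\<^sub>R u' + t *\<^sub>R v' = u' + t *\<^sub>R (v' - u')" for t and u' v' :: "real ^ 'n"
    by (simp add: algebra_simps)
  show ?thesis
    unfolding in_segment eq chart_add_scaled_diff[symmetric] by (metis coords_chart)
qed

lemma extreme_point_chart_iff:
  "chart b B y extreme_point_of chart b B ` S \<longleftrightarrow> y extreme_point_of S"
  by (auto simp: extreme_point_of_def chart_mem_open_segment_iff mem_chart_image_iff)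

lemma vertices_chart_cube:
  "{x. x extreme_point_of chart b B ` cbox 0 1} = chart b B ` corners"
proof -
  have "x extreme_point_of chart b B ` cbox 0 1 \<longleftrightarrow> x \<in> chart b B ` corners" for x
  proof -
    have "x extreme_point_of chart b B ` cbox 0 1 \<longleftrightarrow> coords b B x extreme_point_of cbox 0 1"
      using extreme_point_chart_iff[of "coords b B x"] by simp
    also have "\<dots> \<longleftrightarrow> coords b B x \<in> corners"
      using extreme_points_unit_cube[where 'n = 'n] by blast
    finally show ?thesis
      by (simp add: mem_chart_image_iff)
  qed
  thus ?thesis by blast
qed

lemma extreme_point_chart_cube_iff:
  "x extreme_point_of chart b B ` cbox 0 1 \<longleftrightarrow> coords b B x \<in> corners"
  using vertices_chart_cube mem_chart_image_iff[of x corners] by blast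

lemma convex_chart_cube: "convex (chart b B ` cbox 0 1)"
proof -
  have "chart b B = (+) b \<circ> (*v) B"
    by (auto simp: chart_def)
  thus ?thesis
    by (metis image_comp convex_translation convex_linear_image
        matrix_vector_mul_linear convex_box(1))
qed

end

text \<open>The chart is a parameter because the value depends on it at first sight;
  \<open>pweight_agree\<close> removes this dependence, also between neighbouring elements.\<close>

definition pweight ::
  "real ^ 'n \<Rightarrow> real ^ 'n ^ 'n \<Rightarrow> real ^ 'n \<Rightarrow> real ^ 'n \<Rightarrow> real" where
  "pweight b B p x = cweight (coords b B p) (coords b B x)"

text \<open>Only the distances to the corner enter, so reflecting and permuting the coordinates does
  not change the weight. This is what makes different charts comparable.\<close>

lemma cweight_eq_prod_dist:
  fixes s y :: "real ^ 'n"
  assumes "s \<in> corners" "y \<in> cbox 0 1"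
  shows "cweight s y = (\<Prod>i\<in>UNIV. 1 - \<bar>y $ i - s $ i\<bar>)"
  unfolding cweight_def
proof (intro prod.cong refl)
  fix i
  have "s $ i = 0 \<or> s $ i = 1" "0 \<le> y $ i" "y $ i \<le> 1"
    using assms by (auto simp: corners_def mem_unit_cube)
  thus "s $ i * y $ i + (1 - s $ i) * (1 - y $ i) = 1 - \<bar>y $ i - s $ i\<bar>"
    by auto
qed

text \<open>Extend the segment from the corner \<open>s\<close> through \<open>y\<close> until it leaves the cube.\<close>

lemma cweight_nonzero_segment:
  fixes s y :: "real ^ 'n"
  assumes s: "s \<in> corners" and y: "y \<in> cbox 0 1" and nz: "cweight s y \<noteq> 0" and ne: "y \<noteq> s"
  shows "\<exists>q\<in>cbox 0 1. y \<in> open_segment s q"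
proof -
  \<comment> \<open>Seen from \<open>s\<close>, the opposite faces of the cube are at distance 1. A
    non-zero weight means that no coordinate of \<open>y\<close> has reached one of them, so
    \<open>m < 1\<close> and stretching by \<open>1 / m\<close> leads to a point of the cube beyond
    \<open>y\<close>.\<close>
  define m where "m = Max (range (\<lambda>i. \<bar>y $ i - s $ i\<bar>))"
  have ge: "\<bar>y $ i - s $ i\<bar> \<le> m" for i
    unfolding m_def by (intro Max_ge) auto
  have "m \<in> range (\<lambda>i. \<bar>y $ i - s $ i\<bar>)"
    unfolding m_def by (intro Max_in) auto
  then obtain k where k: "m = \<bar>y $ k - s $ k\<bar>" by blast
  have sc: "s $ i = 0 \<or> s $ i = 1" "0 \<le> y $ i" "y $ i \<le> 1" for i
    using s y by (auto simp: corners_def mem_unit_cube)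
  have "m \<le> 1" using sc[of k] k by auto
  moreover have "1 - \<bar>y $ k - s $ k\<bar> \<noteq> 0"
    using nz unfolding cweight_eq_prod_dist[OF s y] by (metis prod_zero finite UNIV_I)
  ultimately have m1: "m < 1" using k by auto
  obtain j where "y $ j \<noteq> s $ j" using ne by (auto simp: vec_eq_iff)
  hence m0: "0 < m" using ge[of j] by auto
  define q where "q = s + (1 / m) *\<^sub>R (y - s)"
  have "q \<in> cbox 0 1"
    unfolding mem_unit_cube
  proof
    fix i
    have "(y $ i - s $ i) / m \<le> 1" "- 1 \<le> (y $ i - s $ i) / m"
      using ge[of i] m0 by (simp_all add: field_simps)
    moreover have "(s $ i = 0 \<longrightarrow> 0 \<le> (y $ i - s $ i) / m) \<and> (s $ i = 1 \<longrightarrow> (y $ i - s $ i) / m \<le> 0)"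
      using sc[of i] m0 by (auto simp: divide_le_0_iff)
    ultimately show "0 \<le> q $ i \<and> q $ i \<le> 1"
      using sc(1)[of i] by (auto simp: q_def)
  qed
  moreover have "y = (1 - m) *\<^sub>R s + m *\<^sub>R q"
    using m0 by (simp add: q_def algebra_simps)
  moreover have "s \<noteq> q"
    using m0 ne by (simp add: q_def)
  ultimately show ?thesis
    using m0 m1 by (auto simp: in_segment)
qed

lemma pweight_nonzero_segment:
  assumes B: "invertible B" and K: "K = chart b B ` cbox 0 1"
    and p: "p extreme_point_of K" and x: "x \<in> K" and "pweight b B p x \<noteq> 0" "x \<noteq> p"
  obtains q where "q \<in> K" "x \<in> open_segment p q"
proof -
  have "coords b B p \<in> corners" "coords b B x \<in> cbox 0 1"
    using p x B K by (auto simp: extreme_point_chart_cube_iff)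
  then obtain q where q: "q \<in> cbox 0 1" "coords b B x \<in> open_segment (coords b B p) q"
    using cweight_nonzero_segment[of "coords b B p" "coords b B x"] assms
    by (auto simp: pweight_def coords_eq_iff)
  hence "x \<in> open_segment p (chart b B q)"
    using chart_mem_open_segment_iff[OF B, of b "coords b B x" "coords b B p" q] B by simp
  thus ?thesis using that q K by blast
qed

text \<open>With a non-zero weight, \<open>x\<close> would be interior to a segment of
  \<open>K\<close> that starts at \<open>p\<close>, and the face property would pull
  \<open>p\<close> into \<open>K'\<close>.\<close>

lemma pweight_zero_outside_face:
  assumes B: "invertible B" and K: "K = chart b B ` cbox 0 1"
    and face: "(K \<inter> K') face_of K" and p: "p extreme_point_of K" "p \<notin> K'" and x: "x \<in> K \<inter> K'"
  shows "pweight b B p x = 0"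
proof (rule ccontr)
  assume "pweight b B p x \<noteq> 0"
  then obtain q where "q \<in> K" "x \<in> open_segment p q"
    using pweight_nonzero_segment[OF B K p(1)] x p(2) by blast
  moreover have "p \<in> K" using p by (simp add: extreme_point_of_def)
  ultimately show False
    using face_ofD[OF face _ _ _ x] p(2) by blast
qed

text \<open>A neighbouring element \<open>K'\<close> sees the same edges of the common face at \<open>p\<close>, because edges
  are the segments between vertices whose midpoint lies on no other segment between vertices;
  and the weight of \<open>p\<close> at \<open>x\<close> depends only on the coefficients of \<open>x - p\<close> in the edges at \<open>p\<close>.\<close>

lemma pweight_agree:
  fixes b b' :: "real ^ 'n"
  assumes B: "invertible B" and K: "K = chart b B ` cbox 0 1"
    and B': "invertible B'" and K': "K' = chart b' B' ` cbox 0 1"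
    and face: "(K \<inter> K') face_of K" and face': "(K \<inter> K') face_of K'"
    and p: "p extreme_point_of K" "p \<in> K'" and x: "x \<in> K \<inter> K'"
  shows "pweight b B p x = pweight b' B' p x"
proof -
  let ?cr = "coords b B" and ?cr' = "coords b' B'"
  define F where "F = K \<inter> K'"
  have segment_eq: "(1 - t) *\<^sub>R u + t *\<^sub>R v = u + t *\<^sub>R (v - u)" for t and u v :: "real ^ 'n"
    by (simp add: algebra_simps)
  have convF: "convex F" using face face_of_imp_convex F_def by blast
  have inK: "z \<in> K \<longleftrightarrow> (\<forall>i. 0 \<le> ?cr z $ i \<and> ?cr z $ i \<le> 1)" for z
    by (simp add: K mem_chart_image_iff[OF B] mem_unit_cube)
  have inK': "z \<in> K' \<longleftrightarrow> (\<forall>i. 0 \<le> ?cr' z $ i \<and> ?cr' z $ i \<le> 1)" for z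
    by (simp add: K' mem_chart_image_iff[OF B'] mem_unit_cube)
  have exF: "z extreme_point_of K \<and> z \<in> F \<longleftrightarrow> z extreme_point_of K' \<and> z \<in> F" for z
    using extreme_point_of_face[OF face] extreme_point_of_face[OF face'] F_def by blast
  have pF: "p \<in> F" using p by (auto simp: F_def extreme_point_of_def)
  have xF: "x \<in> F" using x F_def by simp
  have pc: "?cr p $ i = 0 \<or> ?cr p $ i = 1" for i
    using p(1) by (simp add: K extreme_point_chart_cube_iff[OF B] corners_def)
  have pc': "?cr' p $ i = 0 \<or> ?cr' p $ i = 1" for i
    using exF[of p] p(1) pF by (simp add: K' extreme_point_chart_cube_iff[OF B'] corners_def)
  define c where "c i = \<bar>?cr x $ i - ?cr p $ i\<bar>" for i
  define c' where "c' i = \<bar>?cr' x $ i - ?cr' p $ i\<bar>" for i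
  have cx: "?cr x $ i - ?cr p $ i = (1 - 2 * ?cr p $ i) * c i" for i
    using pc[of i] xF by (auto simp: c_def F_def inK)
  have c1: "c i \<le> 1" for i
    using pc[of i] xF by (auto simp: c_def F_def inK)
  \<comment> \<open>The other end of the edge of \<open>K\<close> at \<open>p\<close> in direction
    \<open>i\<close>.\<close>
  define n where "n i = chart b B (?cr p + (1 - 2 * ?cr p $ i) *\<^sub>R axis i 1)" for i
  have crn: "?cr (n i) = ?cr p + (1 - 2 * ?cr p $ i) *\<^sub>R axis i 1" for i
    by (simp add: n_def B)
  have crn_nth: "?cr (n i) $ j = (if j = i then 1 - ?cr p $ i else ?cr p $ j)" for i j
    by (simp add: crn axis_def)
  have nK: "n i \<in> K" for i
    using pc by (auto simp: inK crn_nth) (metis add_0 diff_ge_0_iff_ge order.refl zero_le_one)+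
  have n_ext: "n i extreme_point_of K" for i
  proof -
    have "?cr (n i) $ j = 0 \<or> ?cr (n i) $ j = 1" for j
      using pc[of j] by (auto simp: crn_nth)
    thus ?thesis
      by (simp add: K extreme_point_chart_cube_iff[OF B] corners_def)
  qed
  have n_ne: "n i \<noteq> p" for i
  proof
    assume "n i = p"
    thus False using crn_nth[of i i] pc[of i] by auto
  qed
  have nF: "n i \<in> F" if "c i > 0" for i
  proof -
    \<comment> \<open>Halving makes room: the segment from \<open>n i\<close> through
      \<open>y\<close> can be prolonged inside \<open>K\<close> by the fraction
      \<open>c i / 2\<close>, which just keeps the \<open>i\<close>-th coordinate from passing
      \<open>p\<close>. As \<open>y\<close> lies in the face, so does \<open>n i\<close>.\<close>
    define y where "y = p + (1/2) *\<^sub>R (x - p)"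
    have yF: "y \<in> F"
    proof -
      have "y = (1 - 1/2) *\<^sub>R p + (1/2) *\<^sub>R x"
        using segment_eq[of "1/2" p x] by (simp add: y_def)
      thus ?thesis using convexD_alt[OF convF pF xF, of "1/2"] by simp
    qed
    have cry: "?cr y $ j = ?cr p $ j + (1 - 2 * ?cr p $ j) * (c j / 2)" for j
      using cx[of j] by (simp add: y_def coords_add_scaled_diff[OF B])
    define q where "q = y + (c i / 2) *\<^sub>R (y - n i)"
    have crq: "?cr q $ j = ?cr y $ j + (c i / 2) * (?cr y $ j - ?cr (n i) $ j)" for j
      by (simp add: q_def coords_add_scaled_diff[OF B])
    have "q \<in> K"
      unfolding inK
    proof
      fix j
      have cj: "0 \<le> c j" "c j \<le> 1" "0 \<le> c i" "c i \<le> 1"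
        using c1 by (auto simp: c_def)
      show "0 \<le> ?cr q $ j \<and> ?cr q $ j \<le> 1"
      proof (cases "j = i")
        case True
        have "0 \<le> c i / 2 - c i / 2 * (1 - c i / 2)"
          "c i / 2 - c i / 2 * (1 - c i / 2) \<le> 1"
          using cj mult_le_one[of "c i / 2" "c i / 2"] by (auto simp: algebra_simps)
        thus ?thesis
          using pc[of i] True by (auto simp: crq cry crn_nth algebra_simps)
      next
        case False
        have "0 \<le> c j / 2 + c i / 2 * (c j / 2)" "c j / 2 + c i / 2 * (c j / 2) \<le> 1"
          using cj mult_le_one[of "c i" "c j"] by (auto simp: algebra_simps)
        thus ?thesis
          using pc[of j] False by (auto simp: crq cry crn_nth algebra_simps)
      qed
    qed
    moreover have "y \<in> open_segment (n i) q"
    proof -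
      define t where "t = 1 / (1 + c i / 2)"
      have t: "0 < t" "t < 1" "t * (1 + c i / 2) = 1"
        using that by (auto simp: t_def)
      have "(1 - t) *\<^sub>R n i + t *\<^sub>R q = n i + (t * (1 + c i / 2)) *\<^sub>R (y - n i)"
        by (simp add: q_def algebra_simps)
      hence "y = (1 - t) *\<^sub>R n i + t *\<^sub>R q" using t by simp
      moreover have "n i \<noteq> q"
      proof
        assume "n i = q"
        hence "(1 + c i / 2) *\<^sub>R (y - n i) = 0"
          by (simp add: q_def algebra_simps)
        hence "y = n i" using that by auto
        hence "?cr y $ i = ?cr (n i) $ i" by simp
        thus False
          using pc[of i] c1[of i] that by (auto simp: cry crn_nth)
      qed
      ultimately show ?thesis using t by (auto simp: in_segment)
    qed
    ultimately show ?thesis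
      using face_ofD[OF face, of y "n i" q] yF nK by (auto simp: F_def)
  qed
  have n_ext': "n i extreme_point_of K'" if "c i > 0" for i
    using exF[of "n i"] nF[OF that] n_ext by simp
  have nc': "?cr' (n i) $ j = 0 \<or> ?cr' (n i) $ j = 1" if "c i > 0" for i j
    using n_ext'[OF that] by (simp add: K' extreme_point_chart_cube_iff[OF B'] corners_def)
  have unique: "j1 = j2"
    if ci: "c i > 0" and d1: "?cr' (n i) $ j1 \<noteq> ?cr' p $ j1" and d2: "?cr' (n i) $ j2 \<noteq> ?cr' p $ j2"
    for i j1 j2
  proof (rule ccontr)
    \<comment> \<open>If \<open>n i\<close> differed from \<open>p\<close> in two coordinates of
      \<open>K'\<close>, then \<open>p\<close>, \<open>q1\<close>, \<open>n i\<close>,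
      \<open>q2\<close> would form a parallelogram in \<open>K'\<close> whose centre lies in the
      face; so \<open>q1\<close> and \<open>q2\<close> would lie in \<open>K\<close>. There their
      coordinates other than the \<open>i\<close>-th have mean 0 or 1, which forces
      \<open>q1\<close> onto the line through \<open>p\<close> and \<open>n i\<close>; but
      \<open>q1\<close> agrees with \<open>n i\<close> in \<open>j1\<close> and with
      \<open>p\<close> in \<open>j2\<close>.\<close>
    assume ne: "j1 \<noteq> j2"
    define \<delta> where "\<delta> = (?cr' (n i) $ j1 - ?cr' p $ j1) *\<^sub>R axis j1 (1 :: real)"
    define q1 where "q1 = chart b' B' (?cr' p + \<delta>)"
    define q2 where "q2 = chart b' B' (?cr' (n i) - \<delta>)"
    have cq1: "?cr' q1 $ j = (if j = j1 then ?cr' (n i) $ j1 else ?cr' p $ j)" for j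
      by (simp add: q1_def B' \<delta>_def axis_def)
    have cq2: "?cr' q2 $ j = (if j = j1 then ?cr' p $ j1 else ?cr' (n i) $ j)" for j
      by (simp add: q2_def B' \<delta>_def axis_def)
    have mem: "q1 \<in> K'" "q2 \<in> K'"
      using pF nF[OF ci] by (auto simp: F_def inK' cq1 cq2)
    have "q1 \<noteq> q2"
      using cq1[of j1] cq2[of j1] d1 by auto
    have q12: "q2 = n i + (- 1) *\<^sub>R (q1 - p)"
    proof -
      have "?cr' q2 = ?cr' (n i) + (- 1) *\<^sub>R (?cr' q1 - ?cr' p)"
        by (simp add: q1_def q2_def B')
      thus ?thesis
        using coords_eq_iff[OF B', of b' q2 "n i + (- 1) *\<^sub>R (q1 - p)"]
          coords_add_scaled_diff[OF B', of b' "n i" "- 1" q1 p] by simp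
    qed
    hence mid: "midpoint q1 q2 = midpoint p (n i)"
      by (simp add: midpoint_def algebra_simps)
    have "midpoint p (n i) \<in> F"
      using convexD_alt[OF convF pF nF[OF ci], of "1/2"]
      by (simp add: midpoint_def algebra_simps)
    hence "midpoint q1 q2 \<in> K \<inter> K'"
      by (simp add: mid F_def)
    moreover have "midpoint q1 q2 \<in> open_segment q1 q2"
      using \<open>q1 \<noteq> q2\<close> by simp
    ultimately have "q1 \<in> K" "q2 \<in> K"
      using face_ofD[OF face', of "midpoint q1 q2" q1 q2] mem by simp_all
    define lam where "lam = (1 - 2 * ?cr p $ i) * (?cr q1 $ i - ?cr p $ i)"
    have "?cr q1 = ?cr p + lam *\<^sub>R (?cr (n i) - ?cr p)"
    proof -
      have "?cr q1 $ j = ?cr p $ j + lam * (?cr (n i) $ j - ?cr p $ j)" for j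
      proof (cases "j = i")
        case True
        thus ?thesis using pc[of i] by (auto simp: crn_nth lam_def)
      next
        case False
        have "?cr q2 $ j = ?cr (n i) $ j - (?cr q1 $ j - ?cr p $ j)"
          unfolding q12 coords_add_scaled_diff[OF B] by simp
        hence "?cr q1 $ j + ?cr q2 $ j = 2 * ?cr p $ j"
          using False by (simp add: crn_nth)
        moreover have "0 \<le> ?cr q1 $ j" "?cr q1 $ j \<le> 1" "0 \<le> ?cr q2 $ j" "?cr q2 $ j \<le> 1"
          using \<open>q1 \<in> K\<close> \<open>q2 \<in> K\<close> by (auto simp: inK)
        ultimately show ?thesis
          using pc[of j] False by (auto simp: crn_nth)
      qed
      thus ?thesis by (simp add: vec_eq_iff)
    qed
    hence "q1 = p + lam *\<^sub>R (n i - p)"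
      using coords_eq_iff[OF B, of b q1 "p + lam *\<^sub>R (n i - p)"]
        coords_add_scaled_diff[OF B, of b p lam "n i" p] by simp
    hence eq: "?cr' q1 $ j = ?cr' p $ j + lam * (?cr' (n i) $ j - ?cr' p $ j)" for j
      by (simp add: coords_add_scaled_diff[OF B'])
    have "lam = 0" using eq[of j2] cq1[of j2] ne d2 by simp
    thus False using eq[of j1] cq1[of j1] d1 by simp
  qed
  have "\<exists>j. ?cr' (n i) $ j \<noteq> ?cr' p $ j" for i
    using n_ne[of i] coords_eq_iff[OF B', of b' "n i" p] by (auto simp: vec_eq_iff)
  \<comment> \<open>\<open>\<sigma>\<close> matches the edges of \<open>K\<close> at
    \<open>p\<close> with those of \<open>K'\<close>; only the indices with \<open>c i > 0\<close>
    matter, and on them it is injective.\<close>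
  then obtain \<sigma> where \<sigma>: "?cr' (n i) $ \<sigma> i \<noteq> ?cr' p $ \<sigma> i" for i
    by metis
  have crn': "?cr' (n i) - ?cr' p = (1 - 2 * ?cr' p $ \<sigma> i) *\<^sub>R axis (\<sigma> i) 1" if "c i > 0" for i
  proof -
    have "?cr' (n i) $ j - ?cr' p $ j = (if j = \<sigma> i then 1 - 2 * ?cr' p $ \<sigma> i else 0)" for j
      using unique[OF that, of j "\<sigma> i"] \<sigma>[of i] nc'[OF that, of "\<sigma> i"] pc'[of "\<sigma> i"]
      by (cases "j = \<sigma> i") auto
    thus ?thesis by (simp add: vec_eq_iff axis_def)
  qed
  define I where "I = {i. c i > 0}"
  have inj: "inj_on \<sigma> I"
  proof (rule inj_onI)
    fix i j assume ij: "i \<in> I" "j \<in> I" "\<sigma> i = \<sigma> j"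
    hence "?cr' (n i) = ?cr' (n j)"
      using crn'[of i] crn'[of j] unfolding I_def mem_Collect_eq
      by (metis (no_types) diff_add_cancel)
    hence "?cr (n i) = ?cr (n j)"
      by (simp add: coords_eq_iff[OF B'])
    hence "?cr (n j) $ i = 1 - ?cr p $ i"
      using crn_nth[of i i] by simp
    thus "i = j"
      using crn_nth[of j i] pc[of i] by (cases "i = j") auto
  qed
  \<comment> \<open>The identity holds in the chart of \<open>K\<close> by definition of
    \<open>c\<close>. It is a relation between \<open>x\<close>, \<open>p\<close> and the vertices
    \<open>n i\<close> themselves, so the affine chart of \<open>K'\<close> preserves it.\<close>
  have xsum: "?cr' x - ?cr' p = (\<Sum>i\<in>I. c i *\<^sub>R (?cr' (n i) - ?cr' p))"
  proof -
    have aff: "?cr' (p + (\<Sum>i\<in>J. c i *\<^sub>R (n i - p))) - ?cr' p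
        = (\<Sum>i\<in>J. c i *\<^sub>R (?cr' (n i) - ?cr' p))" if "finite J" for J
      using that
    proof (induction J)
      case (insert i J)
      have eq: "p + (\<Sum>i\<in>insert i J. c i *\<^sub>R (n i - p))
          = (p + (\<Sum>i\<in>J. c i *\<^sub>R (n i - p))) + c i *\<^sub>R (n i - p)"
        using insert(1,2) by (simp add: add_ac)
      show ?case
        unfolding eq coords_add_scaled_diff[OF B'] using insert by simp
    qed simp
    have aff0: "?cr (p + (\<Sum>i\<in>J. c i *\<^sub>R (n i - p))) - ?cr p
        = (\<Sum>i\<in>J. c i *\<^sub>R (?cr (n i) - ?cr p))" if "finite J" for J
      using that
    proof (induction J)
      case (insert i J)
      have eq: "p + (\<Sum>i\<in>insert i J. c i *\<^sub>R (n i - p))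
          = (p + (\<Sum>i\<in>J. c i *\<^sub>R (n i - p))) + c i *\<^sub>R (n i - p)"
        using insert(1,2) by (simp add: add_ac)
      show ?case
        unfolding eq coords_add_scaled_diff[OF B] using insert by simp
    qed simp
    have "(\<Sum>i\<in>I. c i *\<^sub>R (?cr (n i) - ?cr p)) = ?cr x - ?cr p"
    proof -
      have "(\<Sum>i\<in>I. c i * ((1 - 2 * ?cr p $ i) * (if j = i then 1 else 0))) = ?cr x $ j - ?cr p $ j" for j
        using cx[of j] by (cases "j \<in> I") (auto simp: I_def c_def if_distrib sum.delta' mult.commute cong: if_cong)
      thus ?thesis
        by (simp add: vec_eq_iff crn axis_def mult.assoc)
    qed
    hence "?cr (p + (\<Sum>i\<in>I. c i *\<^sub>R (n i - p))) = ?cr x"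
      using aff0[of I] by simp
    hence "p + (\<Sum>i\<in>I. c i *\<^sub>R (n i - p)) = x"
      by (simp add: coords_eq_iff[OF B])
    thus ?thesis using aff[of I] by simp
  qed
  have c'_nth: "c' j = \<bar>\<Sum>i\<in>I. c i * ((1 - 2 * ?cr' p $ \<sigma> i) * (if j = \<sigma> i then 1 else 0))\<bar>" for j
  proof -
    have "(\<Sum>i\<in>I. c i *\<^sub>R (?cr' (n i) - ?cr' p))
        = (\<Sum>i\<in>I. c i *\<^sub>R ((1 - 2 * ?cr' p $ \<sigma> i) *\<^sub>R axis (\<sigma> i) 1))"
      by (intro sum.cong refl) (simp add: crn' I_def)
    hence "(?cr' x - ?cr' p) $ j = (\<Sum>i\<in>I. c i *\<^sub>R ((1 - 2 * ?cr' p $ \<sigma> i) *\<^sub>R axis (\<sigma> i) 1)) $ j"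
      using xsum by simp
    thus ?thesis by (simp add: c'_def axis_def mult.assoc)
  qed
  have c'_\<sigma>: "c' (\<sigma> k) = c k" if "k \<in> I" for k
  proof -
    have "(\<Sum>i\<in>I. c i * ((1 - 2 * ?cr' p $ \<sigma> i) * (if \<sigma> k = \<sigma> i then 1 else 0)))
        = (\<Sum>i\<in>I. if i = k then c k * (1 - 2 * ?cr' p $ \<sigma> k) else 0)"
      using inj that by (intro sum.cong refl) (auto dest: inj_onD)
    thus ?thesis
      using that pc'[of "\<sigma> k"] unfolding c'_nth by (auto simp: I_def abs_mult)
  qed
  have c'_0: "c' j = 0" if "j \<notin> \<sigma> ` I" for j
    unfolding c'_nth using that by (subst sum.neutral) auto
  have "pweight b B p x = (\<Prod>i\<in>UNIV. 1 - c i)"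
    unfolding pweight_def c_def using p(1) x
    by (intro cweight_eq_prod_dist)
       (auto simp: K extreme_point_chart_cube_iff[OF B] mem_chart_image_iff[OF B])
  also have "\<dots> = (\<Prod>i\<in>I. 1 - c i)"
    by (rule prod.mono_neutral_right) (auto simp: I_def c_def)
  also have "\<dots> = (\<Prod>i\<in>I. 1 - c' (\<sigma> i))"
    by (simp add: c'_\<sigma>)
  also have "\<dots> = (\<Prod>j\<in>\<sigma> ` I. 1 - c' j)"
    by (simp add: prod.reindex[OF inj])
  also have "\<dots> = (\<Prod>j\<in>UNIV. 1 - c' j)"
    by (rule prod.mono_neutral_left) (auto simp: c'_0)
  also have "\<dots> = pweight b' B' p x"
    unfolding pweight_def c'_def using exF[of p] p(1) pF x
    by (intro cweight_eq_prod_dist[symmetric])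
       (auto simp: K' extreme_point_chart_cube_iff[OF B'] mem_chart_image_iff[OF B'])
  finally show ?thesis .
qed


section \<open>Nodal interpolation\<close>

text \<open>One fixed chart for each element. The choice is harmless because of
  \<open>weight_eq_pweight\<close>.\<close>

definition elem_chart :: "(real ^ 'n) set \<Rightarrow> (real ^ 'n) \<times> (real ^ 'n ^ 'n)" where
  "elem_chart K = (SOME c. invertible (snd c) \<and> K = chart (fst c) (snd c) ` cbox 0 1)"

definition ecoords :: "(real ^ 'n) set \<Rightarrow> real ^ 'n \<Rightarrow> real ^ 'n" where
  "ecoords K = coords (fst (elem_chart K)) (snd (elem_chart K))"

definition verts :: "(real ^ 'n) set \<Rightarrow> (real ^ 'n) set" where
  "verts K = {x. x extreme_point_of K}"

definition weight :: "(real ^ 'n) set \<Rightarrow> real ^ 'n \<Rightarrow> real ^ 'n \<Rightarrow> real" where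
  "weight K p x = cweight (ecoords K p) (ecoords K x)"

lemma parallelepiped_iff_chart:
  "parallelepiped K \<longleftrightarrow> (\<exists>b B. invertible B \<and> K = chart b B ` cbox 0 1)"
  by (simp add: parallelepiped_def chart_def[abs_def])

lemma elem_chart:
  assumes "parallelepiped K"
  shows "invertible (snd (elem_chart K))"
    and "K = chart (fst (elem_chart K)) (snd (elem_chart K)) ` cbox 0 1"
proof -
  have "\<exists>c. invertible (snd c) \<and> K = chart (fst c) (snd c) ` cbox 0 1"
    using assms by (auto simp: parallelepiped_iff_chart)
  from someI_ex[OF this] show "invertible (snd (elem_chart K))"
    and "K = chart (fst (elem_chart K)) (snd (elem_chart K)) ` cbox 0 1"
    by (simp_all add: elem_chart_def)
qed

context
  fixes K :: "(real ^ 'n) set"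
  assumes K: "parallelepiped K"
begin

lemma mem_elem_iff: "x \<in> K \<longleftrightarrow> ecoords K x \<in> cbox 0 1"
  using elem_chart[OF K] mem_chart_image_iff by (metis ecoords_def)

lemma mem_verts_iff: "x \<in> verts K \<longleftrightarrow> ecoords K x \<in> corners"
  using elem_chart[OF K] extreme_point_chart_cube_iff by (metis ecoords_def mem_Collect_eq verts_def)

lemma ecoords_eq_iff: "ecoords K x = ecoords K y \<longleftrightarrow> x = y"
  unfolding ecoords_def using elem_chart(1)[OF K] by (simp add: coords_eq_iff)

lemma ecoords_surj: "\<exists>x. ecoords K x = y"
  unfolding ecoords_def using elem_chart(1)[OF K] by (metis coords_chart)

lemma ecoords_add_scaled_diff:
  "ecoords K (x + t *\<^sub>R (z - w)) = ecoords K x + t *\<^sub>R (ecoords K z - ecoords K w)"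
  unfolding ecoords_def using elem_chart(1)[OF K] by (rule coords_add_scaled_diff)

lemma bij_betw_ecoords_verts: "bij_betw (ecoords K) (verts K) corners"
  unfolding bij_betw_def inj_on_def
  using mem_verts_iff ecoords_eq_iff ecoords_surj by (auto simp: image_iff) metis

lemma sum_verts: "(\<Sum>p\<in>verts K. f (ecoords K p)) = (\<Sum>s\<in>corners. f s)"
  by (rule sum.reindex_bij_betw[OF bij_betw_ecoords_verts])

lemma finite_verts: "finite (verts K)"
  using bij_betw_finite[OF bij_betw_ecoords_verts] by simp

lemma card_verts: "card (verts K) = 2 ^ CARD('n)"
  using bij_betw_same_card[OF bij_betw_ecoords_verts] by (simp add: card_corners)

lemma verts_subset: "verts K \<subseteq> K"
  by (auto simp: verts_def extreme_point_of_def)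

lemma verts_nonempty: "verts K \<noteq> {}"
  using card_verts by force

lemma convex_elem: "convex K"
  using elem_chart[OF K] convex_chart_cube by metis

lemma weight_nonneg: "p \<in> verts K \<Longrightarrow> x \<in> K \<Longrightarrow> 0 \<le> weight K p x"
  unfolding weight_def by (simp add: mem_verts_iff mem_elem_iff cweight_nonneg)

lemma weight_le_1: "p \<in> verts K \<Longrightarrow> x \<in> K \<Longrightarrow> weight K p x \<le> 1"
  unfolding weight_def by (simp add: mem_verts_iff mem_elem_iff cweight_le_1)

lemma sum_weight: "(\<Sum>p\<in>verts K. weight K p x) = 1"
  unfolding weight_def using sum_verts[of "\<lambda>s. cweight s (ecoords K x)"] by (simp add: sum_cweight)

lemma weight_verts:
  "p \<in> verts K \<Longrightarrow> q \<in> verts K \<Longrightarrow> weight K p q = (if p = q then 1 else 0)"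
  unfolding weight_def by (simp add: mem_verts_iff cweight_corners ecoords_eq_iff)

lemma sum_weight_vert:
  assumes "q \<in> verts K"
  shows "(\<Sum>p\<in>verts K. g p * weight K p q) = g q"
proof -
  have "(\<Sum>p\<in>verts K. g p * weight K p q) = (\<Sum>p\<in>verts K. if p = q then g q else 0)"
    by (intro sum.cong) (auto simp: weight_verts assms)
  thus ?thesis
    using assms finite_verts by simp
qed

text \<open>This is \<open>pweight_agree\<close> with the element as its own neighbour: two charts
  of the same set give the same weights.\<close>

lemma weight_eq_pweight:
  assumes B: "invertible B" and Kb: "K = chart b B ` cbox 0 1" and p: "p \<in> verts K" and x: "x \<in> K"
  shows "weight K p x = pweight b B p x"
proof -
  have "K face_of K" using convex_elem by (rule face_of_refl)
  hence "pweight (fst (elem_chart K)) (snd (elem_chart K)) p x = pweight b B p x"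
    using p x verts_subset
    by (intro pweight_agree[OF elem_chart[OF K] B Kb]) (auto simp: verts_def)
  thus ?thesis
    by (simp add: weight_def pweight_def ecoords_def)
qed

lemma compact_elem: "compact K"
proof -
  have "continuous_on (cbox 0 1) (\<lambda>y. b + B *v y)" for b :: "real ^ 'n" and B :: "real ^ 'n ^ 'n"
    by (intro continuous_intros linear_continuous_on matrix_vector_mul_bounded_linear)
  moreover obtain b :: "real ^ 'n" and B :: "real ^ 'n ^ 'n" where "K = (\<lambda>y. b + B *v y) ` cbox 0 1"
    using K by (auto simp: parallelepiped_def)
  ultimately show ?thesis
    by (simp add: compact_continuous_image)
qed

lemma closed_elem: "closed K"
  using compact_elem by (rule compact_imp_closed)

lemma continuous_on_ecoords: "continuous_on S (ecoords K)"
  unfolding ecoords_def coords_def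
  by (intro continuous_intros bounded_linear.continuous_on[OF matrix_vector_mul_bounded_linear])

lemma continuous_on_weight: "continuous_on S (weight K p)"
  unfolding weight_def cweight_def
  by (intro continuous_intros continuous_on_compose2[OF continuous_on_ecoords]) auto

text \<open>The chart that witnesses \<open>Q1_on\<close> may differ from \<open>elem_chart\<close>;
  the expansion is done in the former, and the weights are then exchanged.\<close>

lemma Q1_on_weights:
  assumes "Q1_on K v" "x \<in> K"
  shows "v x = (\<Sum>p\<in>verts K. v p * weight K p x)"
proof -
  obtain b :: "real ^ 'n" and B :: "real ^ 'n ^ 'n" and c where B: "invertible B" and Kb: "K = (\<lambda>y. b + B *v y) ` cbox 0 1"
    and v: "\<And>y. y \<in> cbox 0 1 \<Longrightarrow> v (b + B *v y) = (\<Sum>J\<in>UNIV. c J * (\<Prod>i\<in>J. y $ i))"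
    using assms(1) unfolding Q1_on_def by blast
  have Kb': "K = chart b B ` cbox 0 1"
    using Kb by (simp add: chart_def[abs_def])
  have v': "v (chart b B y) = (\<Sum>J\<in>UNIV. c J * (\<Prod>i\<in>J. y $ i))" if "y \<in> cbox 0 1" for y
    using v[OF that] by (simp add: chart_def)
  have vc: "\<And>p. p \<in> verts K \<longleftrightarrow> coords b B p \<in> corners"
    unfolding verts_def Kb' by (simp add: extreme_point_chart_cube_iff[OF B])
  define y where "y = coords b B x"
  have y: "y \<in> cbox 0 1" "x = chart b B y"
    using assms(2) Kb' B by (auto simp: y_def)
  have "v x = (\<Sum>J\<in>UNIV. c J * (\<Sum>s\<in>corners. (\<Prod>i\<in>J. s $ i) * cweight s y))"
    unfolding y(2) v'[OF y(1)] monomial_eq_sum_cweight[of y] ..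
  also have "\<dots> = (\<Sum>s\<in>corners. (\<Sum>J\<in>UNIV. c J * (\<Prod>i\<in>J. s $ i)) * cweight s y)"
    by (simp add: sum_distrib_left sum_distrib_right mult.assoc) (rule sum.swap)
  also have "\<dots> = (\<Sum>s\<in>corners. v (chart b B s) * cweight s y)"
    using corners_subset_cube by (intro sum.cong refl) (auto simp: v' subset_eq)
  also have "\<dots> = (\<Sum>p\<in>verts K. v p * pweight b B p x)"
  proof (rule sum.reindex_bij_witness[of _ "coords b B" "chart b B"])
  qed (use B in \<open>auto simp: vc pweight_def y\<close>)
  also have "\<dots> = (\<Sum>p\<in>verts K. v p * weight K p x)"
    using assms(2) by (intro sum.cong refl) (simp add: weight_eq_pweight[OF B Kb'])
  finally show ?thesis .
qed

lemma Q1_onI: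
  assumes v: "\<And>x. x \<in> K \<Longrightarrow> v x = (\<Sum>p\<in>verts K. g p * weight K p x)"
  shows "Q1_on K v"
proof -
  define b where "b = fst (elem_chart K)"
  define B where "B = snd (elem_chart K)"
  have B: "invertible B" and Kb: "K = chart b B ` cbox 0 1"
    unfolding B_def b_def by (fact elem_chart[OF K])+
  define d where "d s J = (\<Prod>i\<in>J. 2 * s $ i - 1) * (\<Prod>i\<in>-J. 1 - s $ i)" for s :: "real ^ 'n" and J
  have "v (b + B *v y) = (\<Sum>J\<in>UNIV. (\<Sum>p\<in>verts K. g p * d (ecoords K p) J) * (\<Prod>i\<in>J. y $ i))"
    if "y \<in> cbox 0 1" for y
  proof -
    have "chart b B y \<in> K" using that Kb by blast
    moreover have "ecoords K (chart b B y) = y"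
      using B by (simp add: ecoords_def B_def b_def)
    ultimately have "v (chart b B y) = (\<Sum>p\<in>verts K. g p * cweight (ecoords K p) y)"
      by (simp add: v weight_def)
    also have "\<dots> = (\<Sum>p\<in>verts K. \<Sum>J\<in>UNIV. g p * d (ecoords K p) J * (\<Prod>i\<in>J. y $ i))"
      unfolding cweight_eq_sum_monomials[of _ y] d_def by (simp add: sum_distrib_left mult.assoc)
    also have "\<dots> = (\<Sum>J\<in>UNIV. (\<Sum>p\<in>verts K. g p * d (ecoords K p) J) * (\<Prod>i\<in>J. y $ i))"
      by (subst sum.swap) (simp add: sum_distrib_right)
    finally show ?thesis by (simp add: chart_def)
  qed
  moreover have "K = (\<lambda>y. b + B *v y) ` cbox 0 1"
    using Kb by (simp add: chart_def[abs_def])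
  ultimately show ?thesis
    unfolding Q1_on_def using B
    by (intro exI[of _ b] exI[of _ B] exI[of _ "\<lambda>J. \<Sum>p\<in>verts K. g p * d (ecoords K p) J"]) blast
qed

lemma weight_nonzero_segment:
  assumes "p \<in> verts K" "x \<in> K" "weight K p x \<noteq> 0" "x \<noteq> p"
  obtains q where "q \<in> K" "x \<in> open_segment p q"
  using pweight_nonzero_segment[OF elem_chart[OF K], of p x] assms
  by (auto simp: weight_def pweight_def ecoords_def verts_def)

lemma abs_weighted_sum_le:
  assumes "x \<in> K" and "\<And>p. p \<in> verts K \<Longrightarrow> \<bar>g p\<bar> \<le> m"
  shows "\<bar>\<Sum>p\<in>verts K. g p * weight K p x\<bar> \<le> m"
proof -
  have "\<bar>\<Sum>p\<in>verts K. g p * weight K p x\<bar> \<le> (\<Sum>p\<in>verts K. m * weight K p x)"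
    using assms weight_nonneg by (intro sum_abs[THEN order.trans] sum_mono)
      (auto simp: abs_mult intro!: mult_right_mono)
  thus ?thesis by (simp add: sum_weight flip: sum_distrib_left)
qed

end

section \<open>Conforming meshes and the gluing of element shape functions\<close>

locale para_mesh =
  fixes \<T> :: "(real ^ 'n) set set"
  assumes finite_mesh: "finite \<T>"
    and para: "K \<in> \<T> \<Longrightarrow> parallelepiped K"
    and face: "K \<in> \<T> \<Longrightarrow> K' \<in> \<T> \<Longrightarrow> (K \<inter> K') face_of K"
begin

lemma face': "K \<in> \<T> \<Longrightarrow> K' \<in> \<T> \<Longrightarrow> (K \<inter> K') face_of K'"
  using face[of K' K] by (simp add: Int_commute)

lemma verts_shared: "K \<in> \<T> \<Longrightarrow> K' \<in> \<T> \<Longrightarrow> p \<in> verts K \<Longrightarrow> p \<in> K' \<Longrightarrow> p \<in> verts K'"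
  unfolding verts_def using extreme_point_of_face[OF face] extreme_point_of_face[OF face']
  by (metis IntI extreme_point_of_def mem_Collect_eq)

lemma mesh_vertices_eq: "mesh_vertices \<T> = (\<Union>K\<in>\<T>. verts K)"
  by (simp add: mesh_vertices_def verts_def)

lemma finite_mesh_vertices: "finite (mesh_vertices \<T>)"
  unfolding mesh_vertices_eq using finite_mesh finite_verts para by blast

text \<open>At a point of the common face, vertices off the face carry no weight and shared vertices
  carry the same weight from both sides. This makes element-wise nodal sums single-valued and
  continuous across elements.\<close>

lemma weighted_sum_agree:
  assumes K: "K \<in> \<T>" "K' \<in> \<T>" and x: "x \<in> K" "x \<in> K'"
  shows "(\<Sum>p\<in>verts K. g p * weight K p x) = (\<Sum>p\<in>verts K'. g p * weight K' p x)"
proof -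
  have zero: "weight L p x = 0" if "L \<in> \<T>" "L' \<in> \<T>" "p \<in> verts L - L'" "x \<in> L" "x \<in> L'" for L L' p
    using pweight_zero_outside_face[OF elem_chart[OF para[OF that(1)]] face[OF that(1,2)], of p x] that
    by (auto simp: verts_def weight_def pweight_def ecoords_def)
  have "(\<Sum>p\<in>verts K. g p * weight K p x) = (\<Sum>p\<in>verts K \<inter> K'. g p * weight K p x)"
    using finite_verts[OF para] K x zero[OF K] by (intro sum.mono_neutral_right) auto
  also have "\<dots> = (\<Sum>p\<in>verts K \<inter> K'. g p * weight K' p x)"
  proof (intro sum.cong refl)
    fix p assume "p \<in> verts K \<inter> K'"
    thus "g p * weight K p x = g p * weight K' p x"
      using pweight_agree[OF elem_chart[OF para[OF K(1)]] elem_chart[OF para[OF K(2)]] face[OF K] face'[OF K],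
          of p x] x
      by (simp add: weight_def pweight_def ecoords_def verts_def)
  qed
  also have "verts K \<inter> K' = verts K' \<inter> K"
    using verts_shared[OF K] verts_shared[OF K(2,1)] verts_subset[OF para] K by blast
  also have "(\<Sum>p\<in>verts K' \<inter> K. g p * weight K' p x) = (\<Sum>p\<in>verts K'. g p * weight K' p x)"
    using finite_verts[OF para] K x zero[OF K(2,1)] by (intro sum.mono_neutral_left) auto
  finally show ?thesis .
qed

lemma Q1_space_weights:
  "v \<in> Q1_space \<T> \<Longrightarrow> K \<in> \<T> \<Longrightarrow> x \<in> K \<Longrightarrow> v x = (\<Sum>p\<in>verts K. v p * weight K p x)"
  using Q1_on_weights[OF para] by (auto simp: Q1_space_def)

lemma Q1_space_eqI:
  assumes "v \<in> Q1_space \<T>" "w \<in> Q1_space \<T>" "\<And>p. p \<in> mesh_vertices \<T> \<Longrightarrow> v p = w p"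
  shows "v = w"
proof
  fix x
  show "v x = w x"
  proof (cases "x \<in> \<Union>\<T>")
    case True
    then obtain K where K: "K \<in> \<T>" "x \<in> K" by blast
    hence "(\<Sum>p\<in>verts K. v p * weight K p x) = (\<Sum>p\<in>verts K. w p * weight K p x)"
      using assms(3) by (intro sum.cong) (auto simp: mesh_vertices_eq)
    thus ?thesis
      using Q1_space_weights[OF assms(1) K] Q1_space_weights[OF assms(2) K] by simp
  qed (use assms in \<open>auto simp: Q1_space_def\<close>)
qed

lemma nodal_interp_exists:
  "\<exists>v \<in> Q1_space \<T>. \<forall>p\<in>mesh_vertices \<T>. v p = g p"
proof -
  \<comment> \<open>Any element that contains \<open>x\<close> will do, by
    \<open>weighted_sum_agree\<close>.\<close>
  define pick where "pick x = (SOME K. K \<in> \<T> \<and> x \<in> K)" for x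
  define v where
    "v x = (if x \<in> \<Union>\<T> then \<Sum>p\<in>verts (pick x). g p * weight (pick x) p x else 0)" for x
  have v: "v x = (\<Sum>p\<in>verts K. g p * weight K p x)" if "K \<in> \<T>" "x \<in> K" for K x
  proof -
    have pick: "pick x \<in> \<T>" "x \<in> pick x"
      using someI[of "\<lambda>K. K \<in> \<T> \<and> x \<in> K" K] that by (simp_all add: pick_def)
    have "x \<in> \<Union>\<T>" using that by blast
    hence "v x = (\<Sum>p\<in>verts (pick x). g p * weight (pick x) p x)"
      by (simp add: v_def)
    also have "\<dots> = (\<Sum>p\<in>verts K. g p * weight K p x)"
      by (rule weighted_sum_agree[OF pick(1) that(1) pick(2) that(2)])
    finally show ?thesis .
  qed
  have "continuous_on (\<Union>K\<in>\<T>. K) v"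
  proof (rule continuous_on_closed_Union[OF finite_mesh])
    fix K assume K: "K \<in> \<T>"
    show "closed K" using K para closed_elem by blast
    have "continuous_on K (\<lambda>x. \<Sum>p\<in>verts K. g p * weight K p x)"
      by (intro continuous_intros continuous_on_weight para K)
    thus "continuous_on K v"
      using v[OF K] by (simp cong: continuous_on_cong)
  qed
  moreover have "Q1_on K v" if "K \<in> \<T>" for K
    using v[OF that] by (rule Q1_onI[OF para[OF that]])
  ultimately have "v \<in> Q1_space \<T>"
    by (simp add: Q1_space_def v_def)
  moreover have "v p = g p" if p: "p \<in> mesh_vertices \<T>" for p
  proof -
    obtain K where K: "K \<in> \<T>" "p \<in> verts K"
      using p by (auto simp: mesh_vertices_eq)
    thus ?thesis
      using v[OF K(1)] verts_subset[OF para[OF K(1)]] sum_weight_vert[OF para[OF K(1)] K(2)] by auto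
  qed
  ultimately show ?thesis by blast
qed

text \<open>Existence and uniqueness together justify the definite description in
  \<open>nodal_interp\<close>; from here on it can be used through its nodal values.\<close>

lemma nodal_interp: 
  shows nodal_interp_in_Q1_space: "nodal_interp \<T> g \<in> Q1_space \<T>"
    and nodal_interp_vertex: "p \<in> mesh_vertices \<T> \<Longrightarrow> nodal_interp \<T> g p = g p"
proof -
  have "\<exists>!v. v \<in> Q1_space \<T> \<and> (\<forall>p\<in>mesh_vertices \<T>. v p = g p)"
    using nodal_interp_exists[of g] Q1_space_eqI by metis
  from theI'[OF this] show "nodal_interp \<T> g \<in> Q1_space \<T>"
    and "p \<in> mesh_vertices \<T> \<Longrightarrow> nodal_interp \<T> g p = g p"
    by (auto simp: nodal_interp_def)
qed

lemma nodal_interp_weights: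
  assumes "K \<in> \<T>" "x \<in> K"
  shows "nodal_interp \<T> g x = (\<Sum>p\<in>verts K. g p * weight K p x)"
proof -
  have "p \<in> mesh_vertices \<T>" if "p \<in> verts K" for p
    using that assms by (auto simp: mesh_vertices_eq)
  thus ?thesis
    using Q1_space_weights[OF nodal_interp_in_Q1_space assms, of g] by (simp add: nodal_interp_vertex)
qed

lemma Q1_space_lincomb:
  assumes "v \<in> Q1_space \<T>" "w \<in> Q1_space \<T>"
  shows "(\<lambda>x. a * v x + c * w x) \<in> Q1_space \<T>"
proof -
  have "Q1_on K (\<lambda>x. a * v x + c * w x)" if "K \<in> \<T>" for K
  proof (rule Q1_onI[OF para[OF that]])
    fix x assume "x \<in> K"
    thus "a * v x + c * w x = (\<Sum>p\<in>verts K. (a * v p + c * w p) * weight K p x)"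
      using Q1_space_weights[OF assms(1) that] Q1_space_weights[OF assms(2) that]
      by (simp add: sum_distrib_left distrib_right sum.distrib mult.assoc)
  qed
  thus ?thesis
    using assms by (auto simp: Q1_space_def intro!: continuous_intros)
qed

lemma zero_in_Q1_space: "(\<lambda>x. 0) \<in> Q1_space \<T>"
  using Q1_onI[OF para, of _ "\<lambda>x. 0" "\<lambda>x. 0"] by (auto simp: Q1_space_def)

lemma nodal_basis_bounds: "0 \<le> nodal_basis \<T> z x" "nodal_basis \<T> z x \<le> 1"
proof -
  have "0 \<le> nodal_basis \<T> z x \<and> nodal_basis \<T> z x \<le> 1"
  proof (cases "x \<in> \<Union>\<T>")
    case True
    then obtain K where K: "K \<in> \<T>" "x \<in> K" by blast
    have eq: "nodal_basis \<T> z x = (\<Sum>p\<in>verts K. (if p = z then 1 else 0) * weight K p x)"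
      unfolding nodal_basis_def by (rule nodal_interp_weights[OF K])
    have "0 \<le> nodal_basis \<T> z x"
      unfolding eq using weight_nonneg[OF para[OF K(1)]] K by (intro sum_nonneg) auto
    moreover have "\<bar>nodal_basis \<T> z x\<bar> \<le> 1"
      unfolding eq using K by (intro abs_weighted_sum_le[OF para[OF K(1)] K(2)]) auto
    ultimately show ?thesis by simp
  next
    case False
    thus ?thesis
      using nodal_interp_in_Q1_space by (auto simp: nodal_basis_def Q1_space_def)
  qed
  thus "0 \<le> nodal_basis \<T> z x" "nodal_basis \<T> z x \<le> 1" by auto
qed

lemma sum_nodal_basis:
  assumes "x \<in> \<Union>\<T>"
  shows "(\<Sum>z\<in>mesh_vertices \<T>. nodal_basis \<T> z x) = 1"
proof -
  obtain K where K: "K \<in> \<T>" "x \<in> K" using assms by blast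
  have "(\<Sum>z\<in>mesh_vertices \<T>. nodal_basis \<T> z x)
      = (\<Sum>z\<in>mesh_vertices \<T>. \<Sum>p\<in>verts K. (if p = z then 1 else 0) * weight K p x)"
    by (simp only: nodal_basis_def nodal_interp_weights[OF K])
  also have "\<dots> = (\<Sum>p\<in>verts K. \<Sum>z\<in>mesh_vertices \<T>. (if z = p then weight K p x else 0))"
    by (subst sum.swap) (auto intro!: sum.cong)
  also have "\<dots> = (\<Sum>p\<in>verts K. weight K p x)"
    using K finite_mesh_vertices by (intro sum.cong refl) (auto simp: mesh_vertices_eq)
  finally show ?thesis using sum_weight[OF para[OF K(1)]] by simp
qed

end


section \<open>Element-wise estimates\<close>

text \<open>The gradient of the \<open>i\<close>-th local coordinate. The rows are the basis dual to
  the edge vectors \<open>elem_edge\<close>.\<close>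

definition elem_row :: "(real ^ 'n) set \<Rightarrow> 'n \<Rightarrow> real ^ 'n" where
  "elem_row K i = matrix_inv (snd (elem_chart K)) $ i"

definition elem_edge :: "(real ^ 'n) set \<Rightarrow> 'n \<Rightarrow> real ^ 'n" where
  "elem_edge K j = snd (elem_chart K) *v axis j 1"

definition dweight :: "(real ^ 'n) set \<Rightarrow> real ^ 'n \<Rightarrow> real ^ 'n \<Rightarrow> real ^ 'n" where
  "dweight K p x = (\<Sum>i\<in>UNIV. ((2 * ecoords K p $ i - 1) *
     (\<Prod>j\<in>-{i}. ecoords K p $ j * ecoords K x $ j + (1 - ecoords K p $ j) * (1 - ecoords K x $ j)))
       *\<^sub>R elem_row K i)"

text \<open>From \<open>mass_lower_bound\<close>: the volume fraction \<open>(1 / (4 d)) ^ d\<close>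
  of the shrunken copy, 1/4 for the square of one half, and \<open>2 ^ d\<close> for replacing the
  largest nodal value by the sum over all vertices.\<close>

definition mass_const :: "nat \<Rightarrow> real" where
  "mass_const d = (1 / (4 * real d)) ^ d / 4 / 2 ^ d"

lemma ecoords_nth: "ecoords K x $ i = elem_row K i \<bullet> (x - fst (elem_chart K))"
  by (simp add: ecoords_def coords_def elem_row_def matrix_vector_mul_component)

lemma GDERIV_weight: "GDERIV (weight K p) x :> dweight K p x"
proof -
  let ?f = "\<lambda>i x. ecoords K p $ i * ecoords K x $ i + (1 - ecoords K p $ i) * (1 - ecoords K x $ i)"
  have "((\<lambda>x. \<Prod>i\<in>UNIV. ?f i x) has_derivative
      (\<lambda>h. \<Sum>i\<in>UNIV. ((2 * ecoords K p $ i - 1) * (elem_row K i \<bullet> h)) * (\<Prod>j\<in>UNIV - {i}. ?f j x))) (at x)"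
  proof (rule has_derivative_prod)
    fix i
    have "((\<lambda>x. ?f i x) has_derivative (\<lambda>h. ecoords K p $ i * (elem_row K i \<bullet> h)
        + (1 - ecoords K p $ i) * (0 - elem_row K i \<bullet> h))) (at x)"
      unfolding ecoords_nth[of K _ i]
      by (rule derivative_eq_intros refl | simp)+
    thus "(?f i has_derivative (\<lambda>h. (2 * ecoords K p $ i - 1) * (elem_row K i \<bullet> h))) (at x)"
      by (simp add: algebra_simps)
  qed
  moreover have "weight K p = (\<lambda>x. \<Prod>i\<in>UNIV. ?f i x)"
    by (simp add: weight_def cweight_def fun_eq_iff)
  ultimately show ?thesis
    by (simp add: gderiv_def dweight_def inner_sum_right Compl_eq_Diff_UNIV inner_commute mult_ac)
qed

lemma grad_eqI:
  assumes "GDERIV v x :> D"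
  shows "grad v x = D"
proof -
  have "D' = D" if "GDERIV v x :> D'" for D'
  proof -
    have "(\<lambda>h. h \<bullet> D') = (\<lambda>h. h \<bullet> D)"
      using that assms unfolding gderiv_def by (rule has_derivative_unique)
    thus ?thesis by (metis vector_eq_ldot)
  qed
  thus ?thesis
    unfolding grad_def using assms by (intro the_equality)
qed

lemma GDERIV_weighted_sum:
  "GDERIV (\<lambda>x. \<Sum>p\<in>P. g p * weight K p x) x :> (\<Sum>p\<in>P. g p *\<^sub>R dweight K p x)"
proof (induction P rule: infinite_finite_induct)
  case (insert p P)
  have "GDERIV (\<lambda>x. g p * weight K p x) x :> g p *\<^sub>R dweight K p x"
    using GDERIV_mult[OF GDERIV_const GDERIV_weight] by (rule GDERIV_subst) simp
  thus ?case
    using insert GDERIV_add by simp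
qed (simp_all add: GDERIV_const)

lemma grad_weighted_sum:
  assumes "x \<in> interior K" and "\<And>y. y \<in> K \<Longrightarrow> v y = (\<Sum>p\<in>P. g p * weight K p y)"
  shows "grad v x = (\<Sum>p\<in>P. g p *\<^sub>R dweight K p x)"
proof (rule grad_eqI, unfold gderiv_def, rule has_derivative_transform_within_open)
  show "((\<lambda>x. \<Sum>p\<in>P. g p * weight K p x) has_derivative (\<lambda>h. h \<bullet> (\<Sum>p\<in>P. g p *\<^sub>R dweight K p x))) (at x)"
    using GDERIV_weighted_sum by (simp add: gderiv_def)
qed (use assms interior_subset[of K] in \<open>auto simp: subset_eq\<close>)

context
  fixes K :: "(real ^ 'n) set"
  assumes K: "parallelepiped K"
begin

lemma continuous_on_dweight: "continuous_on S (dweight K p)"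
  unfolding dweight_def
  by (intro continuous_intros continuous_on_compose2[OF continuous_on_ecoords[OF K]]) auto

lemma elem_row_edge: "elem_row K i \<bullet> elem_edge K j = (if i = j then 1 else 0)"
proof -
  have "elem_row K i \<bullet> elem_edge K j = (matrix_inv (snd (elem_chart K)) *v elem_edge K j) $ i"
    by (simp add: elem_row_def matrix_vector_mul_component)
  also have "\<dots> = axis j 1 $ i"
    unfolding elem_edge_def matrix_vector_mul_assoc matrix_inv_inverse(2)[OF elem_chart(1)[OF K]]
    by simp
  finally show ?thesis by (auto simp: axis_def)
qed

lemma norm_elem_edge: "norm (elem_edge K j) \<le> diameter K"
proof -
  let ?c = "chart (fst (elem_chart K)) (snd (elem_chart K))"
  have "?c 0 \<in> K" "?c (axis j 1) \<in> K"
    by (subst (2) elem_chart(2)[OF K], intro imageI, simp add: mem_unit_cube axis_def)+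
  hence "dist (?c (axis j 1)) (?c 0) \<le> diameter K"
    using compact_imp_bounded[OF compact_elem[OF K]] by (intro diameter_bounded_bound)
  thus ?thesis by (simp add: dist_norm chart_def elem_edge_def)
qed

text \<open>A local coordinate varies by at most 1 on \<open>K\<close>, but by \<open>2 * r\<close>
  times the norm of its gradient across the inscribed ball.\<close>

lemma norm_elem_row:
  assumes "0 < r" "cball c r \<subseteq> K"
  shows "norm (elem_row K i) \<le> 1 / (2 * r)"
proof (cases "elem_row K i = 0")
  case False
  define u where "u = (r / norm (elem_row K i)) *\<^sub>R elem_row K i"
  have "norm u = r" using False assms by (simp add: u_def)
  hence "c + u \<in> K" "c - u \<in> K"
    using assms(2) by (auto simp: subset_eq dist_norm)
  hence "ecoords K (c + u) $ i \<le> 1" "0 \<le> ecoords K (c - u) $ i"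
    by (auto simp: mem_elem_iff[OF K] mem_unit_cube)
  hence "elem_row K i \<bullet> (c + u - fst (elem_chart K)) - elem_row K i \<bullet> (c - u - fst (elem_chart K)) \<le> 1"
    unfolding ecoords_nth by linarith
  hence "2 * (elem_row K i \<bullet> u) \<le> 1"
    by (simp add: inner_diff_right inner_add_right)
  moreover have "elem_row K i \<bullet> u = r * norm (elem_row K i)"
    using False by (simp add: u_def power2_norm_eq_inner[symmetric] power2_eq_square)
  ultimately show ?thesis
    using assms(1) by (simp add: field_simps)
qed (use assms in simp)

lemma norm_dweight:
  assumes "0 < r" "cball c r \<subseteq> K" "p \<in> verts K" "x \<in> K"
  shows "norm (dweight K p x) \<le> real CARD('n) / (2 * r)"
proof -
  have pc: "ecoords K p \<in> corners" using assms(3) by (simp add: mem_verts_iff[OF K])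
  have xc: "ecoords K x \<in> cbox 0 1" using assms(4) by (simp add: mem_elem_iff[OF K])
  have "\<bar>(2 * ecoords K p $ i - 1) *
     (\<Prod>j\<in>-{i}. ecoords K p $ j * ecoords K x $ j + (1 - ecoords K p $ j) * (1 - ecoords K x $ j))\<bar> \<le> 1"
    (is "\<bar>_ * ?P\<bar> \<le> 1") for i
  proof -
    have bd: "0 \<le> ecoords K p $ j * ecoords K x $ j + (1 - ecoords K p $ j) * (1 - ecoords K x $ j)"
      "ecoords K p $ j * ecoords K x $ j + (1 - ecoords K p $ j) * (1 - ecoords K x $ j) \<le> 1" for j
      using pc xc corners_subset_cube
      by (auto intro!: cfactor_bounds simp: mem_unit_cube subset_eq)
    have "0 \<le> ?P" "?P \<le> 1"
      using bd by (auto intro!: prod_nonneg prod_le_1)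
    moreover have "\<bar>2 * ecoords K p $ i - 1\<bar> = 1"
      using pc by (auto simp: corners_def dest!: spec[of _ i])
    ultimately show ?thesis by (simp add: abs_mult)
  qed
  hence "norm (dweight K p x) \<le> (\<Sum>i\<in>(UNIV :: 'n set). 1 * (1 / (2 * r)))"
    unfolding dweight_def using norm_elem_row[OF assms(1,2)]
    by (intro order.trans[OF norm_sum] sum_mono) (simp only: norm_scaleR real_norm_def mult_mono norm_ge_zero abs_ge_zero zero_le_one)
  thus ?thesis by simp
qed

lemma lmeasurable_elem: "K \<in> lmeasurable" "interior K \<in> lmeasurable"
  using compact_elem[OF K] compact_imp_bounded by (auto intro: lmeasurable_compact lmeasurable_interior)

lemma measure_interior_elem: "measure lebesgue (interior K) = measure lebesgue K"
  using negligible_convex_frontier[OF convex_elem[OF K]] compact_imp_bounded[OF compact_elem[OF K]]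
  by (rule measure_interior[rotated])

text \<open>Each of the factors is at least \<open>1 - \<delta>\<close> there; Bernoulli's
  inequality makes the bound linear.\<close>

lemma weight_near_vertex:
  assumes p: "p \<in> verts K" and z: "z \<in> K" and \<delta>: "0 \<le> \<delta>" "\<delta> \<le> 1"
  shows "1 - real CARD('n) * \<delta> \<le> weight K p (p + \<delta> *\<^sub>R (z - p))"
proof -
  have pc: "ecoords K p $ i = 0 \<or> ecoords K p $ i = 1" for i
    using p by (simp add: mem_verts_iff[OF K] corners_def)
  have zc: "0 \<le> ecoords K z $ i" "ecoords K z $ i \<le> 1" for i
    using z by (auto simp: mem_elem_iff[OF K] mem_unit_cube)
  let ?x = "p + \<delta> *\<^sub>R (z - p)"
  have xc: "ecoords K ?x $ i = ecoords K p $ i + \<delta> * (ecoords K z $ i - ecoords K p $ i)" for i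
    by (simp add: ecoords_add_scaled_diff[OF K])
  have "(1 - \<delta>) ^ CARD('n) = (\<Prod>i\<in>(UNIV :: 'n set). 1 - \<delta>)" by simp
  also have "\<dots> \<le> weight K p ?x"
    unfolding weight_def cweight_def
  proof (intro prod_mono conjI)
    fix i
    have "\<delta> * ecoords K z $ i \<le> \<delta> * 1"
      using \<delta> zc by (intro mult_left_mono) auto
    moreover have "0 \<le> \<delta> * ecoords K z $ i" using \<delta> zc by simp
    ultimately show "1 - \<delta> \<le> ecoords K p $ i * ecoords K ?x $ i
        + (1 - ecoords K p $ i) * (1 - ecoords K ?x $ i)"
      unfolding xc using pc[of i] by (elim disjE) (simp_all add: algebra_simps)
  qed (use \<delta> in simp)
  finally have "(1 - \<delta>) ^ CARD('n) \<le> weight K p ?x" .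
  moreover have "1 + real CARD('n) * (- \<delta>) \<le> (1 + - \<delta>) ^ CARD('n)"
    using \<delta> by (intro Bernoulli_inequality) simp
  ultimately show ?thesis by simp
qed

lemma set_integrable_continuous_elem:
  fixes f :: "real ^ 'n \<Rightarrow> real"
  assumes "continuous_on K f"
  shows "set_integrable lebesgue (interior K) f"
proof -
  have "bounded (f ` K)"
    using assms compact_elem[OF K] by (intro compact_imp_bounded compact_continuous_image)
  then obtain M where M: "\<And>x. x \<in> K \<Longrightarrow> norm (f x) \<le> M"
    by (auto simp: bounded_iff)
  have "continuous_on (interior K) f"
    using assms interior_subset continuous_on_subset by blast
  hence "f \<in> borel_measurable (lebesgue_on (interior K))"
    by (intro continuous_imp_measurable_on_sets_lebesgue) auto
  moreover have "AE x in lebesgue_on (interior K). norm (f x) \<le> M"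
    using M interior_subset by (intro AE_I2) (auto simp: space_restrict_space)
  ultimately have "integrable (lebesgue_on (interior K)) f"
    using finite_measure_lebesgue_on[OF lmeasurable_elem(2)]
    by (intro finite_measure.integrable_const_bound)
  thus ?thesis
    by (simp add: integrable_restrict_space set_integrable_def)
qed

text \<open>If \<open>\<bar>g\<bar>\<close> is largest at the vertex \<open>p\<close>, then the function is at least half as large on the copy
  of \<open>K\<close> shrunk towards \<open>p\<close> by the factor \<open>1 / (4 d)\<close>.\<close>

lemma mass_lower_bound:
  "mass_const CARD('n) * measure lebesgue K * (\<Sum>p\<in>verts K. (g p)\<^sup>2)
     \<le> (LINT x:interior K|lebesgue. (\<Sum>p\<in>verts K. g p * weight K p x)\<^sup>2)"
proof -
  let ?w = "\<lambda>x. \<Sum>p\<in>verts K. g p * weight K p x"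
  obtain p where p: "p \<in> verts K" and max: "\<And>q. q \<in> verts K \<Longrightarrow> \<bar>g q\<bar> \<le> \<bar>g p\<bar>"
  proof -
    have "Max ((\<lambda>q. \<bar>g q\<bar>) ` verts K) \<in> (\<lambda>q. \<bar>g q\<bar>) ` verts K"
      using finite_verts[OF K] verts_nonempty[OF K] by (intro Max_in) auto
    then obtain p where p: "p \<in> verts K" "\<bar>g p\<bar> = Max ((\<lambda>q. \<bar>g q\<bar>) ` verts K)"
      by auto
    hence "\<bar>g q\<bar> \<le> \<bar>g p\<bar>" if "q \<in> verts K" for q
      unfolding p(2) using finite_verts[OF K] that by (intro Max_ge) auto
    thus ?thesis using that p(1) by blast
  qed
  \<comment> \<open>This value leaves weight at least 3/4 for \<open>p\<close> and at most 1/4 for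
    all other vertices together, so the function keeps at least half of its value at
    \<open>p\<close>.\<close>
  define \<delta> where "\<delta> = 1 / (4 * real CARD('n))"
  have card1: "1 \<le> real CARD('n)"
    using zero_less_card_finite[where 'a = 'n] by linarith
  have \<delta>: "0 < \<delta>" "\<delta> \<le> 1" "real CARD('n) * \<delta> = 1 / 4"
    using card1 unfolding \<delta>_def divide_le_eq_1 by (simp, linarith, simp)
  define C where "C = (\<lambda>x. \<delta> *\<^sub>R x + (1 - \<delta>) *\<^sub>R p) ` K"
  have C_eq: "\<delta> *\<^sub>R x + (1 - \<delta>) *\<^sub>R p = p + \<delta> *\<^sub>R (x - p)" for x
    by (simp add: algebra_simps)
  have pK: "p \<in> K" using p verts_subset[OF K] by blast
  have "C \<subseteq> K"
    unfolding C_def using convexD_alt[OF convex_elem[OF K] pK, of _ \<delta>] \<delta>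
    by (auto simp: add.commute)
  have "compact C"
    unfolding C_def using compact_elem[OF K]
    by (intro compact_continuous_image continuous_intros)
  have "convex C"
    unfolding C_def using convex_affinity[OF convex_elem[OF K], of "(1 - \<delta>) *\<^sub>R p" \<delta>]
    by (simp add: add.commute)
  have mC: "measure lebesgue (interior C) = \<delta> ^ CARD('n) * measure lebesgue K"
  proof -
    have "measure lebesgue (interior C) = measure lebesgue C"
      using negligible_convex_frontier[OF \<open>convex C\<close>] compact_imp_bounded[OF \<open>compact C\<close>]
      by (rule measure_interior[rotated])
    thus ?thesis
      unfolding C_def measure_lebesgue_affine using \<delta> by simp
  qed
  have half: "\<bar>g p\<bar> / 2 \<le> \<bar>?w x\<bar>" if x: "x \<in> C" for x
  proof -
    obtain z where z: "z \<in> K" "x = p + \<delta> *\<^sub>R (z - p)"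
      using x unfolding C_def C_eq by blast
    have wp: "3 / 4 \<le> weight K p x"
      using weight_near_vertex[OF p z(1), of \<delta>] \<delta> z(2) by simp
    have "\<bar>\<Sum>q\<in>verts K - {p}. g q * weight K q x\<bar> \<le> (\<Sum>q\<in>verts K - {p}. \<bar>g p\<bar> * weight K q x)"
      using max weight_nonneg[OF K] x \<open>C \<subseteq> K\<close>
      by (intro sum_abs[THEN order.trans] sum_mono) (auto simp: abs_mult intro!: mult_mono)
    also have "\<dots> = \<bar>g p\<bar> * (1 - weight K p x)"
      using sum_weight[OF K, of x] finite_verts[OF K] p
      by (simp add: sum_diff1 flip: sum_distrib_left)
    also have "\<dots> \<le> \<bar>g p\<bar> * (1 / 4)"
      using wp by (intro mult_left_mono) auto
    finally have rest: "\<bar>\<Sum>q\<in>verts K - {p}. g q * weight K q x\<bar> \<le> \<bar>g p\<bar> / 4" by simp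
    have "?w x = g p * weight K p x + (\<Sum>q\<in>verts K - {p}. g q * weight K q x)"
      using finite_verts[OF K] p by (simp add: sum.remove)
    moreover have "\<bar>g p\<bar> * (3 / 4) \<le> \<bar>g p * weight K p x\<bar>"
      using wp unfolding abs_mult by (intro mult_left_mono) auto
    ultimately show ?thesis using rest by linarith
  qed
  have cont: "continuous_on K (\<lambda>x. (?w x)\<^sup>2)"
    by (intro continuous_intros continuous_on_weight[OF K])
  have intC: "interior C \<in> sets lebesgue" by simp
  have "(\<Sum>q\<in>verts K. (g q)\<^sup>2) \<le> (\<Sum>q\<in>verts K. (g p)\<^sup>2)"
    using max by (intro sum_mono) (simp add: abs_le_square_iff)
  also have "\<dots> = 2 ^ CARD('n) * (g p)\<^sup>2"
    by (simp add: card_verts[OF K])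
  finally have "mass_const CARD('n) * measure lebesgue K * (\<Sum>q\<in>verts K. (g q)\<^sup>2)
      \<le> mass_const CARD('n) * measure lebesgue K * (2 ^ CARD('n) * (g p)\<^sup>2)"
    by (intro mult_left_mono) (auto simp: mass_const_def)
  also have "\<dots> = (g p)\<^sup>2 / 4 * measure lebesgue (interior C)"
    unfolding mC by (simp add: mass_const_def \<delta>_def)
  also have "\<dots> = (LINT x:interior K|lebesgue. indicator (interior C) x * ((g p)\<^sup>2 / 4))"
  proof -
    have "interior C \<subseteq> interior K" using \<open>C \<subseteq> K\<close> by (rule interior_mono)
    hence "(\<lambda>x. indicator (interior K) x *\<^sub>R (indicator (interior C) x * ((g p)\<^sup>2 / 4)))
        = (\<lambda>x. indicator (interior C) x *\<^sub>R ((g p)\<^sup>2 / 4))"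
      by (auto simp: indicator_def fun_eq_iff)
    thus ?thesis
      unfolding set_lebesgue_integral_def by simp
  qed
  also have "\<dots> \<le> (LINT x:interior K|lebesgue. (?w x)\<^sup>2)"
  proof (rule set_integral_mono)
    have "integrable lebesgue (\<lambda>x. indicator (interior C \<inter> interior K) x *\<^sub>R ((g p)\<^sup>2 / 4))"
      using lmeasurable_elem(2)
      by (intro integrable_scaleR_left integrable_real_indicator)
         (auto simp: fmeasurable_def intro: le_less_trans[OF emeasure_mono])
    moreover have "(\<lambda>x. indicator (interior C \<inter> interior K) x *\<^sub>R ((g p)\<^sup>2 / 4))
        = (\<lambda>x. indicator (interior K) x *\<^sub>R (indicator (interior C) x * ((g p)\<^sup>2 / 4)))"
      by (auto simp: indicator_def fun_eq_iff)
    ultimately show "set_integrable lebesgue (interior K) (\<lambda>x. indicator (interior C) x * ((g p)\<^sup>2 / 4))"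
      by (simp only: set_integrable_def)
    show "set_integrable lebesgue (interior K) (\<lambda>x. (?w x)\<^sup>2)"
      using cont by (rule set_integrable_continuous_elem)
    fix x
    show "indicator (interior C) x * ((g p)\<^sup>2 / 4) \<le> (?w x)\<^sup>2"
    proof (cases "x \<in> interior C")
      case True
      hence "\<bar>g p\<bar> / 2 \<le> \<bar>?w x\<bar>" using half interior_subset by blast
      hence "(\<bar>g p\<bar> / 2)\<^sup>2 \<le> \<bar>?w x\<bar>\<^sup>2" by (intro power_mono) auto
      thus ?thesis using True by (simp add: power_divide)
    qed simp
  qed
  finally show ?thesis .
qed

definition move_vertex :: "'n \<Rightarrow> real \<Rightarrow> real ^ 'n \<Rightarrow> real ^ 'n" where
  "move_vertex j t q = (THE q'. ecoords K q' = (\<chi> i. if i = j then t else ecoords K q $ i))"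

lemma ecoords_move_vertex: "ecoords K (move_vertex j t q) = (\<chi> i. if i = j then t else ecoords K q $ i)"
proof -
  have "\<exists>!q'. ecoords K q' = (\<chi> i. if i = j then t else ecoords K q $ i)"
    using ecoords_surj[OF K] ecoords_eq_iff[OF K] by metis
  from theI'[OF this] show ?thesis by (simp add: move_vertex_def)
qed

text \<open>The derivative along an edge direction is again a sum of shape functions, now with edge
  differences as nodal values, so that \<open>mass_lower_bound\<close> applies to it.\<close>

lemma deriv_along_edge:
  "(\<Sum>p\<in>verts K. g p *\<^sub>R dweight K p x) \<bullet> elem_edge K j
     = (\<Sum>q\<in>verts K. (g (move_vertex j 1 q) - g (move_vertex j 0 q)) * weight K q x)"
proof -
  \<comment> \<open>The sums over corners need the nodal values as a function of the local
    coordinates.\<close>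
  obtain G where G: "\<And>q. g q = G (ecoords K q)"
  proof
    show "g q = g (THE q'. ecoords K q' = ecoords K q)" for q
      by (simp add: ecoords_eq_iff[OF K])
  qed
  have "(\<Sum>p\<in>verts K. g p *\<^sub>R dweight K p x) \<bullet> elem_edge K j
      = (\<Sum>p\<in>verts K. g p * ((2 * ecoords K p $ j - 1) *
     (\<Prod>i\<in>-{j}. ecoords K p $ i * ecoords K x $ i + (1 - ecoords K p $ i) * (1 - ecoords K x $ i))))"
    unfolding dweight_def inner_sum_left
    by (simp add: inner_sum_left elem_row_edge if_distrib sum.delta' cong: if_cong)
  also have "\<dots> = (\<Sum>s\<in>corners. G s * ((2 * s $ j - 1) *
     (\<Prod>i\<in>-{j}. s $ i * ecoords K x $ i + (1 - s $ i) * (1 - ecoords K x $ i))))"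
    unfolding G by (rule sum_verts[OF K])
  also have "\<dots> = (\<Sum>s\<in>corners. (G (\<chi> i. if i = j then 1 else s $ i) - G (\<chi> i. if i = j then 0 else s $ i))
      * cweight s (ecoords K x))"
    by (rule sum_cweight_deriv)
  also have "\<dots> = (\<Sum>q\<in>verts K. (G (\<chi> i. if i = j then 1 else ecoords K q $ i)
      - G (\<chi> i. if i = j then 0 else ecoords K q $ i)) * cweight (ecoords K q) (ecoords K x))"
    by (rule sum_verts[OF K, symmetric])
  finally show ?thesis
    unfolding G ecoords_move_vertex weight_def .
qed

text \<open>Each edge difference is a nodal value of a directional derivative and hence bounded by
  the gradient. Walking along edges joins any vertex to the local origin in at most d steps, so two
  vertices are at most \<open>2 * d\<close> edges apart; each edge vector is at most as long as the
  diameter.\<close>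

lemma gradient_lower_bound:
  assumes p: "p \<in> verts K" and q: "q \<in> verts K"
  shows "mass_const CARD('n) * measure lebesgue K * (g p - g q)\<^sup>2
     \<le> (2 * real CARD('n) * diameter K)\<^sup>2 *
        (LINT x:interior K|lebesgue. (norm (\<Sum>p\<in>verts K. g p *\<^sub>R dweight K p x))\<^sup>2)"
proof -
  let ?D = "\<lambda>x. \<Sum>p\<in>verts K. g p *\<^sub>R dweight K p x"
  define m where "m = mass_const CARD('n) * measure lebesgue K"
  define I where "I = (LINT x:interior K|lebesgue. (norm (?D x))\<^sup>2)"
  have m0: "0 \<le> m" by (simp add: m_def mass_const_def)
  have I0: "0 \<le> I"
    unfolding I_def set_lebesgue_integral_def by (intro Bochner_Integration.integral_nonneg) simp
  have diam0: "0 \<le> diameter K"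
    using compact_imp_bounded[OF compact_elem[OF K]] by (rule diameter_ge_0)
  define h where "h j q = g (move_vertex j 1 q) - g (move_vertex j 0 q)" for j q
  have contD: "continuous_on K ?D"
    by (intro continuous_intros continuous_on_dweight)
  have edge: "m * (h j q)\<^sup>2 \<le> (diameter K)\<^sup>2 * I" if q: "q \<in> verts K" for j q
  proof -
    have "m * (h j q)\<^sup>2 \<le> m * (\<Sum>q\<in>verts K. (h j q)\<^sup>2)"
      using q finite_verts[OF K] m0 by (intro mult_left_mono member_le_sum) auto
    also have "\<dots> \<le> (LINT x:interior K|lebesgue. (\<Sum>q\<in>verts K. h j q * weight K q x)\<^sup>2)"
      unfolding m_def by (rule mass_lower_bound)
    also have "\<dots> = (LINT x:interior K|lebesgue. (?D x \<bullet> elem_edge K j)\<^sup>2)"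
      by (simp only: deriv_along_edge h_def)
    also have "\<dots> \<le> (LINT x:interior K|lebesgue. (diameter K)\<^sup>2 * (norm (?D x))\<^sup>2)"
    proof (rule set_integral_mono)
      fix x
      have "\<bar>?D x \<bullet> elem_edge K j\<bar> \<le> norm (?D x) * diameter K"
        using norm_elem_edge by (intro order.trans[OF Cauchy_Schwarz_ineq2] mult_left_mono) auto
      hence "\<bar>?D x \<bullet> elem_edge K j\<bar>\<^sup>2 \<le> (norm (?D x) * diameter K)\<^sup>2"
        by (intro power_mono) auto
      thus "(?D x \<bullet> elem_edge K j)\<^sup>2 \<le> (diameter K)\<^sup>2 * (norm (?D x))\<^sup>2"
        by (simp add: power_mult_distrib mult.commute)
    qed (intro set_integrable_continuous_elem continuous_intros contD)+
    also have "\<dots> = (diameter K)\<^sup>2 * I"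
      unfolding I_def by simp
    finally show ?thesis .
  qed
  define pt where "pt S = (THE q. ecoords K q = corner S)" for S
  have pt: "ecoords K (pt S) = corner S" for S
  proof -
    have "\<exists>!q. ecoords K q = corner S"
      using ecoords_surj[OF K] ecoords_eq_iff[OF K] by metis
    from theI'[OF this] show ?thesis by (simp add: pt_def)
  qed
  have pt_vert: "pt S \<in> verts K" for S
    using pt[of S] by (simp add: mem_verts_iff[OF K] corners_def)
  have "ecoords K (move_vertex j 1 (pt S)) = ecoords K (pt (insert j S))"
    "ecoords K (move_vertex j 0 (pt S)) = ecoords K (pt (S - {j}))" for j S
    unfolding ecoords_move_vertex pt by (auto simp: vec_eq_iff)
  hence pt_move: "move_vertex j 1 (pt S) = pt (insert j S)" "move_vertex j 0 (pt S) = pt (S - {j})" for j S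
    by (simp_all add: ecoords_eq_iff[OF K])
  have chain: "sqrt m * \<bar>g (pt S) - g (pt {})\<bar> \<le> card S * (diameter K * sqrt I)" if "finite S" for S
    using that
  proof induction
    case (insert j S)
    have "sqrt (m * (h j (pt S))\<^sup>2) \<le> sqrt ((diameter K)\<^sup>2 * I)"
      using edge[OF pt_vert] by simp
    hence "sqrt m * \<bar>h j (pt S)\<bar> \<le> diameter K * sqrt I"
      using diam0 by (simp add: real_sqrt_mult)
    moreover have "h j (pt S) = g (pt (insert j S)) - g (pt S)"
      using insert by (simp add: h_def pt_move)
    moreover have "sqrt m * \<bar>g (pt (insert j S)) - g (pt {})\<bar>
        \<le> sqrt m * (\<bar>g (pt (insert j S)) - g (pt S)\<bar> + \<bar>g (pt S) - g (pt {})\<bar>)"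
      using m0 by (intro mult_left_mono) auto
    ultimately show ?case
      using insert by (simp add: distrib_left distrib_right)
  qed simp
  have bound: "sqrt m * \<bar>g p - g (pt {})\<bar> \<le> CARD('n) * (diameter K * sqrt I)" if p: "p \<in> verts K" for p
  proof -
    have "ecoords K p \<in> corners" using p by (simp add: mem_verts_iff[OF K])
    then obtain S where "ecoords K p = corner S"
      using bij_betw_corner by (metis bij_betw_def imageE)
    hence "p = pt S" using pt by (metis ecoords_eq_iff[OF K])
    moreover have "card S * (diameter K * sqrt I) \<le> CARD('n) * (diameter K * sqrt I)"
      using diam0 I0 by (intro mult_right_mono) (auto intro: card_mono)
    ultimately show ?thesis using chain[of S] by simp
  qed
  have "sqrt m * \<bar>g p - g q\<bar> \<le> sqrt m * (\<bar>g p - g (pt {})\<bar> + \<bar>g q - g (pt {})\<bar>)"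
    using m0 by (intro mult_left_mono) auto
  also have "\<dots> \<le> 2 * CARD('n) * diameter K * sqrt I"
    using bound[OF p] bound[OF q] by (simp add: distrib_left)
  finally have "(sqrt m * \<bar>g p - g q\<bar>)\<^sup>2 \<le> (2 * CARD('n) * diameter K * sqrt I)\<^sup>2"
    using m0 by (intro power_mono) auto
  thus ?thesis
    using m0 I0 by (simp add: power_mult_distrib m_def I_def)
qed

end


section \<open>Forms on the mesh and the discrete Poincare inequality\<close>

text \<open>The form is kept as a sum of element matrices. A shared vertex occurs once for each of
  its elements, and sparsity is built in: only vertices of a common element interact.\<close>

definition nform ::
  "'e set \<Rightarrow> ('e \<Rightarrow> 'p set) \<Rightarrow> ('e \<Rightarrow> 'p \<Rightarrow> 'p \<Rightarrow> real) \<Rightarrow> ('p \<Rightarrow> real) \<Rightarrow> ('p \<Rightarrow> real) \<Rightarrow> real" where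
  "nform \<E> V M x y = (\<Sum>K\<in>\<E>. \<Sum>p\<in>V K. \<Sum>q\<in>V K. M K p q * (x p * y q))"

definition mass_entry :: "(real ^ 'n) set \<Rightarrow> real ^ 'n \<Rightarrow> real ^ 'n \<Rightarrow> real" where
  "mass_entry K p q = (LINT x:interior K|lebesgue. weight K p x * weight K q x)"

definition stiff_entry ::
  "(real ^ 'n \<Rightarrow> real) \<Rightarrow> (real ^ 'n) set \<Rightarrow> real ^ 'n \<Rightarrow> real ^ 'n \<Rightarrow> real" where
  "stiff_entry A K p q = (LINT x:interior K|lebesgue. A x * (dweight K p x \<bullet> dweight K q x))"

lemma set_integral_double_sum:
  fixes F :: "'p \<Rightarrow> 'q \<Rightarrow> 'a \<Rightarrow> real"
  assumes "\<And>p q. p \<in> P \<Longrightarrow> q \<in> Q \<Longrightarrow> set_integrable M S (F p q)"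
  shows "set_integrable M S (\<lambda>x. \<Sum>p\<in>P. \<Sum>q\<in>Q. F p q x * c p q)"
    and "(LINT x:S|M. \<Sum>p\<in>P. \<Sum>q\<in>Q. F p q x * c p q) = (\<Sum>p\<in>P. \<Sum>q\<in>Q. (LINT x:S|M. F p q x) * c p q)"
proof -
  have int: "integrable M (\<lambda>x. indicator S x *\<^sub>R (F p q x * c p q))" if "p \<in> P" "q \<in> Q" for p q
    using assms[OF that] set_integrable_mult_left[of "c p q" M S "F p q"] by (auto simp: set_integrable_def)
  have eq: "(\<lambda>x. indicator S x *\<^sub>R (\<Sum>p\<in>P. \<Sum>q\<in>Q. F p q x * c p q))
      = (\<lambda>x. \<Sum>p\<in>P. \<Sum>q\<in>Q. indicator S x *\<^sub>R (F p q x * c p q))"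
    by (simp add: sum_distrib_left)
  show "set_integrable M S (\<lambda>x. \<Sum>p\<in>P. \<Sum>q\<in>Q. F p q x * c p q)"
    unfolding set_integrable_def eq using int by (intro Bochner_Integration.integrable_sum) auto
  have "(LINT x:S|M. \<Sum>p\<in>P. \<Sum>q\<in>Q. F p q x * c p q)
      = (\<Sum>p\<in>P. \<Sum>q\<in>Q. LINT x:S|M. F p q x * c p q)"
    unfolding set_lebesgue_integral_def eq using int
    by (subst Bochner_Integration.integral_sum)
       (auto intro!: Bochner_Integration.integrable_sum sum.cong Bochner_Integration.integral_sum)
  thus "(LINT x:S|M. \<Sum>p\<in>P. \<Sum>q\<in>Q. F p q x * c p q)
      = (\<Sum>p\<in>P. \<Sum>q\<in>Q. (LINT x:S|M. F p q x) * c p q)"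
    by simp
qed

lemma abs_set_integral_le:
  fixes f :: "'a::euclidean_space \<Rightarrow> real"
  assumes "S \<in> lmeasurable" "set_integrable lebesgue S f" "AE x\<in>S in lebesgue. \<bar>f x\<bar> \<le> B"
  shows "\<bar>LINT x:S|lebesgue. f x\<bar> \<le> B * measure lebesgue S"
proof -
  have fin: "emeasure lebesgue S \<noteq> \<infinity>" "S \<in> sets lebesgue"
    using assms(1) by (auto simp: fmeasurable_def)
  have const: "set_integrable lebesgue S (\<lambda>x. c)" for c :: real
    using assms(1) unfolding set_integrable_def
    by (intro integrable_scaleR_left integrable_real_indicator) (auto simp: fmeasurable_def)
  have "(LINT x:S|lebesgue. f x) \<le> (LINT x:S|lebesgue. B)"
    using assms by (intro set_integral_mono_AE const) (auto elim!: eventually_mono)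
  moreover have "(LINT x:S|lebesgue. - B) \<le> (LINT x:S|lebesgue. f x)"
    using assms by (intro set_integral_mono_AE const) (auto elim!: eventually_mono)
  ultimately show ?thesis
    using fin by (simp add: set_integral_const mult.commute)
qed

text \<open>Next to a boundary point, the part \<open>U\<close> of the ball strictly above the graph
  is open and disjoint from the domain, and it contains points arbitrarily close to the boundary
  point. This excludes slits, so that mesh elements have their interiors inside the domain.\<close>

lemma interior_closure_lipschitz_domain:
  fixes \<Omega> :: "(real ^ 'n) set"
  assumes "open \<Omega>" "lipschitz_domain \<Omega>"
  shows "interior (closure \<Omega>) = \<Omega>"
proof (intro equalityI subsetI)
  fix x assume x: "x \<in> interior (closure \<Omega>)"
  show "x \<in> \<Omega>"
  proof (rule ccontr)
    assume "x \<notin> \<Omega>"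
    moreover have "x \<in> closure \<Omega>" using x interior_subset by blast
    ultimately have "x \<in> frontier \<Omega>"
      using assms(1) by (simp add: frontier_def interior_open)
    then obtain r e L and \<phi> :: "real ^ 'n \<Rightarrow> real" where r: "0 < r" and e: "norm e = 1"
      and L: "L-lipschitz_on UNIV \<phi>"
      and eq: "\<Omega> \<inter> ball x r = {y \<in> ball x r. y \<bullet> e < \<phi> (y - (y \<bullet> e) *\<^sub>R e)}"
      using assms(2) unfolding lipschitz_domain_def by blast
    obtain r' where r': "0 < r'" "ball x r' \<subseteq> closure \<Omega>"
      using x by (meson mem_interior)
    define s where "s = min r r' / 2"
    have s: "0 < s" "s < r" "s < r'" using r r' by (auto simp: s_def)
    define y where "y = x + s *\<^sub>R e"
    have y: "y \<in> ball x r" "y \<in> ball x r'"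
      using s e by (auto simp: y_def dist_norm)
    define U where "U = {y \<in> ball x r. y \<bullet> e > \<phi> (y - (y \<bullet> e) *\<^sub>R e)}"
    have "open U"
    proof -
      have "continuous_on UNIV \<phi>" using L by (rule lipschitz_on_continuous_on)
      hence "continuous_on UNIV (\<lambda>y. \<phi> (y - (y \<bullet> e) *\<^sub>R e))"
        by (rule continuous_on_compose2) (auto intro!: continuous_intros)
      hence "open {y. \<phi> (y - (y \<bullet> e) *\<^sub>R e) < y \<bullet> e}"
        by (intro open_Collect_less continuous_intros)
      moreover have "U = ball x r \<inter> {y. \<phi> (y - (y \<bullet> e) *\<^sub>R e) < y \<bullet> e}"
        by (auto simp: U_def)
      ultimately show ?thesis by (simp add: open_Int)
    qed
    moreover have "y \<in> U"
    proof -
      have ee: "e \<bullet> e = 1" using e by (simp add: dot_square_norm)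
      have "y - (y \<bullet> e) *\<^sub>R e = x - (x \<bullet> e) *\<^sub>R e"
        by (simp add: y_def inner_add_left ee algebra_simps)
      moreover have "\<phi> (x - (x \<bullet> e) *\<^sub>R e) \<le> x \<bullet> e"
        using \<open>x \<notin> \<Omega>\<close> eq r by (metis (no_types, lifting) IntD1 centre_in_ball mem_Collect_eq not_le)
      ultimately show ?thesis
        using y s by (simp add: U_def) (simp add: y_def inner_add_left ee)
    qed
    ultimately have "U \<inter> \<Omega> \<noteq> {}"
      using y r' by (meson disjoint_iff open_Int_closure_eq_empty subsetD)
    thus False using eq by (force simp: U_def)
  qed
next
  fix x assume "x \<in> \<Omega>"
  thus "x \<in> interior (closure \<Omega>)"
    using assms(1) closure_subset interior_maximal by blast
qed

section \<open>Counting elements and element-wise integration\<close>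

lemma measure_cball:
  fixes c :: "real ^ 'n"
  assumes "0 \<le> r"
  shows "measure lebesgue (cball c r) = unit_ball_vol CARD('n) * r ^ CARD('n)"
  using content_cball[OF assms, of c] by (simp add: measure_completion)

locale ball_mesh = para_mesh \<T> for \<T> :: "(real ^ 'n) set set" +
  fixes r :: real
  assumes r_pos: "0 < r"
    and inscribed: "K \<in> \<T> \<Longrightarrow> \<exists>c. cball c r \<subseteq> K"
begin

lemma interior_nonempty: "K \<in> \<T> \<Longrightarrow> interior K \<noteq> {}"
  using inscribed[of K] r_pos by (metis ball_subset_cball centre_in_ball empty_iff
    interior_maximal open_ball subset_trans subsetD)

text \<open>The intersection is a face that meets the interior of \<open>K\<close>, hence all of
  \<open>K\<close>; then it also meets the interior of \<open>K'\<close>.\<close>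

lemma elem_eq_if_interior_meets:
  assumes K: "K \<in> \<T>" "K' \<in> \<T>" and x: "x \<in> interior K" "x \<in> K'"
  shows "K = K'"
proof -
  have "x \<in> K" using x interior_subset by blast
  hence "(K \<inter> K') \<inter> rel_interior K \<noteq> {}"
    using x rel_interior_nonempty_interior[OF interior_nonempty[OF K(1)]] by auto
  hence sub: "K \<subseteq> K \<inter> K'"
    by (rule subset_of_face_of[OF face[OF K] subset_refl])
  hence "interior K \<subseteq> interior K'" by (intro interior_mono) auto
  hence "(K \<inter> K') \<inter> rel_interior K' \<noteq> {}"
    using x \<open>x \<in> K\<close> rel_interior_nonempty_interior[OF interior_nonempty[OF K(2)]] by auto
  hence "K' \<subseteq> K \<inter> K'"
    by (rule subset_of_face_of[OF face'[OF K] subset_refl])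
  thus ?thesis using sub by auto
qed

lemma disjoint_interiors: "C \<subseteq> \<T> \<Longrightarrow> disjoint_family_on interior C"
  unfolding disjoint_family_on_def
  using elem_eq_if_interior_meets interior_subset by blast

lemma closure_interior_elem: "K \<in> \<T> \<Longrightarrow> closure (interior K) = K"
  using convex_closure_interior[OF convex_elem[OF para] interior_nonempty] closed_elem[OF para]
  by (simp add: closure_closed)

lemma measure_elem_ge: "K \<in> \<T> \<Longrightarrow> unit_ball_vol CARD('n) * r ^ CARD('n) \<le> measure lebesgue K"
proof -
  assume K: "K \<in> \<T>"
  then obtain c where "cball c r \<subseteq> K" using inscribed by blast
  hence "measure lebesgue (cball c r) \<le> measure lebesgue K"
    using lmeasurable_elem(1)[OF para[OF K]] by (intro measure_mono_fmeasurable) auto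
  thus ?thesis using measure_cball[of r c] r_pos by simp
qed

lemma sum_measure_le:
  assumes "\<Union>\<T> \<subseteq> cball c R" "0 \<le> R"
  shows "(\<Sum>K\<in>\<T>. measure lebesgue K) \<le> unit_ball_vol CARD('n) * R ^ CARD('n)"
proof -
  have "(\<Sum>K\<in>\<T>. measure lebesgue K) = (\<Sum>K\<in>\<T>. measure lebesgue (interior K))"
    by (intro sum.cong refl measure_interior_elem[symmetric] para)
  also have "\<dots> = measure lebesgue (\<Union>K\<in>\<T>. interior K)"
  proof (rule measure_finite_Union[symmetric])
    show "emeasure lebesgue (interior K) \<noteq> \<infinity>" if "K \<in> \<T>" for K
      using lmeasurable_elem(2)[OF para[OF that]] by (auto simp: fmeasurable_def)
  qed (use finite_mesh disjoint_interiors[OF order.refl] in auto)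
  also have "\<dots> \<le> measure lebesgue (cball c R)"
  proof (rule measure_mono_fmeasurable)
    show "(\<Union>K\<in>\<T>. interior K) \<subseteq> cball c R"
      using assms(1) interior_subset by blast
    show "(\<Union>K\<in>\<T>. interior K) \<in> sets lebesgue"
      by (intro sets.finite_UN finite_mesh) auto
  qed simp
  finally show ?thesis using measure_cball[OF assms(2), of c] by simp
qed

lemma card_mesh_le:
  assumes "\<Union>\<T> \<subseteq> cball c R" "0 \<le> R"
  shows "real (card \<T>) \<le> (R / r) ^ CARD('n)"
proof -
  have "real (card \<T>) * (unit_ball_vol CARD('n) * r ^ CARD('n)) \<le> (\<Sum>K\<in>\<T>. measure lebesgue K)"
    using sum_mono[of \<T> "\<lambda>_. unit_ball_vol CARD('n) * r ^ CARD('n)" "\<lambda>K. measure lebesgue K"]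
      measure_elem_ge by simp
  hence "real (card \<T>) * (unit_ball_vol CARD('n) * r ^ CARD('n)) \<le> unit_ball_vol CARD('n) * R ^ CARD('n)"
    using sum_measure_le[OF assms] by linarith
  hence "real (card \<T>) * r ^ CARD('n) \<le> R ^ CARD('n)"
    using unit_ball_vol_pos[of "CARD('n)"] by (simp add: algebra_simps)
  thus ?thesis
    using r_pos by (simp add: power_divide field_simps)
qed

text \<open>The sets between the open and the closed union differ by parts of the element
  boundaries, which are null sets. This covers both the domain and the patches, which are interiors
  of unions.\<close>

lemma set_integral_mesh:
  fixes f :: "real ^ 'n \<Rightarrow> real"
  assumes C: "C \<subseteq> \<T>" and S: "(\<Union>K\<in>C. interior K) \<subseteq> S" "S \<subseteq> \<Union>C"
    and f: "\<And>K. K \<in> C \<Longrightarrow> set_integrable lebesgue (interior K) f"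
  shows "(LINT x:S|lebesgue. f x) = (\<Sum>K\<in>C. LINT x:interior K|lebesgue. f x)"
proof -
  let ?U = "\<Union>K\<in>C. interior K"
  have finC: "finite C" using C finite_mesh finite_subset by blast
  have "negligible (\<Union>K\<in>C. frontier K)"
    using finC C para convex_elem by (intro negligible_Union) (auto intro!: negligible_convex_frontier)
  moreover have "{x \<in> S - ?U. f x \<noteq> 0} \<subseteq> (\<Union>K\<in>C. frontier K)"
  proof
    fix x assume "x \<in> {x \<in> S - ?U. f x \<noteq> 0}"
    then obtain K where "K \<in> C" "x \<in> K" "x \<notin> interior K" using S by blast
    thus "x \<in> (\<Union>K\<in>C. frontier K)"
      using closure_subset by (auto simp: frontier_def)
  qed
  ultimately have neg: "negligible {x \<in> S - ?U. f x \<noteq> 0}"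
    by (rule negligible_subset)
  have neg': "negligible {x \<in> ?U - S. f x \<noteq> 0}"
    by (rule negligible_subset[of "{}"]) (use S in auto)
  have intU: "set_integrable lebesgue ?U f"
    using finC f by (intro set_integrable_UN) auto
  have "f absolutely_integrable_on S"
    using absolutely_integrable_spike_set[OF intU neg' neg] .
  hence "(LINT x:S|lebesgue. f x) = integral S f"
    by (rule set_lebesgue_integral_eq_integral(2))
  also have "\<dots> = integral ?U f"
    using neg neg' by (rule integral_spike_set)
  also have "\<dots> = (LINT x:?U|lebesgue. f x)"
    using set_lebesgue_integral_eq_integral(2)[OF intU] by simp
  also have "\<dots> = (\<Sum>K\<in>C. LINT x:interior K|lebesgue. f x)"
    using finC disjoint_interiors[OF C] f by (intro set_integral_finite_Union) auto
  finally show ?thesis .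
qed

lemma l2_inner_eq_nform:
  assumes C: "C \<subseteq> \<T>" and S: "(\<Union>K\<in>C. interior K) \<subseteq> S" "S \<subseteq> \<Union>C"
    and v: "v \<in> Q1_space \<T>" and w: "w \<in> Q1_space \<T>"
  shows "l2_inner S v w = nform C verts mass_entry v w"
proof -
  let ?f = "\<lambda>K x. \<Sum>p\<in>verts K. \<Sum>q\<in>verts K. (weight K p x * weight K q x) * (v p * w q)"
  have eq: "v x * w x = ?f K x" if "K \<in> C" "x \<in> interior K" for K x
  proof -
    have "K \<in> \<T>" "x \<in> K" using that C interior_subset by auto
    thus ?thesis
      using Q1_space_weights[OF v] Q1_space_weights[OF w] by (simp add: sum_product mult_ac)
  qed
  have integ: "set_integrable lebesgue (interior K) (\<lambda>x. weight K p x * weight K q x)" if "K \<in> C" for K p q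
    using that C para
    by (intro set_integrable_continuous_elem continuous_intros continuous_on_weight) auto
  have "set_integrable lebesgue (interior K) (\<lambda>x. v x * w x)" if "K \<in> C" for K
    using set_integral_double_sum(1)[OF integ[OF that]] eq[OF that] by (simp cong: set_integrable_cong)
  hence "l2_inner S v w = (\<Sum>K\<in>C. LINT x:interior K|lebesgue. v x * w x)"
    unfolding l2_inner_def by (rule set_integral_mesh[OF C S])
  also have "\<dots> = (\<Sum>K\<in>C. LINT x:interior K|lebesgue. ?f K x)"
    using eq by (intro sum.cong refl set_lebesgue_integral_cong) auto
  also have "\<dots> = nform C verts mass_entry v w"
    unfolding nform_def mass_entry_def using integ by (intro sum.cong refl set_integral_double_sum(2)) auto
  finally show ?thesis .
qed

lemma nform_mass_lower:
  "mass_const CARD('n) * (\<Sum>K\<in>\<T>. measure lebesgue K * (\<Sum>p\<in>verts K. (x p)\<^sup>2))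
     \<le> nform \<T> verts mass_entry x x"
proof -
  have "mass_const CARD('n) * (measure lebesgue K * (\<Sum>p\<in>verts K. (x p)\<^sup>2))
      \<le> (\<Sum>p\<in>verts K. \<Sum>q\<in>verts K. mass_entry K p q * (x p * x q))" if K: "K \<in> \<T>" for K
  proof -
    have "(LINT y:interior K|lebesgue. (\<Sum>p\<in>verts K. x p * weight K p y)\<^sup>2)
        = (LINT y:interior K|lebesgue. \<Sum>p\<in>verts K. \<Sum>q\<in>verts K. (weight K p y * weight K q y) * (x p * x q))"
      by (simp add: power2_eq_square sum_product mult_ac)
    also have "\<dots> = (\<Sum>p\<in>verts K. \<Sum>q\<in>verts K. mass_entry K p q * (x p * x q))"
      unfolding mass_entry_def using para[OF K]
      by (intro set_integral_double_sum(2) set_integrable_continuous_elem continuous_intros continuous_on_weight) auto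
    finally show ?thesis
      using mass_lower_bound[OF para[OF K], of x] by (simp add: mult.assoc)
  qed
  thus ?thesis
    unfolding nform_def sum_distrib_left by (rule sum_mono)
qed

lemma mass_entry_sym: "mass_entry K p q = mass_entry K q p"
  by (simp add: mass_entry_def mult.commute)

lemma abs_mass_entry:
  assumes K: "K \<in> \<T>" and p: "p \<in> verts K" and q: "q \<in> verts K"
  shows "\<bar>mass_entry K p q\<bar> \<le> measure lebesgue K"
proof -
  have "\<bar>mass_entry K p q\<bar> \<le> 1 * measure lebesgue (interior K)"
    unfolding mass_entry_def
  proof (rule abs_set_integral_le)
    show "set_integrable lebesgue (interior K) (\<lambda>x. weight K p x * weight K q x)"
      using para[OF K] by (intro set_integrable_continuous_elem continuous_intros continuous_on_weight)
    show "AE x\<in>interior K in lebesgue. \<bar>weight K p x * weight K q x\<bar> \<le> 1"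
    proof (intro AE_I2 impI)
      fix x assume "x \<in> interior K"
      hence x: "x \<in> K" using interior_subset by blast
      show "\<bar>weight K p x * weight K q x\<bar> \<le> 1"
        using weight_nonneg[OF para[OF K] _ x] weight_le_1[OF para[OF K] _ x] p q
        by (simp add: abs_mult mult_le_one)
    qed
  qed (rule lmeasurable_elem(2)[OF para[OF K]])
  thus ?thesis by (simp add: measure_interior_elem[OF para[OF K]])
qed

end

locale fe_mesh = ball_mesh \<T> r for \<T> :: "(real ^ 'n) set set" and r +
  fixes \<Omega> :: "(real ^ 'n) set" and A :: "real ^ 'n \<Rightarrow> real" and \<alpha> \<beta> h :: real
  assumes open_domain: "open \<Omega>" and bounded_domain: "bounded \<Omega>" and connected_domain: "connected \<Omega>"
    and domain_nonempty: "\<Omega> \<noteq> {}"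
    and regular_domain: "interior (closure \<Omega>) = \<Omega>"
    and cover: "\<Union>\<T> = closure \<Omega>"
    and diam: "K \<in> \<T> \<Longrightarrow> diameter K \<le> h"
    and A_measurable: "A \<in> borel_measurable (lebesgue_on \<Omega>)"
    and A_bounds: "AE x in lebesgue_on \<Omega>. \<alpha> \<le> A x \<and> A x \<le> \<beta>"
    and alpha_pos: "0 < \<alpha>" and alpha_le_beta: "\<alpha> \<le> \<beta>"
begin

lemma interior_elem_subset: "K \<in> \<T> \<Longrightarrow> interior K \<subseteq> \<Omega>"
  using cover regular_domain interior_mono[of K "closure \<Omega>"] by blast

lemma A_bounds_elem:
  assumes "K \<in> \<T>"
  shows "AE x\<in>interior K in lebesgue. \<alpha> \<le> A x \<and> A x \<le> \<beta>"
proof -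
  have "AE x in lebesgue. x \<in> \<Omega> \<longrightarrow> \<alpha> \<le> A x \<and> A x \<le> \<beta>"
    using A_bounds open_domain by (subst (asm) AE_restrict_space_iff) auto
  thus ?thesis
    using interior_elem_subset[OF assms] by (auto elim!: eventually_mono)
qed

lemma set_integrable_A_mult:
  assumes K: "K \<in> \<T>" and g: "continuous_on K g"
  shows "set_integrable lebesgue (interior K) (\<lambda>x. A x * g x)"
proof -
  have "bounded (g ` K)"
    using g compact_elem[OF para[OF K]] by (intro compact_imp_bounded compact_continuous_image)
  then obtain M where M: "\<And>x. x \<in> K \<Longrightarrow> norm (g x) \<le> M"
    by (auto simp: bounded_iff)
  have "continuous_on (interior K) g"
    using g interior_subset continuous_on_subset by blast
  hence "g \<in> borel_measurable (lebesgue_on (interior K))"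
    by (intro continuous_imp_measurable_on_sets_lebesgue) auto
  moreover have "A \<in> borel_measurable (lebesgue_on (interior K))"
    using A_measurable interior_elem_subset[OF K] by (rule measurable_restrict_mono)
  moreover have "AE x in lebesgue_on (interior K). norm (A x * g x) \<le> \<beta> * M"
  proof (subst AE_restrict_space_iff)
    show "AE x in lebesgue. x \<in> interior K \<longrightarrow> norm (A x * g x) \<le> \<beta> * M"
      using A_bounds_elem[OF K]
    proof eventually_elim
      case (elim x)
      show ?case
      proof
        assume x: "x \<in> interior K"
        hence "norm (g x) \<le> M" using M interior_subset by blast
        thus "norm (A x * g x) \<le> \<beta> * M"
          using elim x alpha_pos by (auto simp: abs_mult intro!: mult_mono)
      qed
    qed
  qed simp
  ultimately have "integrable (lebesgue_on (interior K)) (\<lambda>x. A x * g x)"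
    using finite_measure_lebesgue_on[OF lmeasurable_elem(2)[OF para[OF K]]]
    by (intro finite_measure.integrable_const_bound) auto
  thus ?thesis
    by (simp add: integrable_restrict_space set_integrable_def)
qed

lemma set_integrable_stiff:
  "K \<in> \<T> \<Longrightarrow> set_integrable lebesgue (interior K) (\<lambda>x. A x * (dweight K p x \<bullet> dweight K q x))"
  by (intro set_integrable_A_mult continuous_intros continuous_on_dweight para)

lemma a_form_eq_nform:
  assumes C: "C \<subseteq> \<T>" and S: "(\<Union>K\<in>C. interior K) \<subseteq> S" "S \<subseteq> \<Union>C"
    and v: "v \<in> Q1_space \<T>" and w: "w \<in> Q1_space \<T>"
  shows "a_form A S v w = nform C verts (stiff_entry A) v w"
proof -
  let ?f = "\<lambda>K x. \<Sum>p\<in>verts K. \<Sum>q\<in>verts K. (A x * (dweight K p x \<bullet> dweight K q x)) * (v p * w q)"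
  have eq: "(A x *\<^sub>R grad v x) \<bullet> grad w x = ?f K x" if "K \<in> C" "x \<in> interior K" for K x
  proof -
    have "K \<in> \<T>" using that C by auto
    hence "grad v x = (\<Sum>p\<in>verts K. v p *\<^sub>R dweight K p x)" "grad w x = (\<Sum>p\<in>verts K. w p *\<^sub>R dweight K p x)"
      using grad_weighted_sum[OF that(2)] Q1_space_weights[OF v] Q1_space_weights[OF w] by blast+
    thus ?thesis
      by (simp add: inner_sum_left inner_sum_right sum_distrib_left mult_ac) (rule sum.swap)
  qed
  have integ: "set_integrable lebesgue (interior K) (\<lambda>x. A x * (dweight K p x \<bullet> dweight K q x))"
    if "K \<in> C" for K p q
    using that C set_integrable_stiff by blast
  have "set_integrable lebesgue (interior K) (\<lambda>x. (A x *\<^sub>R grad v x) \<bullet> grad w x)" if "K \<in> C" for K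
    using set_integral_double_sum(1)[OF integ[OF that]] eq[OF that] by (simp cong: set_integrable_cong)
  hence "a_form A S v w = (\<Sum>K\<in>C. LINT x:interior K|lebesgue. (A x *\<^sub>R grad v x) \<bullet> grad w x)"
    unfolding a_form_def by (rule set_integral_mesh[OF C S])
  also have "\<dots> = (\<Sum>K\<in>C. LINT x:interior K|lebesgue. ?f K x)"
    using eq by (intro sum.cong refl set_lebesgue_integral_cong) auto
  also have "\<dots> = nform C verts (stiff_entry A) v w"
    unfolding nform_def stiff_entry_def using integ by (intro sum.cong refl set_integral_double_sum(2)) auto
  finally show ?thesis .
qed

lemma stiff_entry_sym: "stiff_entry A K p q = stiff_entry A K q p"
  by (simp add: stiff_entry_def inner_commute)

lemma abs_stiff_entry:
  assumes K: "K \<in> \<T>" and p: "p \<in> verts K" and q: "q \<in> verts K"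
  shows "\<bar>stiff_entry A K p q\<bar> \<le> \<beta> * (real CARD('n) / (2 * r))\<^sup>2 * measure lebesgue K"
proof -
  let ?G = "real CARD('n) / (2 * r)"
  obtain c where c: "cball c r \<subseteq> K" using inscribed[OF K] by blast
  have "\<bar>stiff_entry A K p q\<bar> \<le> \<beta> * ?G\<^sup>2 * measure lebesgue (interior K)"
    unfolding stiff_entry_def
  proof (rule abs_set_integral_le)
    show "AE x\<in>interior K in lebesgue. \<bar>A x * (dweight K p x \<bullet> dweight K q x)\<bar> \<le> \<beta> * ?G\<^sup>2"
      using A_bounds_elem[OF K]
    proof eventually_elim
      case (elim x)
      show ?case
      proof
        assume x: "x \<in> interior K"
        hence xK: "x \<in> K" using interior_subset by blast
        have "\<bar>dweight K p x \<bullet> dweight K q x\<bar> \<le> ?G * ?G"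
          using norm_dweight[OF para[OF K] r_pos c _ xK] p q
          by (intro order.trans[OF Cauchy_Schwarz_ineq2] mult_mono) (auto intro: order.trans[OF norm_ge_zero])
        thus "\<bar>A x * (dweight K p x \<bullet> dweight K q x)\<bar> \<le> \<beta> * ?G\<^sup>2"
          using elim x alpha_pos unfolding abs_mult power2_eq_square by (intro mult_mono) auto
      qed
    qed
  qed (use K set_integrable_stiff lmeasurable_elem(2)[OF para[OF K]] in auto)
  thus ?thesis by (simp add: measure_interior_elem[OF para[OF K]])
qed

lemma stiff_elem_lower:
  assumes K: "K \<in> \<T>"
  shows "\<alpha> * (LINT y:interior K|lebesgue. (norm (\<Sum>p\<in>verts K. x p *\<^sub>R dweight K p y))\<^sup>2)
     \<le> (\<Sum>p\<in>verts K. \<Sum>q\<in>verts K. stiff_entry A K p q * (x p * x q))"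
proof -
  let ?D = "\<lambda>y. \<Sum>p\<in>verts K. x p *\<^sub>R dweight K p y"
  have contD: "continuous_on K ?D"
    by (intro continuous_intros continuous_on_dweight para K)
  have "\<alpha> * (LINT y:interior K|lebesgue. (norm (?D y))\<^sup>2) = (LINT y:interior K|lebesgue. \<alpha> * (norm (?D y))\<^sup>2)"
    by simp
  also have "\<dots> \<le> (LINT y:interior K|lebesgue. A y * (norm (?D y))\<^sup>2)"
  proof (rule set_integral_mono_AE)
    show "AE y\<in>interior K in lebesgue. \<alpha> * (norm (?D y))\<^sup>2 \<le> A y * (norm (?D y))\<^sup>2"
      using A_bounds_elem[OF K] by eventually_elim (auto intro: mult_right_mono)
    show "set_integrable lebesgue (interior K) (\<lambda>y. \<alpha> * (norm (?D y))\<^sup>2)"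
      by (intro set_integrable_continuous_elem para K continuous_intros contD)
    show "set_integrable lebesgue (interior K) (\<lambda>y. A y * (norm (?D y))\<^sup>2)"
      by (intro set_integrable_A_mult K continuous_intros contD)
  qed
  also have "\<dots> = (LINT y:interior K|lebesgue.
      \<Sum>p\<in>verts K. \<Sum>q\<in>verts K. (A y * (dweight K p y \<bullet> dweight K q y)) * (x p * x q))"
  proof (rule arg_cong[where f = "set_lebesgue_integral lebesgue (interior K)"], rule ext)
    fix y
    show "A y * (norm (?D y))\<^sup>2
        = (\<Sum>p\<in>verts K. \<Sum>q\<in>verts K. (A y * (dweight K p y \<bullet> dweight K q y)) * (x p * x q))"
      by (simp add: power2_norm_eq_inner inner_sum_left inner_sum_right sum_distrib_left mult_ac)
         (intro sum.cong refl, simp add: inner_commute)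
  qed
  also have "\<dots> = (\<Sum>p\<in>verts K. \<Sum>q\<in>verts K. stiff_entry A K p q * (x p * x q))"
    unfolding stiff_entry_def using set_integrable_stiff[OF K] by (intro set_integral_double_sum(2)) auto
  finally show ?thesis .
qed

lemma stiff_elem_nonneg:
  assumes K: "K \<in> \<T>"
  shows "0 \<le> (\<Sum>p\<in>verts K. \<Sum>q\<in>verts K. stiff_entry A K p q * (x p * x q))"
proof -
  have "0 \<le> (LINT y:interior K|lebesgue. (norm (\<Sum>p\<in>verts K. x p *\<^sub>R dweight K p y))\<^sup>2)"
    unfolding set_lebesgue_integral_def by (intro Bochner_Integration.integral_nonneg) simp
  thus ?thesis using stiff_elem_lower[OF K, of x] alpha_pos
    by (meson mult_nonneg_nonneg order.strict_implies_order order.trans)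
qed

lemma nform_stiff_nonneg: "0 \<le> nform \<T> verts (stiff_entry A) x x"
  unfolding nform_def by (intro sum_nonneg stiff_elem_nonneg)

lemma h_pos: "0 < h"
proof -
  obtain K where K: "K \<in> \<T>"
    using cover domain_nonempty by (metis Union_empty closure_eq_empty ex_in_conv)
  then obtain c where "cball c r \<subseteq> K" using inscribed by blast
  hence "diameter (cball c r) \<le> diameter K"
    using compact_imp_bounded[OF compact_elem[OF para[OF K]]] by (intro diameter_subset)
  thus ?thesis using diam[OF K] r_pos by simp
qed

text \<open>The energy of one element is a non-negative summand of the total energy, and the
  inscribed ball bounds the element volume from below. This supplies the oscillation bound for the
  Poincare inequality.\<close>

lemma vertex_diff_le:
  assumes K: "K \<in> \<T>" and p: "p \<in> verts K" and q: "q \<in> verts K"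
  shows "\<alpha> * mass_const CARD('n) * (unit_ball_vol CARD('n) * r ^ CARD('n)) * (x p - x q)\<^sup>2
     \<le> (2 * real CARD('n) * h)\<^sup>2 * nform \<T> verts (stiff_entry A) x x"
proof -
  let ?I = "LINT y:interior K|lebesgue. (norm (\<Sum>p\<in>verts K. x p *\<^sub>R dweight K p y))\<^sup>2"
  have I0: "0 \<le> ?I"
    unfolding set_lebesgue_integral_def by (intro Bochner_Integration.integral_nonneg) simp
  have "mass_const CARD('n) * (unit_ball_vol CARD('n) * r ^ CARD('n)) * (x p - x q)\<^sup>2
      \<le> mass_const CARD('n) * measure lebesgue K * (x p - x q)\<^sup>2"
    using measure_elem_ge[OF K] by (intro mult_right_mono mult_left_mono) (auto simp: mass_const_def)
  also have "\<dots> \<le> (2 * real CARD('n) * diameter K)\<^sup>2 * ?I"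
    by (rule gradient_lower_bound[OF para[OF K] p q])
  also have "\<dots> \<le> (2 * real CARD('n) * h)\<^sup>2 * ?I"
    using diam[OF K] I0 diameter_ge_0[OF compact_imp_bounded[OF compact_elem[OF para[OF K]]]]
    by (intro mult_right_mono power_mono mult_left_mono) auto
  finally have "\<alpha> * (mass_const CARD('n) * (unit_ball_vol CARD('n) * r ^ CARD('n)) * (x p - x q)\<^sup>2)
      \<le> \<alpha> * ((2 * real CARD('n) * h)\<^sup>2 * ?I)"
    using alpha_pos by (intro mult_left_mono) auto
  also have "\<dots> = (2 * real CARD('n) * h)\<^sup>2 * (\<alpha> * ?I)" by simp
  also have "\<dots> \<le> (2 * real CARD('n) * h)\<^sup>2 * nform \<T> verts (stiff_entry A) x x"
  proof (intro mult_left_mono)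
    have "\<alpha> * ?I \<le> (\<Sum>p\<in>verts K. \<Sum>q\<in>verts K. stiff_entry A K p q * (x p * x q))"
      by (rule stiff_elem_lower[OF K])
    also have "\<dots> \<le> nform \<T> verts (stiff_entry A) x x"
      unfolding nform_def using K finite_mesh stiff_elem_nonneg
      by (intro member_le_sum) auto
    finally show "\<alpha> * ?I \<le> nform \<T> verts (stiff_entry A) x x" .
  qed simp
  finally show ?thesis by (simp add: mult.assoc)
qed

text \<open>The image of the closed domain under \<open>v\<close> is an interval that contains 0 and is covered by
  the images of the elements, whose lengths are bounded by the energy.\<close>

lemma discrete_poincare:
  assumes v: "v \<in> fe_space \<Omega> \<T>" and x: "x \<in> closure \<Omega>"
    and osc: "\<And>K p q. K \<in> \<T> \<Longrightarrow> p \<in> verts K \<Longrightarrow> q \<in> verts K \<Longrightarrow> \<bar>v p - v q\<bar> \<le> e"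
  shows "\<bar>v x\<bar> \<le> real (card \<T>) * e"
proof -
  have vQ: "v \<in> Q1_space \<T>" using v by (simp add: fe_space_def)
  have "frontier \<Omega> \<noteq> {}"
    using domain_nonempty bounded_domain not_bounded_UNIV by (auto simp: frontier_eq_empty)
  then obtain y where y: "y \<in> frontier \<Omega>" by blast
  have y': "y \<in> closure \<Omega>" "v y = 0"
    using y v by (auto simp: frontier_def fe_space_def)
  have cont: "continuous_on (closure \<Omega>) v"
    using vQ cover by (simp add: Q1_space_def)
  have "connected (v ` closure \<Omega>)"
    using cont connected_imp_connected_closure[OF connected_domain] by (rule connected_continuous_image)
  hence "convex (v ` closure \<Omega>)"
    by (simp flip: is_interval_convex_1 is_interval_connected_1)
  hence "closed_segment 0 (v x) \<subseteq> v ` closure \<Omega>"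
    using x y' by (intro closed_segment_subset) (auto simp: image_iff intro: bexI[of _ y])
  \<comment> \<open>Values on an element are convex combinations of its vertex values, so they fill
    at most an interval of length \<open>e\<close> above the smallest of these.\<close>
  moreover have "\<exists>m. \<forall>x\<in>K. m \<le> v x \<and> v x \<le> m + e" if K: "K \<in> \<T>" for K
  proof -
    have fin: "finite (v ` verts K)" "v ` verts K \<noteq> {}"
      using finite_verts[OF para[OF K]] verts_nonempty[OF para[OF K]] by auto
    define m where "m = Min (v ` verts K)"
    have "m \<in> v ` verts K" unfolding m_def using fin by (intro Min_in)
    then obtain p0 where p0: "p0 \<in> verts K" "m = v p0" by blast
    have "m \<le> v x \<and> v x \<le> m + e" if x: "x \<in> K" for x
    proof -
      have vx: "v x = (\<Sum>p\<in>verts K. v p * weight K p x)" by (rule Q1_space_weights[OF vQ K x])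
      have m: "c = (\<Sum>p\<in>verts K. c * weight K p x)" for c
        using sum_weight[OF para[OF K], of x] by (simp flip: sum_distrib_left)
      have w0: "0 \<le> weight K p x" if "p \<in> verts K" for p
        using weight_nonneg[OF para[OF K] that x] .
      have "m \<le> v x"
        unfolding vx by (subst m) (use w0 fin m_def in \<open>auto intro!: sum_mono mult_right_mono Min_le\<close>)
      moreover have "v x \<le> m + e"
      proof -
        have "v p \<le> m + e" if "p \<in> verts K" for p
          using osc[OF K that p0(1)] p0 by auto
        thus ?thesis
          unfolding vx by (subst m) (use w0 in \<open>auto intro!: sum_mono mult_right_mono\<close>)
      qed
      ultimately show ?thesis by simp
    qed
    thus ?thesis by blast
  qed
  then obtain m where m: "\<And>K x. K \<in> \<T> \<Longrightarrow> x \<in> K \<Longrightarrow> m K \<le> v x \<and> v x \<le> m K + e"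
    by metis
  ultimately have sub: "closed_segment 0 (v x) \<subseteq> (\<Union>K\<in>\<T>. {m K..m K + e})"
    unfolding cover[symmetric] by fastforce
  obtain K p where K: "K \<in> \<T>" "p \<in> verts K"
    using x cover verts_nonempty[OF para] by blast
  have e0: "0 \<le> e" using osc[OF K K(2)] by simp
  have "\<bar>v x\<bar> = measure lebesgue (closed_segment 0 (v x))"
    by (auto simp: closed_segment_eq_real_ivl)
  also have "\<dots> \<le> measure lebesgue (\<Union>K\<in>\<T>. {m K..m K + e})"
    using sub finite_mesh by (intro measure_mono_fmeasurable fmeasurable.finite_UN) auto
  also have "\<dots> \<le> (\<Sum>K\<in>\<T>. measure lebesgue {m K..m K + e})"
    using finite_mesh by (intro measure_UNION_le) auto
  also have "\<dots> = real (card \<T>) * e" using e0 by simp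
  finally show ?thesis .
qed

end


section \<open>Exponentially weighted estimates for sparse forms\<close>

text \<open>With element volumes as \<open>k\<close>, an L2 norm with lumped mass. It depends on
  nodal values alone, so it remains meaningful for weighted values that are not finite element
  functions.\<close>

definition nnorm :: "'e set \<Rightarrow> ('e \<Rightarrow> 'p set) \<Rightarrow> ('e \<Rightarrow> real) \<Rightarrow> ('p \<Rightarrow> real) \<Rightarrow> real" where
  "nnorm \<E> V k x = sqrt (\<Sum>K\<in>\<E>. k K * (\<Sum>p\<in>V K. (x p)\<^sup>2))"

lemma cosh_sub_1_le:
  fixes \<mu> :: real
  assumes "0 \<le> \<mu>" "\<mu> \<le> 1"
  shows "cosh \<mu> - 1 \<le> \<mu>\<^sup>2"
proof -
  have "exp \<mu> \<le> 1 + \<mu> + \<mu>\<^sup>2" using assms by (rule exp_bound)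
  \<comment> \<open>Multiply \<open>1 + \<mu> \<le> exp \<mu>\<close> by
    \<open>1 - \<mu> + \<mu>\<^sup>2\<close>; the left-hand side becomes
    \<open>1 + \<mu> ^ 3\<close>.\<close>
  moreover have "exp (- \<mu>) \<le> 1 - \<mu> + \<mu>\<^sup>2"
  proof -
    have "0 \<le> 1 - \<mu> + \<mu>\<^sup>2" using assms by simp
    hence "(1 - \<mu> + \<mu>\<^sup>2) * (1 + \<mu>) \<le> (1 - \<mu> + \<mu>\<^sup>2) * exp \<mu>"
      using exp_ge_add_one_self[of \<mu>] by (intro mult_left_mono)
    moreover have "(1 - \<mu> + \<mu>\<^sup>2) * (1 + \<mu>) = 1 + \<mu> ^ 3"
      by (simp add: algebra_simps power2_eq_square power3_eq_cube)
    moreover have "0 \<le> \<mu> ^ 3" using assms by simp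
    ultimately have "1 \<le> (1 - \<mu> + \<mu>\<^sup>2) * exp \<mu>" by linarith
    thus ?thesis by (simp add: exp_minus field_simps)
  qed
  ultimately have "exp \<mu> + exp (- \<mu>) \<le> (1 + \<mu> + \<mu>\<^sup>2) + (1 - \<mu> + \<mu>\<^sup>2)"
    by (rule add_mono)
  moreover have "cosh \<mu> = (exp \<mu> + exp (- \<mu>)) / 2" by (simp add: cosh_field_def)
  ultimately show ?thesis by simp
qed

lemma nform_lincomb_left:
  "nform \<E> V M (\<lambda>p. a * x p + b * x' p) y = a * nform \<E> V M x y + b * nform \<E> V M x' y"
  by (simp add: nform_def sum_distrib_left sum.distrib algebra_simps)

lemma nform_lincomb_right:
  "nform \<E> V M x (\<lambda>p. a * y p + b * y' p) = a * nform \<E> V M x y + b * nform \<E> V M x y'"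
  by (simp add: nform_def sum_distrib_left sum.distrib algebra_simps)

lemma nform_lincomb_entries:
  "nform \<E> V (\<lambda>K p q. a * M K p q + b * M' K p q) x y = a * nform \<E> V M x y + b * nform \<E> V M' x y"
  by (simp add: nform_def sum_distrib_left sum.distrib algebra_simps)

lemma nform_sym:
  assumes "\<And>K p q. M K p q = M K q p"
  shows "nform \<E> V M x y = nform \<E> V M y x"
  unfolding nform_def
proof (rule sum.cong[OF refl])
  fix K
  show "(\<Sum>p\<in>V K. \<Sum>q\<in>V K. M K p q * (x p * y q)) = (\<Sum>p\<in>V K. \<Sum>q\<in>V K. M K p q * (y p * x q))"
    by (subst sum.swap) (intro sum.cong refl, simp add: assms mult.commute)
qed

text \<open>Elements and vertices without geometry; \<open>k\<close> will be the element volume and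
  \<open>s\<close> the number \<open>2 ^ d\<close> of vertices of an element.\<close>

locale nodal_space =
  fixes \<E> :: "'e set" and V :: "'e \<Rightarrow> 'p set" and k :: "'e \<Rightarrow> real" and s :: nat
  assumes k_nonneg: "K \<in> \<E> \<Longrightarrow> 0 \<le> k K"
    and card_V: "K \<in> \<E> \<Longrightarrow> card (V K) \<le> s"
    and finite_E: "finite \<E>" and finite_V: "K \<in> \<E> \<Longrightarrow> finite (V K)"
begin

abbreviation "nn \<equiv> nnorm \<E> V k"
abbreviation "nf \<equiv> nform \<E> V"

lemma nnorm_sq: "(nn x)\<^sup>2 = (\<Sum>K\<in>\<E>. k K * (\<Sum>p\<in>V K. (x p)\<^sup>2))"
  unfolding nnorm_def using k_nonneg by (intro real_sqrt_pow2 sum_nonneg mult_nonneg_nonneg) auto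

lemma nnorm_nonneg: "0 \<le> nn x"
  unfolding nnorm_def using k_nonneg by (intro real_sqrt_ge_zero sum_nonneg mult_nonneg_nonneg) auto

text \<open>A Euclidean norm over the incidences of vertices with elements, from which the triangle
  inequality is inherited.\<close>

lemma nnorm_eq_L2_set: "nn x = L2_set (\<lambda>(K, p). sqrt (k K) * x p) (SIGMA K:\<E>. V K)"
proof -
  have "(\<Sum>i\<in>(SIGMA K:\<E>. V K). ((\<lambda>(K, p). sqrt (k K) * x p) i)\<^sup>2) = (\<Sum>K\<in>\<E>. \<Sum>p\<in>V K. (sqrt (k K) * x p)\<^sup>2)"
    using finite_E finite_V by (subst sum.Sigma) (auto intro!: sum.cong)
  also have "\<dots> = (\<Sum>K\<in>\<E>. k K * (\<Sum>p\<in>V K. (x p)\<^sup>2))"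
    using k_nonneg by (intro sum.cong refl) (simp add: power_mult_distrib sum_distrib_left)
  finally show ?thesis by (simp add: nnorm_def L2_set_def)
qed

lemma nnorm_triangle: "nn (\<lambda>p. x p + y p) \<le> nn x + nn y"
proof -
  have "(\<lambda>(K, p). sqrt (k K) * (x p + y p)) = (\<lambda>i. (\<lambda>(K, p). sqrt (k K) * x p) i + (\<lambda>(K, p). sqrt (k K) * y p) i)"
    by (auto simp: fun_eq_iff algebra_simps)
  thus ?thesis
    unfolding nnorm_eq_L2_set by (simp only: L2_set_triangle_ineq)
qed

lemma nnorm_mono:
  assumes "\<And>K p. K \<in> \<E> \<Longrightarrow> p \<in> V K \<Longrightarrow> \<bar>x p\<bar> \<le> \<bar>y p\<bar>"
  shows "nn x \<le> nn y"
  unfolding nnorm_def using assms k_nonneg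
  by (intro real_sqrt_le_mono sum_mono mult_left_mono) (auto simp: abs_le_square_iff)

lemma nnorm_scale: "nn (\<lambda>p. a * x p) = \<bar>a\<bar> * nn x"
proof -
  have "(\<Sum>K\<in>\<E>. k K * (\<Sum>p\<in>V K. (a * x p)\<^sup>2)) = a\<^sup>2 * (\<Sum>K\<in>\<E>. k K * (\<Sum>p\<in>V K. (x p)\<^sup>2))"
    by (simp add: power_mult_distrib sum_distrib_left mult_ac)
  thus ?thesis by (simp add: nnorm_def real_sqrt_mult)
qed

lemma nform_cong:
  "(\<And>K p. K \<in> \<E> \<Longrightarrow> p \<in> V K \<Longrightarrow> x p = x' p) \<Longrightarrow> (\<And>K p. K \<in> \<E> \<Longrightarrow> p \<in> V K \<Longrightarrow> y p = y' p)
    \<Longrightarrow> nf M x y = nf M x' y'"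
  unfolding nform_def by (intro sum.cong) auto

text \<open>Cauchy-Schwarz over the triples of an element and two of its vertices. Each vertex value
  is repeated at most \<open>s\<close> times, which costs \<open>sqrt s\<close> for either
  argument.\<close>

lemma abs_nform_le:
  assumes M: "\<And>K p q. K \<in> \<E> \<Longrightarrow> p \<in> V K \<Longrightarrow> q \<in> V K \<Longrightarrow> \<bar>M K p q\<bar> \<le> b * k K" and b: "0 \<le> b"
  shows "\<bar>nf M x y\<bar> \<le> b * real s * nn x * nn y"
proof -
  define T where "T = (SIGMA K:\<E>. V K \<times> V K)"
  have nested: "(\<Sum>(K, p, q)\<in>T. F K p q) = (\<Sum>K\<in>\<E>. \<Sum>p\<in>V K. \<Sum>q\<in>V K. F K p q)" for F :: "'e \<Rightarrow> 'p \<Rightarrow> 'p \<Rightarrow> real"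
    unfolding T_def using finite_E finite_V
    by (subst sum.Sigma[symmetric]) (auto simp: sum.cartesian_product)
  have norm_bound: "L2_set (\<lambda>(K, p, q). sqrt (k K) * x p) T \<le> sqrt (real s) * nn x"
    "L2_set (\<lambda>(K, p, q). sqrt (k K) * x q) T \<le> sqrt (real s) * nn x" for x
  proof -
    have "(\<Sum>K\<in>\<E>. \<Sum>p\<in>V K. \<Sum>q\<in>V K. (sqrt (k K) * x p)\<^sup>2) = (\<Sum>K\<in>\<E>. real (card (V K)) * (k K * (\<Sum>p\<in>V K. (x p)\<^sup>2)))"
      using k_nonneg by (intro sum.cong refl) (simp add: power_mult_distrib sum_distrib_left)
    moreover have "(\<Sum>K\<in>\<E>. \<Sum>p\<in>V K. \<Sum>q\<in>V K. (sqrt (k K) * x q)\<^sup>2) = (\<Sum>K\<in>\<E>. real (card (V K)) * (k K * (\<Sum>p\<in>V K. (x p)\<^sup>2)))"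
      using k_nonneg by (intro sum.cong refl) (simp add: power_mult_distrib sum_distrib_left)
    moreover have "(\<Sum>K\<in>\<E>. real (card (V K)) * (k K * (\<Sum>p\<in>V K. (x p)\<^sup>2))) \<le> real s * (nn x)\<^sup>2"
      unfolding nnorm_sq sum_distrib_left using card_V k_nonneg
      by (intro sum_mono mult_right_mono mult_nonneg_nonneg sum_nonneg) auto
    ultimately have
      "(\<Sum>(K, p, q)\<in>T. (sqrt (k K) * x p)\<^sup>2) \<le> real s * (nn x)\<^sup>2"
      "(\<Sum>(K, p, q)\<in>T. (sqrt (k K) * x q)\<^sup>2) \<le> real s * (nn x)\<^sup>2"
      unfolding nested by simp_all
    hence "sqrt (\<Sum>(K, p, q)\<in>T. (sqrt (k K) * x p)\<^sup>2) \<le> sqrt (real s) * nn x"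
      "sqrt (\<Sum>(K, p, q)\<in>T. (sqrt (k K) * x q)\<^sup>2) \<le> sqrt (real s) * nn x"
      using nnorm_nonneg[of x] by (metis real_sqrt_le_mono real_sqrt_mult real_sqrt_unique)+
    thus "L2_set (\<lambda>(K, p, q). sqrt (k K) * x p) T \<le> sqrt (real s) * nn x"
      "L2_set (\<lambda>(K, p, q). sqrt (k K) * x q) T \<le> sqrt (real s) * nn x"
      by (simp_all add: L2_set_def case_prod_beta)
  qed
  have "\<bar>nf M x y\<bar> \<le> (\<Sum>K\<in>\<E>. \<Sum>p\<in>V K. \<Sum>q\<in>V K. b * (\<bar>sqrt (k K) * x p\<bar> * \<bar>sqrt (k K) * y q\<bar>))"
    unfolding nform_def
  proof (intro order.trans[OF sum_abs] sum_mono)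
    fix K p q assume K: "K \<in> \<E>" "p \<in> V K" "q \<in> V K"
    have "\<bar>M K p q * (x p * y q)\<bar> \<le> (b * k K) * (\<bar>x p\<bar> * \<bar>y q\<bar>)"
      unfolding abs_mult using M[OF K] by (intro mult_right_mono) auto
    also have "\<dots> = b * (\<bar>sqrt (k K) * x p\<bar> * \<bar>sqrt (k K) * y q\<bar>)"
      using k_nonneg[OF K(1)] by (simp add: abs_mult mult_ac)
    finally show "\<bar>M K p q * (x p * y q)\<bar> \<le> b * (\<bar>sqrt (k K) * x p\<bar> * \<bar>sqrt (k K) * y q\<bar>)" .
  qed
  also have "\<dots> = b * (\<Sum>(K, p, q)\<in>T. \<bar>sqrt (k K) * x p\<bar> * \<bar>sqrt (k K) * y q\<bar>)"
    unfolding nested by (simp add: sum_distrib_left)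
  also have "\<dots> \<le> b * (L2_set (\<lambda>(K, p, q). sqrt (k K) * x p) T * L2_set (\<lambda>(K, p, q). sqrt (k K) * y q) T)"
    using b L2_set_mult_ineq[of "\<lambda>(K, p, q). sqrt (k K) * x p" "\<lambda>(K, p, q). sqrt (k K) * y q" T]
    by (intro mult_left_mono) (auto simp: case_prod_beta)
  also have "\<dots> \<le> b * ((sqrt (real s) * nn x) * (sqrt (real s) * nn y))"
    using b norm_bound nnorm_nonneg by (intro mult_left_mono mult_mono) (auto simp: L2_set_nonneg)
  also have "\<dots> = b * (sqrt (real s) * sqrt (real s)) * nn x * nn y"
    by (simp only: mult_ac)
  finally show ?thesis by simp
qed

context
  fixes d :: "'p \<Rightarrow> real" and \<mu> :: real
  assumes d: "\<And>K p q. K \<in> \<E> \<Longrightarrow> p \<in> V K \<Longrightarrow> q \<in> V K \<Longrightarrow> \<bar>d p - d q\<bar> \<le> 1"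
    and \<mu>: "0 \<le> \<mu>"
begin

text \<open>Moving the opposite weights into the arguments multiplies an entry by
  \<open>exp (\<mu> * (d q - d p))\<close>, at most \<open>exp \<mu>\<close> because
  \<open>d\<close> varies by at most 1 on an element.\<close>

lemma abs_nform_weighted_le:
  assumes M: "\<And>K p q. K \<in> \<E> \<Longrightarrow> p \<in> V K \<Longrightarrow> q \<in> V K \<Longrightarrow> \<bar>M K p q\<bar> \<le> b * k K" and b: "0 \<le> b"
  shows "\<bar>nf M x y\<bar> \<le> b * exp \<mu> * real s * nn (\<lambda>p. exp (\<mu> * d p) * x p) * nn (\<lambda>p. exp (- \<mu> * d p) * y p)"
proof -
  have eq: "nf M x y = nf (\<lambda>K p q. M K p q * exp (\<mu> * (d q - d p))) (\<lambda>p. exp (\<mu> * d p) * x p) (\<lambda>p. exp (- \<mu> * d p) * y p)"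
  proof -
    have "exp (\<mu> * (d q - d p)) * (exp (\<mu> * d p) * exp (- \<mu> * d q)) = 1" for p q
      by (simp add: exp_add[symmetric] algebra_simps)
    hence "M K p q * exp (\<mu> * (d q - d p)) * (exp (\<mu> * d p) * x p * (exp (- \<mu> * d q) * y q)) = M K p q * (x p * y q)"
      for K p q
    proof -
      have "M K p q * exp (\<mu> * (d q - d p)) * (exp (\<mu> * d p) * x p * (exp (- \<mu> * d q) * y q))
          = (M K p q * (x p * y q)) * (exp (\<mu> * (d q - d p)) * (exp (\<mu> * d p) * exp (- \<mu> * d q)))"
        by (simp only: mult_ac)
      thus ?thesis using \<open>\<And>p q. exp (\<mu> * (d q - d p)) * (exp (\<mu> * d p) * exp (- \<mu> * d q)) = 1\<close> by simp
    qed
    thus ?thesis unfolding nform_def by (intro sum.cong refl) simp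
  qed
  have "\<bar>nf (\<lambda>K p q. M K p q * exp (\<mu> * (d q - d p))) (\<lambda>p. exp (\<mu> * d p) * x p) (\<lambda>p. exp (- \<mu> * d p) * y p)\<bar>
      \<le> (b * exp \<mu>) * real s * nn (\<lambda>p. exp (\<mu> * d p) * x p) * nn (\<lambda>p. exp (- \<mu> * d p) * y p)"
  proof (rule abs_nform_le)
    fix K p q assume K: "K \<in> \<E>" "p \<in> V K" "q \<in> V K"
    have "d q - d p \<le> 1" using d[OF K] by linarith
    hence "\<mu> * (d q - d p) \<le> \<mu> * 1" using \<mu> by (rule mult_left_mono)
    hence "\<bar>M K p q\<bar> * exp (\<mu> * (d q - d p)) \<le> (b * k K) * exp \<mu>"
      using M[OF K] by (intro mult_mono) auto
    thus "\<bar>M K p q * exp (\<mu> * (d q - d p))\<bar> \<le> b * exp \<mu> * k K"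
      by (simp add: abs_mult mult_ac)
  qed (use b in simp)
  thus ?thesis unfolding eq .
qed

text \<open>Conjugation with the exponential weight multiplies the entries by \<open>exp (\<mu> (d q - d p))\<close>. By
  symmetry only the even part \<open>cosh\<close> contributes to the quadratic form, and it differs from 1 by
  \<open>O(\<mu>\<^sup>2)\<close>; this is why the decay rate scales with the square root of the condition number.\<close>

lemma nform_weighted_coercive:
  assumes M: "\<And>K p q. K \<in> \<E> \<Longrightarrow> p \<in> V K \<Longrightarrow> q \<in> V K \<Longrightarrow> \<bar>M K p q\<bar> \<le> \<kappa> * k K" and \<kappa>: "0 \<le> \<kappa>"
    and sym: "\<And>K p q. M K p q = M K q p"
    and coercive: "\<And>x. c * (nn x)\<^sup>2 \<le> nf M x x"
    and small: "(cosh \<mu> - 1) * \<kappa> * real s \<le> c / 2"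
  shows "c / 2 * (nn (\<lambda>p. exp (\<mu> * d p) * g p))\<^sup>2 \<le> nf M g (\<lambda>p. exp (2 * \<mu> * d p) * g p)"
proof -
  define x where "x p = exp (\<mu> * d p) * g p" for p
  define M1 where "M1 K p q = M K p q * exp (\<mu> * (d q - d p))" for K p q
  define M2 where "M2 K p q = M K p q * (cosh (\<mu> * (d q - d p)) - 1)" for K p q
  have "nf M g (\<lambda>p. exp (2 * \<mu> * d p) * g p) = nf M1 x x"
  proof -
    have "exp (\<mu> * (d q - d p)) * (exp (\<mu> * d p) * exp (\<mu> * d q)) = exp (2 * \<mu> * d q)" for p q
      by (simp add: exp_add[symmetric] algebra_simps)
    hence "M1 K p q * (x p * x q) = M K p q * (g p * (exp (2 * \<mu> * d q) * g q))" for K p q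
    proof -
      have "M1 K p q * (x p * x q)
          = (M K p q * (g p * g q)) * (exp (\<mu> * (d q - d p)) * (exp (\<mu> * d p) * exp (\<mu> * d q)))"
        by (simp only: M1_def x_def mult_ac)
      also have "\<dots> = M K p q * (g p * (exp (2 * \<mu> * d q) * g q))"
        unfolding \<open>\<And>p q. exp (\<mu> * (d q - d p)) * (exp (\<mu> * d p) * exp (\<mu> * d q)) = exp (2 * \<mu> * d q)\<close>
        by (simp only: mult_ac)
      finally show ?thesis .
    qed
    thus ?thesis by (simp add: nform_def)
  qed
  also have "nf M1 x x = nf M x x + nf M2 x x"
  proof -
    have "nf M1 x x = nf (\<lambda>K p q. M1 K q p) x x"
      unfolding nform_def
    proof (rule sum.cong[OF refl])
      fix K
      show "(\<Sum>p\<in>V K. \<Sum>q\<in>V K. M1 K p q * (x p * x q)) = (\<Sum>p\<in>V K. \<Sum>q\<in>V K. M1 K q p * (x p * x q))"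
        by (subst sum.swap) (simp add: mult.commute)
    qed
    hence "nf M1 x x = (1/2) * nf M1 x x + (1/2) * nf (\<lambda>K p q. M1 K q p) x x"
      by simp
    also have "\<dots> = nf (\<lambda>K p q. (1/2) * M1 K p q + (1/2) * M1 K q p) x x"
      by (rule nform_lincomb_entries[symmetric])
    also have "(\<lambda>K p q. (1/2) * M1 K p q + (1/2) * M1 K q p) = (\<lambda>K p q. 1 * M K p q + 1 * M2 K p q)"
    proof (intro ext)
      fix K p q
      have "exp (\<mu> * (d p - d q)) = exp (- (\<mu> * (d q - d p)))"
        by (simp add: algebra_simps)
      thus "(1/2) * M1 K p q + (1/2) * M1 K q p = 1 * M K p q + 1 * M2 K p q"
        using sym[of K q p] by (simp add: M1_def M2_def cosh_field_def algebra_simps)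
    qed
    also have "nf \<dots> x x = nf M x x + nf M2 x x"
      by (subst nform_lincomb_entries) simp
    finally show ?thesis .
  qed
  finally have eq: "nf M g (\<lambda>p. exp (2 * \<mu> * d p) * g p) = nf M x x + nf M2 x x" .
  have "\<bar>nf M2 x x\<bar> \<le> ((cosh \<mu> - 1) * \<kappa>) * real s * nn x * nn x"
  proof (rule abs_nform_le)
    fix K p q assume K: "K \<in> \<E>" "p \<in> V K" "q \<in> V K"
    have "\<bar>\<mu> * (d q - d p)\<bar> \<le> \<mu> * 1"
      using d[OF K] \<mu> unfolding abs_mult by (intro mult_mono) auto
    hence "cosh \<bar>\<mu> * (d q - d p)\<bar> \<le> cosh \<mu>"
      using \<mu> by (subst cosh_real_nonneg_le_iff) auto
    hence "\<bar>cosh (\<mu> * (d q - d p)) - 1\<bar> \<le> cosh \<mu> - 1"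
      using cosh_real_ge_1[of "\<mu> * (d q - d p)"] by (auto simp: abs_if split: if_splits)
    hence "\<bar>M2 K p q\<bar> \<le> (\<kappa> * k K) * (cosh \<mu> - 1)"
      unfolding M2_def abs_mult using M[OF K] by (intro mult_mono) auto
    thus "\<bar>M2 K p q\<bar> \<le> (cosh \<mu> - 1) * \<kappa> * k K" by (simp add: mult_ac)
  qed (use \<kappa> cosh_real_ge_1[of \<mu>] in simp)
  hence "\<bar>nf M2 x x\<bar> \<le> c / 2 * (nn x)\<^sup>2"
    using mult_right_mono[OF small, of "(nn x)\<^sup>2"] by (simp add: power2_eq_square mult.assoc)
  hence "c / 2 * (nn x)\<^sup>2 \<le> nf M x x + nf M2 x x"
    using coercive[of x] by linarith
  thus ?thesis unfolding eq by (simp add: x_def[abs_def])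
qed

text \<open>The test function \<open>exp (2 * \<mu> * d p) * g p\<close> gives the squared weighted
  norm of \<open>g\<close> on the left by coercivity. On the right, the opposite weight
  \<open>exp (- \<mu> * d p)\<close> turns it back into the weighted \<open>g\<close>, so one factor
  of that norm cancels.\<close>

lemma weighted_solution_bound:
  assumes M: "\<And>K p q. K \<in> \<E> \<Longrightarrow> p \<in> V K \<Longrightarrow> q \<in> V K \<Longrightarrow> \<bar>M K p q\<bar> \<le> \<kappa> * k K" and \<kappa>: "0 \<le> \<kappa>"
    and sym: "\<And>K p q. M K p q = M K q p"
    and coercive: "\<And>x. c * (nn x)\<^sup>2 \<le> nf M x x" and c: "0 < c"
    and small: "(cosh \<mu> - 1) * \<kappa> * real s \<le> c / 2"
    and M': "\<And>K p q. K \<in> \<E> \<Longrightarrow> p \<in> V K \<Longrightarrow> q \<in> V K \<Longrightarrow> \<bar>M' K p q\<bar> \<le> 1 * k K"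
    and eq: "nf M g (\<lambda>p. exp (2 * \<mu> * d p) * g p) = nf M' f (\<lambda>p. exp (2 * \<mu> * d p) * g p)"
  shows "nn (\<lambda>p. exp (\<mu> * d p) * g p) \<le> 2 * exp \<mu> * real s / c * nn (\<lambda>p. exp (\<mu> * d p) * f p)"
proof -
  let ?G = "nn (\<lambda>p. exp (\<mu> * d p) * g p)" and ?F = "nn (\<lambda>p. exp (\<mu> * d p) * f p)"
  have "exp (- \<mu> * d p) * (exp (2 * \<mu> * d p) * g p) = exp (\<mu> * d p) * g p" for p
    by (simp add: exp_add[symmetric] flip: mult.assoc)
  hence fe: "(\<lambda>p. exp (- \<mu> * d p) * (exp (2 * \<mu> * d p) * g p)) = (\<lambda>p. exp (\<mu> * d p) * g p)"
    by (rule ext)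
  have "\<bar>nf M' f (\<lambda>p. exp (2 * \<mu> * d p) * g p)\<bar>
      \<le> 1 * exp \<mu> * real s * ?F * nn (\<lambda>p. exp (- \<mu> * d p) * (exp (2 * \<mu> * d p) * g p))"
    by (rule abs_nform_weighted_le) (use M' in auto)
  hence rhs: "\<bar>nf M' f (\<lambda>p. exp (2 * \<mu> * d p) * g p)\<bar> \<le> exp \<mu> * real s * ?F * ?G"
    unfolding fe by simp
  have "c / 2 * ?G\<^sup>2 \<le> exp \<mu> * real s * ?F * ?G"
    using nform_weighted_coercive[OF M \<kappa> sym coercive small, of g] eq rhs by linarith
  hence "(c / 2 * ?G) * ?G \<le> (exp \<mu> * real s * ?F) * ?G"
    by (simp add: power2_eq_square mult.assoc)
  hence "?G = 0 \<or> c / 2 * ?G \<le> exp \<mu> * real s * ?F"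
    using nnorm_nonneg[of "\<lambda>p. exp (\<mu> * d p) * g p"]
    unfolding mult_le_cancel_right by linarith
  moreover have "0 \<le> ?F" "0 \<le> exp \<mu> * real s" using nnorm_nonneg by auto
  ultimately show ?thesis
    using c by (auto simp: field_simps)
qed

end

end


section \<open>Finite element spaces on patches\<close>

context fe_mesh
begin

text \<open>The elements around a point of the open segment all contain the whole segment. So, seen from
  the endpoint \<open>q\<close>, a neighbourhood of a point \<open>y\<close> of the segment in the domain is dilated to a
  neighbourhood of \<open>x\<close> that is still covered by the mesh.\<close>

lemma open_segment_in_domain:
  assumes K: "K \<in> \<T>" and p: "p \<in> K" "p \<in> \<Omega>" and q: "q \<in> K" and x: "x \<in> open_segment p q"
  shows "x \<in> \<Omega>"
proof -
  obtain u where u: "0 < u" "u < 1" "x = (1 - u) *\<^sub>R p + u *\<^sub>R q" and ne: "p \<noteq> q"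
    using x by (auto simp: in_segment)
  obtain e where e: "0 < e" "ball p e \<subseteq> \<Omega>"
    using open_domain p(2) by (meson openE)
  define \<epsilon> where "\<epsilon> = min u (e / dist p q) / 2"
  have \<epsilon>: "0 < \<epsilon>" "\<epsilon> < u" "\<epsilon> < e / dist p q"
    using u e ne by (auto simp: \<epsilon>_def min_def field_simps)
  define y where "y = (1 - \<epsilon>) *\<^sub>R p + \<epsilon> *\<^sub>R q"
  have "dist p y = \<epsilon> * dist p q"
  proof -
    have "p - y = \<epsilon> *\<^sub>R (p - q)" by (simp add: y_def algebra_simps)
    thus ?thesis using \<epsilon> by (simp add: dist_norm)
  qed
  hence "dist p y < e" using \<epsilon> ne by (simp add: field_simps)
  hence y\<Omega>: "y \<in> \<Omega>" using e by auto
  have yseg: "y \<in> open_segment p q"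
    using \<epsilon> u ne by (auto simp: in_segment y_def)
  \<comment> \<open>The contraction by \<open>t\<close> about \<open>q\<close> maps \<open>y\<close>
    to \<open>x\<close>.\<close>
  define t where "t = (1 - u) / (1 - \<epsilon>)"
  have t: "0 < t" "t \<le> 1" "t * (1 - \<epsilon>) = 1 - u"
    using \<epsilon> u by (auto simp: t_def)
  have xt: "x = (1 - t) *\<^sub>R q + t *\<^sub>R y"
  proof -
    have "(1 - t) *\<^sub>R q + t *\<^sub>R y = (t * (1 - \<epsilon>)) *\<^sub>R p + (1 - t * (1 - \<epsilon>)) *\<^sub>R q"
      by (simp add: y_def algebra_simps)
    thus ?thesis unfolding t(3) using u by simp
  qed
  have "closed (\<Union>{K' \<in> \<T>. y \<notin> K'})"
    using finite_mesh closed_elem[OF para] by (intro closed_Union) auto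
  hence "open (\<Omega> - \<Union>{K' \<in> \<T>. y \<notin> K'})"
    using open_domain by (rule open_Diff[rotated])
  moreover have "y \<in> \<Omega> - \<Union>{K' \<in> \<T>. y \<notin> K'}" using y\<Omega> by blast
  ultimately obtain \<delta> where \<delta>: "0 < \<delta>" "ball y \<delta> \<subseteq> \<Omega> - \<Union>{K' \<in> \<T>. y \<notin> K'}"
    by (meson openE)
  have "ball x (t * \<delta>) \<subseteq> closure \<Omega>"
  proof
    fix z assume z: "z \<in> ball x (t * \<delta>)"
    define y' where "y' = y + (1 / t) *\<^sub>R (z - x)"
    have "dist y y' = dist x z / t"
      using t by (simp add: y'_def dist_norm norm_minus_commute)
    also have "\<dots> < \<delta>" using z t by (simp add: divide_less_eq mult.commute)
    finally have "y' \<in> ball y \<delta>" by simp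
    hence y': "y' \<in> \<Omega>" "\<And>K'. K' \<in> \<T> \<Longrightarrow> y' \<in> K' \<Longrightarrow> y \<in> K'" using \<delta> by auto
    then obtain K' where K': "K' \<in> \<T>" "y' \<in> K'" "y \<in> K'"
      using cover closure_subset by blast
    have "y \<in> K"
      using convexD_alt[OF convex_elem[OF para[OF K]] p(1) q, of \<epsilon>] \<epsilon> u by (simp add: y_def)
    hence "q \<in> K'"
      using face_ofD[OF face[OF K K'(1)] yseg p(1) q] K'(3) by simp
    moreover have "z = (1 - t) *\<^sub>R q + t *\<^sub>R y'"
      using t by (simp add: y'_def xt algebra_simps)
    ultimately have "z \<in> K'"
      using convexD_alt[OF convex_elem[OF para[OF K'(1)]] _ K'(2), of q t] t by simp
    thus "z \<in> closure \<Omega>" using K'(1) cover by blast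
  qed
  moreover have "0 < t * \<delta>" using t \<delta> by simp
  ultimately have "x \<in> interior (closure \<Omega>)" by (auto simp: mem_interior)
  thus ?thesis by (simp add: regular_domain)
qed

text \<open>A vertex with non-zero weight at a boundary point is itself a boundary point: otherwise
  \<open>open_segment_in_domain\<close> would put that point into the open domain. Hence zero nodal
  values on the boundary imply a zero trace.\<close>

lemma nodal_interp_in_fe_space:
  assumes "\<And>p. p \<in> mesh_vertices \<T> \<Longrightarrow> p \<in> frontier \<Omega> \<Longrightarrow> g p = 0"
  shows "nodal_interp \<T> g \<in> fe_space \<Omega> \<T>"
proof -
  have "nodal_interp \<T> g x = 0" if x: "x \<in> frontier \<Omega>" for x
  proof -
    have x': "x \<in> \<Union>\<T>" "x \<notin> \<Omega>"
      using x open_domain cover by (auto simp: frontier_def interior_open)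
    then obtain K where K: "K \<in> \<T>" "x \<in> K" by blast
    have "g p * weight K p x = 0" if p: "p \<in> verts K" for p
    proof (rule ccontr)
      assume "g p * weight K p x \<noteq> 0"
      hence nz: "g p \<noteq> 0" "weight K p x \<noteq> 0" by auto
      have "p \<in> K" using p verts_subset[OF para[OF K(1)]] by blast
      moreover have "p \<in> mesh_vertices \<T>" using p K by (auto simp: mesh_vertices_eq)
      ultimately have "p \<in> \<Omega>"
        using assms[of p] nz K cover open_domain by (auto simp: frontier_def interior_open)
      moreover have "x \<noteq> p" using \<open>p \<in> \<Omega>\<close> x' by blast
      ultimately show False
        using weight_nonzero_segment[OF para[OF K(1)] p K(2) nz(2)] open_segment_in_domain[OF K(1) \<open>p \<in> K\<close>] x'(2)
        by metis
    qed
    thus ?thesis unfolding nodal_interp_weights[OF K] by (rule sum.neutral[rule_format])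
  qed
  thus ?thesis by (simp add: fe_space_def nodal_interp_in_Q1_space)
qed

lemma fe_space_Q1: "v \<in> fe_space \<Omega> \<T> \<Longrightarrow> v \<in> Q1_space \<T>"
  by (simp add: fe_space_def)

lemma fe_space_lincomb:
  assumes "v \<in> fe_space \<Omega> \<T>" "w \<in> fe_space \<Omega> \<T>"
  shows "(\<lambda>x. a * v x + c * w x) \<in> fe_space \<Omega> \<T>"
  using assms Q1_space_lincomb[of v w a c] by (simp add: fe_space_def)

lemma fe_space_sum:
  assumes "\<And>i. i \<in> I \<Longrightarrow> w i \<in> fe_space \<Omega> \<T>"
  shows "(\<lambda>x. \<Sum>i\<in>I. w i x) \<in> fe_space \<Omega> \<T>"
  using assms
proof (induction I rule: infinite_finite_induct)
  case (insert i I)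
  thus ?case using fe_space_lincomb[of "w i" "\<lambda>x. \<Sum>i\<in>I. w i x" 1 1] by simp
qed (use zero_in_Q1_space in \<open>simp_all add: fe_space_def\<close>)

lemma nodal_interp_mult_in_fe_space:
  "v \<in> fe_space \<Omega> \<T> \<Longrightarrow> nodal_interp \<T> (\<lambda>x. \<phi> x * v x) \<in> fe_space \<Omega> \<T>"
  by (rule nodal_interp_in_fe_space) (simp add: fe_space_def)

lemma closed_Union_elems: "C \<subseteq> \<T> \<Longrightarrow> closed (\<Union>C)"
  using finite_mesh finite_subset closed_elem[OF para] by (intro closed_Union) auto

section \<open>Patches, local spaces and the layer distance\<close>

definition star :: "(real ^ 'n) set \<Rightarrow> (real ^ 'n) set set" where
  "star \<omega> = {K \<in> \<T>. K \<inter> closure \<omega> \<noteq> {}}"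

lemma star_subset: "star \<omega> \<subseteq> \<T>"
  by (auto simp: star_def)

lemma patch_eq: "patch \<T> \<omega> = interior (\<Union>(star \<omega>))"
  by (simp add: patch_def star_def)

lemma patch_between: "(\<Union>K\<in>star \<omega>. interior K) \<subseteq> patch \<T> \<omega>" "patch \<T> \<omega> \<subseteq> \<Union>(star \<omega>)"
  unfolding patch_eq by (intro UN_least interior_mono Union_upper, assumption) (rule interior_subset)

text \<open>Elements are the closures of their interiors, so taking the interior in
  \<open>patch\<close> loses nothing after closing, and iterated patches can be followed on sets of
  elements.\<close>

lemma closure_patch: "closure (patch \<T> \<omega>) = \<Union>(star \<omega>)"
proof
  show "closure (patch \<T> \<omega>) \<subseteq> \<Union>(star \<omega>)"
    using patch_between(2) closed_Union_elems[OF star_subset] by (rule closure_minimal)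
  show "\<Union>(star \<omega>) \<subseteq> closure (patch \<T> \<omega>)"
  proof
    fix x assume "x \<in> \<Union>(star \<omega>)"
    then obtain K where K: "K \<in> star \<omega>" "x \<in> K" by blast
    hence "x \<in> closure (interior K)"
      using closure_interior_elem star_subset by blast
    moreover have "interior K \<subseteq> patch \<T> \<omega>" using patch_between(1) K by blast
    ultimately show "x \<in> closure (patch \<T> \<omega>)" using closure_mono by blast
  qed
qed

lemma patches_Suc: "patches \<T> (Suc l) \<omega> = patch \<T> (patches \<T> l \<omega>)"
  by (simp add: patches_def)

text \<open>The interior of an element outside the star is disjoint from the closed patch, and
  continuity carries the zero values to its vertices. In this nodal form, local functions can be cut
  off and weighted vertex by vertex.\<close>

lemma fe_space_on_patch:
  "v \<in> fe_space_on \<Omega> \<T> (patch \<T> \<omega>) \<longleftrightarrow>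
     v \<in> fe_space \<Omega> \<T> \<and> (\<forall>K\<in>\<T> - star \<omega>. \<forall>p\<in>verts K. v p = 0)"
proof (intro iffI conjI ballI)
  assume v: "v \<in> fe_space_on \<Omega> \<T> (patch \<T> \<omega>)"
  thus "v \<in> fe_space \<Omega> \<T>" by (simp add: fe_space_on_def)
  hence cont: "continuous_on (\<Union>\<T>) v" by (simp add: fe_space_def Q1_space_def)
  fix K p assume K: "K \<in> \<T> - star \<omega>" and p: "p \<in> verts K"
  have "v x = 0" if x: "x \<in> interior K" for x
  proof (rule ccontr)
    assume "v x \<noteq> 0"
    hence "x \<in> supp v" unfolding supp_def by (intro subsetD[OF closure_subset]) simp
    hence "x \<in> \<Union>(star \<omega>)" using v closure_patch by (auto simp: fe_space_on_def)
    thus False using elem_eq_if_interior_meets[OF _ _ x] K star_subset by blast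
  qed
  moreover have "continuous_on (closure (interior K)) v"
    using cont K closure_interior_elem by (auto intro: continuous_on_subset)
  moreover have "p \<in> closure (interior K)"
    using p K verts_subset[OF para] closure_interior_elem by blast
  ultimately show "v p = 0"
    using continuous_constant_on_closure[of "interior K" v 0 p] by blast
next
  assume v: "v \<in> fe_space \<Omega> \<T> \<and> (\<forall>K\<in>\<T> - star \<omega>. \<forall>p\<in>verts K. v p = 0)"
  hence vQ: "v \<in> Q1_space \<T>" by (simp add: fe_space_def)
  have "x \<in> \<Union>(star \<omega>)" if x: "v x \<noteq> 0" for x
  proof -
    have "x \<in> \<Union>\<T>" using x vQ by (auto simp: Q1_space_def)
    then obtain K where K: "K \<in> \<T>" "x \<in> K" by blast
    have "K \<in> star \<omega>"
    proof (rule ccontr)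
      assume "K \<notin> star \<omega>"
      hence "v x = 0" using Q1_space_weights[OF vQ K] v K by simp
      thus False using x by simp
    qed
    thus ?thesis using K by blast
  qed
  hence "supp v \<subseteq> \<Union>(star \<omega>)"
    unfolding supp_def using closed_Union_elems[OF star_subset] by (intro closure_minimal) auto
  thus "v \<in> fe_space_on \<Omega> \<T> (patch \<T> \<omega>)"
    using v by (simp add: fe_space_on_def closure_patch)
qed

lemma nform_star:
  assumes "\<And>K p. K \<in> \<T> - star \<omega> \<Longrightarrow> p \<in> verts K \<Longrightarrow> v p = 0"
  shows "nform (star \<omega>) verts M w v = nform \<T> verts M w v"
  unfolding nform_def using finite_mesh star_subset assms
  by (intro sum.mono_neutral_left) auto

lemma l2_inner_domain:
  "v \<in> Q1_space \<T> \<Longrightarrow> w \<in> Q1_space \<T> \<Longrightarrow> l2_inner \<Omega> v w = nform \<T> verts mass_entry v w"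
  using interior_elem_subset cover closure_subset[of \<Omega>] by (intro l2_inner_eq_nform) auto

lemma a_form_domain:
  "v \<in> Q1_space \<T> \<Longrightarrow> w \<in> Q1_space \<T> \<Longrightarrow> a_form A \<Omega> v w = nform \<T> verts (stiff_entry A) v w"
  using interior_elem_subset cover closure_subset[of \<Omega>] by (intro a_form_eq_nform) auto

text \<open>Only the second argument has to be supported in the patch. The local equations thus
  become the global forms, restricted to local test functions.\<close>

lemma local_forms:
  assumes w: "w \<in> Q1_space \<T>" and v: "v \<in> fe_space_on \<Omega> \<T> (patch \<T> \<omega>)"
  shows "l2_inner (patch \<T> \<omega>) w v = nform \<T> verts mass_entry w v"
    and "a_form A (patch \<T> \<omega>) w v = nform \<T> verts (stiff_entry A) w v"
proof -
  have v': "v \<in> Q1_space \<T>" "\<And>K p. K \<in> \<T> - star \<omega> \<Longrightarrow> p \<in> verts K \<Longrightarrow> v p = 0"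
    using v unfolding fe_space_on_patch by (auto simp: fe_space_def)
  show "l2_inner (patch \<T> \<omega>) w v = nform \<T> verts mass_entry w v"
    using l2_inner_eq_nform[OF star_subset patch_between w v'(1)] nform_star[OF v'(2)] by simp
  show "a_form A (patch \<T> \<omega>) w v = nform \<T> verts (stiff_entry A) w v"
    using a_form_eq_nform[OF star_subset patch_between w v'(1)] nform_star[OF v'(2)] by simp
qed

text \<open>Since the closed patches increase, this is the index of the first patch that reaches \<open>x\<close>, cut
  off at \<open>l\<close>.\<close>

definition layer :: "nat \<Rightarrow> (real ^ 'n) set \<Rightarrow> real ^ 'n \<Rightarrow> real" where
  "layer l \<omega> x = real (card {j. j < l \<and> x \<notin> closure (patches \<T> j \<omega>)})"

text \<open>The starting set need not be a union of elements; it must lie in the closed domain for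
  its points to be covered by elements of the first patch.\<close>

lemma closure_patches_mono_Suc:
  assumes "closure \<omega> \<subseteq> closure \<Omega>"
  shows "closure (patches \<T> j \<omega>) \<subseteq> closure (patches \<T> (Suc j) \<omega>)"
proof -
  have "closure (patches \<T> j \<omega>) \<subseteq> \<Union>\<T>"
  proof (cases j)
    case 0
    thus ?thesis using assms cover by (simp add: patches_def)
  next
    case (Suc i)
    thus ?thesis unfolding Suc patches_Suc closure_patch using star_subset by blast
  qed
  thus ?thesis unfolding patches_Suc closure_patch by (auto simp: star_def)
qed

lemma closure_patches_mono:
  assumes "closure \<omega> \<subseteq> closure \<Omega>" "i \<le> j"
  shows "closure (patches \<T> i \<omega>) \<subseteq> closure (patches \<T> j \<omega>)"
  using assms(2)
proof (induction j)
  case (Suc j)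
  thus ?case using closure_patches_mono_Suc[OF assms(1), of j] by (cases "i = Suc j") auto
qed simp

text \<open>If \<open>y\<close> is missed at stage \<open>i + 1\<close>, then its element
  \<open>K\<close> is disjoint from the closed patch at stage \<open>i\<close>, so \<open>x\<close>
  is missed there. Stage 0 accounts for the additional 1.\<close>

lemma layer_le_Suc:
  assumes K: "K \<in> \<T>" and x: "x \<in> K" and y: "y \<in> K"
  shows "layer l \<omega> y \<le> layer l \<omega> x + 1"
proof -
  have "{j. j < l \<and> y \<notin> closure (patches \<T> j \<omega>)}
      \<subseteq> insert 0 (Suc ` {j. j < l \<and> x \<notin> closure (patches \<T> j \<omega>)})"
  proof
    fix j assume j: "j \<in> {j. j < l \<and> y \<notin> closure (patches \<T> j \<omega>)}"
    show "j \<in> insert 0 (Suc ` {j. j < l \<and> x \<notin> closure (patches \<T> j \<omega>)})"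
    proof (cases j)
      case (Suc i)
      hence "K \<notin> star (patches \<T> i \<omega>)"
        using j y by (auto simp: patches_Suc closure_patch)
      hence "x \<notin> closure (patches \<T> i \<omega>)" using K x by (auto simp: star_def)
      thus ?thesis using j Suc by auto
    qed simp
  qed
  hence "card {j. j < l \<and> y \<notin> closure (patches \<T> j \<omega>)}
      \<le> card (insert 0 (Suc ` {j. j < l \<and> x \<notin> closure (patches \<T> j \<omega>)}))"
    by (intro card_mono) auto
  also have "\<dots> \<le> Suc (card {j. j < l \<and> x \<notin> closure (patches \<T> j \<omega>)})"
    by (intro order.trans[OF card_insert_le_m1]) (auto simp: card_image card_insert_if)
  finally show ?thesis by (simp add: layer_def)
qed

lemma layer_diff: "K \<in> \<T> \<Longrightarrow> p \<in> verts K \<Longrightarrow> q \<in> verts K \<Longrightarrow> \<bar>layer l \<omega> p - layer l \<omega> q\<bar> \<le> 1"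
  using layer_le_Suc[of K p q l \<omega>] layer_le_Suc[of K q p l \<omega>] verts_subset[OF para] by fastforce

lemma layer_0:
  assumes "closure \<omega> \<subseteq> closure \<Omega>" "x \<in> closure \<omega>"
  shows "layer l \<omega> x = 0"
proof -
  have "x \<in> closure (patches \<T> j \<omega>)" for j
    using closure_patches_mono[OF assms(1), of 0 j] assms(2) by (auto simp: patches_def)
  thus ?thesis by (simp add: layer_def)
qed

text \<open>The point is missed at the stages 0 to \<open>l\<close>, which are \<open>l + 1\<close>
  in number. This recovers the full count of layers although vertices on the boundary of the next
  patch are only known to lie outside the present one.\<close>

lemma layer_outside:
  assumes "closure \<omega> \<subseteq> closure \<Omega>" "x \<notin> closure (patches \<T> l \<omega>)"
  shows "layer (Suc l) \<omega> x = real (Suc l)"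
proof -
  have "x \<notin> closure (patches \<T> j \<omega>)" if "j < Suc l" for j
    using closure_patches_mono[OF assms(1), of j l] assms(2) that by auto
  hence "{j. j < Suc l \<and> x \<notin> closure (patches \<T> j \<omega>)} = {..<Suc l}"
    by auto
  thus ?thesis by (simp add: layer_def)
qed

end


section \<open>Energy estimates for the Crank--Nicolson scheme\<close>

text \<open>Bound for the entries of the one-step matrix per element volume: 1 from the mass part,
  and the squared gradient bound \<open>d / (2 r)\<close> from the stiffness part.\<close>

definition cond_const :: "nat \<Rightarrow> real \<Rightarrow> real \<Rightarrow> real \<Rightarrow> real" where
  "cond_const d r \<beta> \<tau> = 1 + \<tau>\<^sup>2 / 4 * (\<beta> * (real d / (2 * r))\<^sup>2)"

text \<open>The constant of \<open>data_bound\<close>: the factor of \<open>nnorm_le_energy\<close>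
  for each of two consecutive values, and twice \<open>\<tau> / 2\<close> times the factor between
  nodal and L2 norm for the velocity.\<close>

definition data_const :: "nat \<Rightarrow> real \<Rightarrow> real \<Rightarrow> real \<Rightarrow> real \<Rightarrow> real \<Rightarrow> real" where
  "data_const d r \<alpha> h R \<tau> = 2 * (sqrt (2 ^ d * (R / r) ^ d / (\<alpha> * mass_const d)) * (R / r) ^ d
      * (2 * real d * h)) + \<tau> / sqrt (mass_const d)"

lemma mass_const_pos: "0 < d \<Longrightarrow> 0 < mass_const d"
  by (simp add: mass_const_def)

sublocale para_mesh \<subseteq> nodal_space \<T> verts "\<lambda>K. measure lebesgue K" "2 ^ CARD('n)"
  by unfold_locales (auto simp: finite_mesh card_verts[OF para] finite_verts[OF para])

lemma nform_zero_left [simp]: "nform \<E> V M (\<lambda>p. 0) y = 0"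
  by (simp add: nform_def)

context ball_mesh
begin

lemma mass_pos: "0 < mass_const CARD('n)"
  by (simp add: mass_const_pos)

lemma mass_coercive: "mass_const CARD('n) * (nn x)\<^sup>2 \<le> nf mass_entry x x"
  unfolding nnorm_sq by (rule nform_mass_lower)

end

context fe_mesh
begin

definition cn_entry :: "real \<Rightarrow> (real ^ 'n) set \<Rightarrow> real ^ 'n \<Rightarrow> real ^ 'n \<Rightarrow> real" where
  "cn_entry \<tau> K p q = 1 * mass_entry K p q + \<tau>\<^sup>2 / 4 * stiff_entry A K p q"

lemma beta_nonneg: "0 \<le> \<beta>"
  using alpha_pos alpha_le_beta by simp

lemma cond_const_ge_1: "1 \<le> cond_const CARD('n) r \<beta> \<tau>"
  using beta_nonneg by (simp add: cond_const_def)

lemma abs_cn_entry: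
  assumes "K \<in> \<T>" "p \<in> verts K" "q \<in> verts K"
  shows "\<bar>cn_entry \<tau> K p q\<bar> \<le> cond_const CARD('n) r \<beta> \<tau> * measure lebesgue K"
proof -
  have "\<bar>cn_entry \<tau> K p q\<bar> \<le> \<bar>mass_entry K p q\<bar> + \<tau>\<^sup>2 / 4 * \<bar>stiff_entry A K p q\<bar>"
    unfolding cn_entry_def by (rule order.trans[OF abs_triangle_ineq]) (simp add: abs_mult)
  also have "\<dots> \<le> measure lebesgue K + \<tau>\<^sup>2 / 4 * (\<beta> * (real CARD('n) / (2 * r))\<^sup>2 * measure lebesgue K)"
    using abs_mass_entry[OF assms] abs_stiff_entry[OF assms] by (intro add_mono mult_left_mono) auto
  finally show ?thesis by (simp add: cond_const_def algebra_simps)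
qed

lemma cn_entry_sym: "cn_entry \<tau> K p q = cn_entry \<tau> K q p"
  using mass_entry_sym stiff_entry_sym by (simp add: cn_entry_def)

lemma cn_coercive: "mass_const CARD('n) * (nn x)\<^sup>2 \<le> nf (cn_entry \<tau>) x x"
proof -
  have "nf (cn_entry \<tau>) x x = nf mass_entry x x + \<tau>\<^sup>2 / 4 * nf (stiff_entry A) x x"
    unfolding cn_entry_def[abs_def] by (subst nform_lincomb_entries) simp
  thus ?thesis
    using mass_coercive[of x] nform_stiff_nonneg[of x] by (smt (verit) mult_nonneg_nonneg zero_le_power2 divide_nonneg_pos)
qed

lemma fe_space_time:
  assumes "z (n + 1) \<in> fe_space \<Omega> \<T>" "z n \<in> fe_space \<Omega> \<T>"
  shows half_step_fe: "half_step z n \<in> fe_space \<Omega> \<T>"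
    and half_diff_fe: "half_diff \<tau> z n \<in> fe_space \<Omega> \<T>"
    and dtt_fe: "z (n - 1) \<in> fe_space \<Omega> \<T> \<Longrightarrow> dtt \<tau> z n \<in> fe_space \<Omega> \<T>"
    and tavg_fe: "z (n - 1) \<in> fe_space \<Omega> \<T> \<Longrightarrow> tavg z n \<in> fe_space \<Omega> \<T>"
proof -
  have "half_step z n = (\<lambda>x. (1/2) * z (n + 1) x + (1/2) * z n x)"
    by (auto simp: half_step_def fun_eq_iff)
  thus "half_step z n \<in> fe_space \<Omega> \<T>" using fe_space_lincomb[OF assms, of "1/2" "1/2"] by simp
  have "half_diff \<tau> z n = (\<lambda>x. (1/\<tau>) * z (n + 1) x + (-1/\<tau>) * z n x)"
    by (auto simp: half_diff_def fun_eq_iff diff_divide_distrib)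
  thus "half_diff \<tau> z n \<in> fe_space \<Omega> \<T>" using fe_space_lincomb[OF assms, of "1/\<tau>" "-1/\<tau>"] by simp
  assume z: "z (n - 1) \<in> fe_space \<Omega> \<T>"
  have "dtt \<tau> z n = (\<lambda>x. 1 * ((1/\<tau>\<^sup>2) * z (n + 1) x + (-2/\<tau>\<^sup>2) * z n x) + (1/\<tau>\<^sup>2) * z (n - 1) x)"
    by (auto simp: dtt_def fun_eq_iff diff_divide_distrib add_divide_distrib)
  thus "dtt \<tau> z n \<in> fe_space \<Omega> \<T>"
    using fe_space_lincomb[OF fe_space_lincomb[OF assms, of "1/\<tau>\<^sup>2" "-2/\<tau>\<^sup>2"] z, of 1 "1/\<tau>\<^sup>2"] by simp
  have "tavg z n = (\<lambda>x. 1 * ((1/4) * z (n + 1) x + (1/2) * z n x) + (1/4) * z (n - 1) x)"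
    by (auto simp: tavg_def fun_eq_iff add_divide_distrib)
  thus "tavg z n \<in> fe_space \<Omega> \<T>"
    using fe_space_lincomb[OF fe_space_lincomb[OF assms, of "1/4" "1/2"] z, of 1 "1/4"] by simp
qed

text \<open>In this form one time step is a single coercive problem for \<open>z\<^sup>n\<^sup>+\<^sup>1 + 2 z\<^sup>n + z\<^sup>n\<^sup>-\<^sup>1\<close>.\<close>

lemma cn_residual_eq:
  assumes "\<tau> \<noteq> 0"
  shows "nf mass_entry (dtt \<tau> z n) v + nf (stiff_entry A) (tavg z n) v - nf mass_entry (tavg f n) v
    = (nf (cn_entry \<tau>) (\<lambda>x. z (n + 1) x + 2 * z n x + z (n - 1) x) v
       - nf mass_entry (\<lambda>x. 4 * z n x + \<tau>\<^sup>2 * tavg f n x) v) / \<tau>\<^sup>2"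
proof -
  have "\<tau>\<^sup>2 * (nf mass_entry (dtt \<tau> z n) v + nf (stiff_entry A) (tavg z n) v - nf mass_entry (tavg f n) v)
    = nf (cn_entry \<tau>) (\<lambda>x. z (n + 1) x + 2 * z n x + z (n - 1) x) v
       - nf mass_entry (\<lambda>x. 4 * z n x + \<tau>\<^sup>2 * tavg f n x) v"
    unfolding nform_def sum.distrib[symmetric] sum_subtractf[symmetric] sum_distrib_left
  proof (intro sum.cong refl)
    fix K p q
    have e1: "\<tau>\<^sup>2 * dtt \<tau> z n p = z (n + 1) p - 2 * z n p + z (n - 1) p"
      using assms by (simp add: dtt_def)
    have e2: "4 * tavg z n p = z (n + 1) p + 2 * z n p + z (n - 1) p"
      by (simp add: tavg_def)
    have "\<tau>\<^sup>2 * (mass_entry K p q * (dtt \<tau> z n p * v q) + stiff_entry A K p q * (tavg z n p * v q)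
        - mass_entry K p q * (tavg f n p * v q))
      = mass_entry K p q * v q * (\<tau>\<^sup>2 * dtt \<tau> z n p) + \<tau>\<^sup>2 / 4 * stiff_entry A K p q * v q * (4 * tavg z n p)
        - \<tau>\<^sup>2 * mass_entry K p q * (tavg f n p * v q)"
      by (simp add: algebra_simps)
    also have "\<dots> = cn_entry \<tau> K p q * ((z (n + 1) p + 2 * z n p + z (n - 1) p) * v q)
        - mass_entry K p q * ((4 * z n p + \<tau>\<^sup>2 * tavg f n p) * v q)"
      unfolding e1 e2 by (simp add: cn_entry_def algebra_simps)
    finally show "\<tau>\<^sup>2 * (mass_entry K p q * (dtt \<tau> z n p * v q) + stiff_entry A K p q * (tavg z n p * v q)
        - mass_entry K p q * (tavg f n p * v q))
      = cn_entry \<tau> K p q * ((z (n + 1) p + 2 * z n p + z (n - 1) p) * v q)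
        - mass_entry K p q * ((4 * z n p + \<tau>\<^sup>2 * tavg f n p) * v q)" .
  qed
  thus ?thesis using assms by (simp add: field_simps)
qed

lemma l2_norm_sq:
  assumes "v \<in> Q1_space \<T>"
  shows "(l2_norm \<Omega> v)\<^sup>2 = nf mass_entry v v"
proof -
  have "0 \<le> mass_const CARD('n) * (nn v)\<^sup>2" using mass_pos by simp
  hence "0 \<le> nf mass_entry v v" using mass_coercive[of v] by linarith
  thus ?thesis by (simp add: l2_norm_def l2_inner_domain assms)
qed

lemma a_norm_sq: "v \<in> Q1_space \<T> \<Longrightarrow> (a_norm A \<Omega> v)\<^sup>2 = nf (stiff_entry A) v v"
  using nform_stiff_nonneg[of v] by (simp add: a_norm_def a_form_domain)

lemma l2_norm_nonneg: "0 \<le> l2_norm \<Omega> v"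
  by (simp add: l2_norm_def l2_inner_def set_lebesgue_integral_def)

lemma nnorm_le_l2_norm:
  assumes "v \<in> Q1_space \<T>"
  shows "nn v \<le> l2_norm \<Omega> v / sqrt (mass_const CARD('n))"
proof -
  have "(sqrt (mass_const CARD('n)) * nn v)\<^sup>2 \<le> (l2_norm \<Omega> v)\<^sup>2"
    unfolding l2_norm_sq[OF assms] using mass_coercive[of v] mass_pos by (simp add: power_mult_distrib)
  hence "sqrt (mass_const CARD('n)) * nn v \<le> l2_norm \<Omega> v"
    using l2_norm_nonneg by (rule power2_le_imp_le)
  thus ?thesis using mass_pos by (simp add: field_simps)
qed

lemma energy_norm_nonneg: "0 \<le> energy_norm \<Omega> A \<tau> z n"
  by (simp add: energy_norm_def)

lemma energy_norm_sq:
  assumes "z (n + 1) \<in> fe_space \<Omega> \<T>" "z n \<in> fe_space \<Omega> \<T>"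
  shows "(energy_norm \<Omega> A \<tau> z n)\<^sup>2 = nf mass_entry (half_diff \<tau> z n) (half_diff \<tau> z n)
     + nf (stiff_entry A) (half_step z n) (half_step z n)"
proof -
  have "(energy_norm \<Omega> A \<tau> z n)\<^sup>2 = (l2_norm \<Omega> (half_diff \<tau> z n))\<^sup>2 + (a_norm A \<Omega> (half_step z n))\<^sup>2"
    by (simp add: energy_norm_def)
  thus ?thesis
    using l2_norm_sq[OF fe_space_Q1[OF half_diff_fe[of z, OF assms]]]
      a_norm_sq[OF fe_space_Q1[OF half_step_fe[of z, OF assms]]] by simp
qed

text \<open>Testing with the discrete velocity \<open>(D z\<^sup>n\<^sup>+\<^sup>1\<^sup>/\<^sup>2 + D z\<^sup>n\<^sup>-\<^sup>1\<^sup>/\<^sup>2) / 2\<close> turns the left-hand side of the scheme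
  into the increment of the energy.\<close>

lemma energy_step:
  assumes \<tau>: "0 < \<tau>" and n: "1 \<le> n"
    and z: "z (n + 1) \<in> fe_space \<Omega> \<T>" "z n \<in> fe_space \<Omega> \<T>" "z (n - 1) \<in> fe_space \<Omega> \<T>"
    and res: "\<And>v. v \<in> fe_space \<Omega> \<T> \<Longrightarrow>
        \<bar>l2_inner \<Omega> (dtt \<tau> z n) v + a_form A \<Omega> (tavg z n) v\<bar> \<le> \<rho> * nn v"
    and \<rho>: "0 \<le> \<rho>"
  shows "energy_norm \<Omega> A \<tau> z n \<le> energy_norm \<Omega> A \<tau> z (n - 1) + 2 * \<tau> / sqrt (mass_const CARD('n)) * \<rho>"
proof -
  define D where "D = half_diff \<tau> z n"
  define D' where "D' = half_diff \<tau> z (n - 1)"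
  define H where "H = half_step z n"
  define H' where "H' = half_step z (n - 1)"
  define v where "v = (\<lambda>x. (1/2) * D x + (1/2) * D' x)"
  define E where "E = energy_norm \<Omega> A \<tau> z n"
  define E' where "E' = energy_norm \<Omega> A \<tau> z (n - 1)"
  have n1: "n - 1 + 1 = n" using n by simp
  have fe: "D \<in> fe_space \<Omega> \<T>" "D' \<in> fe_space \<Omega> \<T>"
    unfolding D_def D'_def using half_diff_fe[of z n \<tau>] half_diff_fe[of z "n - 1" \<tau>] z n1 by auto
  have vfe: "v \<in> fe_space \<Omega> \<T>"
    unfolding v_def using fe by (rule fe_space_lincomb)
  have Esq: "E\<^sup>2 = nf mass_entry D D + nf (stiff_entry A) H H"
    unfolding E_def D_def H_def by (rule energy_norm_sq[OF z(1,2)])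
  have E'sq: "E'\<^sup>2 = nf mass_entry D' D' + nf (stiff_entry A) H' H'"
    unfolding E'_def D'_def H'_def using energy_norm_sq[of z "n - 1" \<tau>] z n1 by simp
  have E0: "0 \<le> E" "0 \<le> E'" by (simp_all add: E_def E'_def energy_norm_nonneg)
  have dtt: "dtt \<tau> z n = (\<lambda>x. (1/\<tau>) * D x + (-1/\<tau>) * D' x)"
    using \<tau> n1 by (auto simp: fun_eq_iff dtt_def D_def D'_def half_diff_def power2_eq_square field_simps)
  have tavg: "tavg z n = (\<lambda>x. (1/2) * H x + (1/2) * H' x)"
    using n1 by (auto simp: fun_eq_iff tavg_def H_def H'_def half_step_def field_simps)
  \<comment> \<open>The same test function is the mean of the velocities and a difference quotient
    of the half-step values. The first form telescopes the mass part, the second the stiffness part;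
    mixed terms cancel by symmetry.\<close>
  have vH: "v = (\<lambda>x. (1/\<tau>) * H x + (-1/\<tau>) * H' x)"
    using \<tau> n1 by (auto simp: fun_eq_iff v_def D_def D'_def H_def H'_def half_diff_def half_step_def field_simps)
  have m: "nf mass_entry (dtt \<tau> z n) v = (nf mass_entry D D - nf mass_entry D' D') / (2 * \<tau>)"
    unfolding dtt v_def nform_lincomb_left nform_lincomb_right
    using nform_sym[OF mass_entry_sym, where x = D and y = D' and \<E> = \<T> and V = verts] \<tau> by (simp add: field_simps)
  have a: "nf (stiff_entry A) (tavg z n) v = (nf (stiff_entry A) H H - nf (stiff_entry A) H' H') / (2 * \<tau>)"
    unfolding tavg vH nform_lincomb_left nform_lincomb_right
    using nform_sym[OF stiff_entry_sym, where x = H and y = H' and \<E> = \<T> and V = verts] \<tau> by (simp add: field_simps)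
  have "l2_inner \<Omega> (dtt \<tau> z n) v + a_form A \<Omega> (tavg z n) v = (E\<^sup>2 - E'\<^sup>2) / (2 * \<tau>)"
    using l2_inner_domain[OF fe_space_Q1[OF dtt_fe[of z, OF z]] fe_space_Q1[OF vfe]]
      a_form_domain[OF fe_space_Q1[OF tavg_fe[of z, OF z]] fe_space_Q1[OF vfe]] m a
    by (simp add: Esq E'sq add_divide_distrib diff_divide_distrib)
  hence "(E\<^sup>2 - E'\<^sup>2) / (2 * \<tau>) \<le> \<rho> * nn v"
    using res[OF vfe] by linarith
  hence inc: "E\<^sup>2 - E'\<^sup>2 \<le> 2 * \<tau> * \<rho> * nn v"
    using \<tau> by (simp add: field_simps)
  have "nn v \<le> (E + E') / sqrt (mass_const CARD('n))"
  proof -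
    have nnE: "nn D \<le> E / sqrt (mass_const CARD('n))" "nn D' \<le> E' / sqrt (mass_const CARD('n))"
    proof -
      have "l2_norm \<Omega> D \<le> E" "l2_norm \<Omega> D' \<le> E'"
        unfolding E_def E'_def D_def D'_def energy_norm_def by (auto intro: real_le_rsqrt)
      thus "nn D \<le> E / sqrt (mass_const CARD('n))" "nn D' \<le> E' / sqrt (mass_const CARD('n))"
        using nnorm_le_l2_norm[OF fe_space_Q1] fe mass_pos
        by (meson divide_right_mono order.trans real_sqrt_ge_zero order.strict_implies_order)+
    qed
    have "nn v \<le> (1/2) * nn D + (1/2) * nn D'"
      unfolding v_def using nnorm_triangle[of "\<lambda>x. (1/2) * D x" "\<lambda>x. (1/2) * D' x"]
        nnorm_scale[of "1/2" D] nnorm_scale[of "1/2" D'] by simp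
    also have "\<dots> \<le> nn D + nn D'" using nnorm_nonneg[of D] nnorm_nonneg[of D'] by simp
    also have "\<dots> \<le> (E + E') / sqrt (mass_const CARD('n))" using nnE by (simp add: add_divide_distrib)
    finally show ?thesis .
  qed
  hence "2 * \<tau> * \<rho> * nn v \<le> 2 * \<tau> * \<rho> * ((E + E') / sqrt (mass_const CARD('n)))"
    using \<tau> \<rho> by (intro mult_left_mono) auto
  hence "(E - E') * (E + E') \<le> (2 * \<tau> / sqrt (mass_const CARD('n)) * \<rho>) * (E + E')"
    using inc by (simp add: power2_eq_square algebra_simps)
  \<comment> \<open>Dividing the increment of the squares by \<open>E + E'\<close> leaves a bound
    that is additive in the residual; if the sum is zero, so is \<open>E\<close>.\<close>
  hence "E + E' = 0 \<or> E - E' \<le> 2 * \<tau> / sqrt (mass_const CARD('n)) * \<rho>"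
    using E0 unfolding mult_le_cancel_right by linarith
  moreover have "0 \<le> 2 * \<tau> / sqrt (mass_const CARD('n)) * \<rho>" using \<tau> \<rho> mass_pos by simp
  ultimately have "E \<le> E' + 2 * \<tau> / sqrt (mass_const CARD('n)) * \<rho>" using E0 by auto
  thus ?thesis by (simp add: E_def E'_def)
qed

text \<open>The energy bounds the oscillation on each element, the Poincare inequality turns this
  into a bound for every nodal value at the price of the number of elements, and summation with the
  volumes gives the norm. For \<open>r\<close> proportional to \<open>h\<close>, the lost powers of
  \<open>R / r\<close> cost a multiple of |ln h| layers.\<close>

lemma nnorm_le_energy:
  assumes "closure \<Omega> \<subseteq> cball c R" "0 \<le> R" and v: "v \<in> fe_space \<Omega> \<T>"
  shows "nn v \<le> sqrt (2 ^ CARD('n) * (R / r) ^ CARD('n) / (\<alpha> * mass_const CARD('n))) * (R / r) ^ CARD('n)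
      * (2 * real CARD('n) * h) * a_norm A \<Omega> v"
proof -
  let ?V = "unit_ball_vol (real CARD('n))" and ?d = "CARD('n)"
  have V: "0 < ?V" by simp
  hence V0: "?V \<noteq> 0" by (rule less_imp_neq[symmetric])
  define a where "a = a_norm A \<Omega> v"
  have a0: "0 \<le> a" using nform_stiff_nonneg[of v] v
    by (simp add: a_def a_norm_def a_form_domain fe_space_Q1)
  define e where "e = 2 * real ?d * h * a / sqrt (\<alpha> * mass_const CARD('n) * (?V * r ^ ?d))"
  have den: "0 < \<alpha> * mass_const CARD('n) * (?V * r ^ ?d)" using alpha_pos mass_pos V r_pos by simp
  have osc: "\<bar>v p - v q\<bar> \<le> e" if "K \<in> \<T>" "p \<in> verts K" "q \<in> verts K" for K p q
  proof -
    have "\<alpha> * mass_const CARD('n) * (?V * r ^ ?d) * (v p - v q)\<^sup>2 \<le> (2 * real ?d * h * a)\<^sup>2"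
      using vertex_diff_le[OF that, of v] a_norm_sq[OF fe_space_Q1[OF v]] by (simp add: a_def power_mult_distrib)
    hence "(v p - v q)\<^sup>2 \<le> e\<^sup>2"
      using den by (simp add: e_def power_divide field_simps)
    moreover have "0 \<le> e" using a0 h_pos den by (simp add: e_def)
    ultimately show ?thesis using abs_le_square_iff[of "v p - v q" e] by simp
  qed
  have card: "real (card \<T>) \<le> (R / r) ^ ?d"
    using card_mesh_le[of c R] assms cover by simp
  have Rr: "0 \<le> (R / r) ^ ?d" using assms r_pos by simp
  have e0: "0 \<le> e" using a0 h_pos den by (simp add: e_def)
  have bd: "\<bar>v p\<bar> \<le> (R / r) ^ ?d * e" if "K \<in> \<T>" "p \<in> verts K" for K p
  proof -
    have "p \<in> closure \<Omega>" using that verts_subset[OF para] cover by blast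
    hence "\<bar>v p\<bar> \<le> real (card \<T>) * e" by (rule discrete_poincare[OF v _ osc])
    also have "\<dots> \<le> (R / r) ^ ?d * e" using card e0 by (rule mult_right_mono)
    finally show ?thesis .
  qed
  have total: "(\<Sum>K\<in>\<T>. measure lebesgue K) \<le> ?V * R ^ ?d"
    using sum_measure_le[of c R] assms cover by simp
  have "(nn v)\<^sup>2 \<le> (\<Sum>K\<in>\<T>. measure lebesgue K * (2 ^ ?d * ((R / r) ^ ?d * e)\<^sup>2))"
    unfolding nnorm_sq
  proof (intro sum_mono mult_left_mono)
    fix K assume K: "K \<in> \<T>"
    have "(\<Sum>p\<in>verts K. (v p)\<^sup>2) \<le> (\<Sum>p\<in>verts K. ((R / r) ^ ?d * e)\<^sup>2)"
      using bd[OF K] by (intro sum_mono) (meson abs_le_square_iff abs_ge_self order.trans)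
    thus "(\<Sum>p\<in>verts K. (v p)\<^sup>2) \<le> 2 ^ ?d * ((R / r) ^ ?d * e)\<^sup>2"
      by (simp add: card_verts[OF para[OF K]])
  qed simp
  also have "\<dots> \<le> (?V * R ^ ?d) * (2 ^ ?d * ((R / r) ^ ?d * e)\<^sup>2)"
    unfolding sum_distrib_right[symmetric] using total by (rule mult_right_mono) simp
  also have "\<dots> = (2 ^ ?d * (R / r) ^ ?d / (\<alpha> * mass_const CARD('n))) * ((R / r) ^ ?d * (2 * real ?d * h) * a)\<^sup>2"
    using den V r_pos alpha_pos mass_pos
    by (simp add: e_def power_divide power_mult_distrib) (use V0 in \<open>simp add: field_simps\<close>)
  finally have "sqrt ((nn v)\<^sup>2) \<le> sqrt ((2 ^ ?d * (R / r) ^ ?d / (\<alpha> * mass_const CARD('n))) * ((R / r) ^ ?d * (2 * real ?d * h) * a)\<^sup>2)"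
    by (rule real_sqrt_le_mono)
  thus ?thesis
    using nnorm_nonneg[of v] a0 Rr h_pos unfolding real_sqrt_mult
    by (simp add: a_def abs_mult mult.assoc)
qed

text \<open>The values next to a half step are the half-step mean plus and minus half a time step of
  velocity. The local problems restart from two such values, whereas only the energy is controlled
  across resets.\<close>

lemma data_bound:
  assumes R: "closure \<Omega> \<subseteq> cball c R" "0 \<le> R" and \<tau>: "0 < \<tau>"
    and z: "z (n + 1) \<in> fe_space \<Omega> \<T>" "z n \<in> fe_space \<Omega> \<T>"
  shows "nn (z n) + nn (z (n + 1)) \<le> data_const CARD('n) r \<alpha> h R \<tau> * energy_norm \<Omega> A \<tau> z n"
proof -
  let ?H = "half_step z n" and ?D = "half_diff \<tau> z n" and ?E = "energy_norm \<Omega> A \<tau> z n"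
  define P where "P = sqrt (2 ^ CARD('n) * (R / r) ^ CARD('n) / (\<alpha> * mass_const CARD('n))) * (R / r) ^ CARD('n)
      * (2 * real CARD('n) * h)"
  have P0: "0 \<le> P" using R r_pos h_pos alpha_pos mass_pos by (simp add: P_def)
  have Dfe: "?D \<in> fe_space \<Omega> \<T>" and Hfe: "?H \<in> fe_space \<Omega> \<T>"
    using half_diff_fe[of z, OF z] half_step_fe[of z, OF z] by auto
  have "l2_norm \<Omega> ?D \<le> ?E" "a_norm A \<Omega> ?H \<le> ?E"
    unfolding energy_norm_def by (auto intro: real_le_rsqrt)
  hence "nn ?D \<le> ?E / sqrt (mass_const CARD('n))" and "nn ?H \<le> P * ?E"
    using nnorm_le_l2_norm[OF fe_space_Q1[OF Dfe]] nnorm_le_energy[OF R Hfe] mass_pos P0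
    unfolding P_def[symmetric]
    by (meson divide_right_mono mult_left_mono order.trans real_sqrt_ge_zero order.strict_implies_order)+
  moreover have "z n = (\<lambda>x. ?H x + (- \<tau> / 2) * ?D x)" "z (n + 1) = (\<lambda>x. ?H x + (\<tau> / 2) * ?D x)"
    using \<tau> by (auto simp: fun_eq_iff half_step_def half_diff_def field_simps)
  hence "nn (z n) \<le> nn ?H + \<tau> / 2 * nn ?D" "nn (z (n + 1)) \<le> nn ?H + \<tau> / 2 * nn ?D"
    using nnorm_triangle[of ?H "\<lambda>x. (- \<tau> / 2) * ?D x"] nnorm_scale[of "- \<tau> / 2" ?D]
      nnorm_triangle[of ?H "\<lambda>x. (\<tau> / 2) * ?D x"] nnorm_scale[of "\<tau> / 2" ?D] \<tau> by auto
  ultimately have "nn (z n) + nn (z (n + 1)) \<le> 2 * (P * ?E) + \<tau> * (?E / sqrt (mass_const CARD('n)))"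
    using \<tau> mult_left_mono[of "nn ?D" "?E / sqrt (mass_const CARD('n))" \<tau>] by simp
  moreover have "data_const CARD('n) r \<alpha> h R \<tau> = 2 * P + \<tau> / sqrt (mass_const CARD('n))"
    by (simp only: data_const_def P_def)
  ultimately show ?thesis by (simp add: algebra_simps)
qed

end


section \<open>Decay of the local solutions\<close>

text \<open>The factor of \<open>weighted_solution_bound\<close> for one time step, with
  \<open>\<mu>\<close> replaced by its upper bound 1.\<close>

definition step_const :: "nat \<Rightarrow> real" where
  "step_const d = 2 * exp 1 * 2 ^ d / mass_const d"

text \<open>Since the new value is \<open>W\<close> minus twice the present and once the previous
  one, a step contributes \<open>4 * step_const d\<close> through \<open>W\<close> and 2 + 1 through
  the old values.\<close>

definition growth_const :: "nat \<Rightarrow> real" where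
  "growth_const d = 4 * step_const d + 3"

text \<open>The residual factor of \<open>weighted_step\<close> after at most \<open>N\<close>
  steps. The 5 is 4 + 1, from the two terms of the right-hand side
  \<open>4 w + \<tau>\<^sup>2 f\<close>.\<close>

definition local_const :: "nat \<Rightarrow> real \<Rightarrow> real \<Rightarrow> real \<Rightarrow> real \<Rightarrow> nat \<Rightarrow> nat \<Rightarrow> real" where
  "local_const d r \<beta> \<tau> \<mu> l N = cond_const d r \<beta> \<tau> * exp 1 * 2 ^ d * exp (- \<mu> * real l)
     * ((step_const d + 1) * (5 * growth_const d ^ N)) / \<tau>\<^sup>2"

lemma step_const_nonneg: "0 \<le> step_const d"
  by (simp add: step_const_def mass_const_def)

lemma growth_const_ge_1: "1 \<le> growth_const d"
  using step_const_nonneg[of d] by (simp add: growth_const_def)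

context fe_mesh
begin

section \<open>The local problem on one patch\<close>

context
  fixes \<omega> :: "(real ^ 'n) set" and l' :: nat and \<tau> \<mu> :: real
  assumes \<omega>: "closure \<omega> \<subseteq> closure \<Omega>" and \<tau>: "0 < \<tau>" and \<mu>: "0 \<le> \<mu>" "\<mu> \<le> 1"
    and small: "(cosh \<mu> - 1) * cond_const CARD('n) r \<beta> \<tau> * real (2 ^ CARD('n)) \<le> mass_const CARD('n) / 2"
begin

abbreviation "wgt x \<equiv> (\<lambda>p. exp (\<mu> * layer (Suc l') \<omega> p) * x p)"
text \<open>Writing the number of layers as \<open>Suc l'\<close> makes the local domain the patch
  of a set, as \<open>fe_space_on_patch\<close> requires.\<close>

abbreviation "V\<^sub>S \<equiv> fe_space_on \<Omega> \<T> (patches \<T> (Suc l') \<omega>)"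

lemma V\<^sub>S_iff: "v \<in> V\<^sub>S \<longleftrightarrow> v \<in> fe_space \<Omega> \<T> \<and> (\<forall>K\<in>\<T> - star (patches \<T> l' \<omega>). \<forall>p\<in>verts K. v p = 0)"
  unfolding patches_Suc by (rule fe_space_on_patch)

lemma nodal_interp_in_V\<^sub>S:
  assumes v: "v \<in> fe_space \<Omega> \<T>"
    and g: "\<And>p. v p = 0 \<Longrightarrow> g p = 0" "\<And>K p. K \<in> \<T> - star (patches \<T> l' \<omega>) \<Longrightarrow> p \<in> verts K \<Longrightarrow> g p = 0"
  shows "nodal_interp \<T> g \<in> V\<^sub>S"
proof -
  have "nodal_interp \<T> g \<in> fe_space \<Omega> \<T>"
    using v g(1) by (intro nodal_interp_in_fe_space) (auto simp: fe_space_def)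
  moreover have "nodal_interp \<T> g p = 0" if "K \<in> \<T> - star (patches \<T> l' \<omega>)" "p \<in> verts K" for K p
    using that g(2) by (subst nodal_interp_vertex) (auto simp: mesh_vertices_eq)
  ultimately show ?thesis by (simp add: V\<^sub>S_iff)
qed

text \<open>\<open>W\<close> vanishes where the local space does, so its exponentially weighted
  nodal values are an admissible test function; this gives the first bound. For a global test
  function, the local equation removes all nodal values inside the patch, and the others carry the
  factor \<open>exp (- \<mu> * real (Suc l'))\<close>.\<close>

lemma weighted_step:
  assumes w: "w (n + 1) \<in> V\<^sub>S" "w n \<in> V\<^sub>S" "w (n - 1) \<in> V\<^sub>S"
    and f: "tavg f n \<in> Q1_space \<T>"
    and eq: "cn_equation A \<tau> (patches \<T> (Suc l') \<omega>) V\<^sub>S f w n"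
  defines "W \<equiv> (\<lambda>x. w (n + 1) x + 2 * w n x + w (n - 1) x)"
  defines "R \<equiv> (\<lambda>x. 4 * w n x + \<tau>\<^sup>2 * tavg f n x)"
  shows "nn (wgt W) \<le> step_const CARD('n) * nn (wgt R)"
    and "v \<in> fe_space \<Omega> \<T> \<Longrightarrow>
      \<bar>nf mass_entry (dtt \<tau> w n) v + nf (stiff_entry A) (tavg w n) v - nf mass_entry (tavg f n) v\<bar>
      \<le> cond_const CARD('n) r \<beta> \<tau> * exp 1 * 2 ^ CARD('n) * exp (- \<mu> * real (Suc l'))
         * (nn (wgt W) + nn (wgt R)) * nn v / \<tau>\<^sup>2"
proof -
  let ?d = "layer (Suc l') \<omega>" and ?\<kappa> = "cond_const CARD('n) r \<beta> \<tau>"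
  have wfe: "w (n + 1) \<in> fe_space \<Omega> \<T>" "w n \<in> fe_space \<Omega> \<T>" "w (n - 1) \<in> fe_space \<Omega> \<T>"
    using w by (auto simp: V\<^sub>S_iff)
  have W_fe: "W \<in> fe_space \<Omega> \<T>"
    unfolding W_def using fe_space_lincomb[OF fe_space_lincomb[OF wfe(1,2), of 1 2] wfe(3), of 1 1] by simp
  have W_out: "W p = 0" if "K \<in> \<T> - star (patches \<T> l' \<omega>)" "p \<in> verts K" for K p
    using w that by (auto simp: V\<^sub>S_iff W_def)
  have local: "nf (cn_entry \<tau>) W t = nf mass_entry R t" if t: "t \<in> V\<^sub>S" for t
  proof -
    have "nf mass_entry (dtt \<tau> w n) t + nf (stiff_entry A) (tavg w n) t = nf mass_entry (tavg f n) t"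
      using eq t f local_forms[OF fe_space_Q1[OF dtt_fe[of w, OF wfe]]] local_forms[OF fe_space_Q1[OF tavg_fe[of w, OF wfe]]]
        local_forms(1)[OF f]
      unfolding cn_equation_def patches_Suc by metis
    thus ?thesis
      using cn_residual_eq[of \<tau> w n t f] \<tau> by (simp add: W_def R_def)
  qed
  show bound: "nn (wgt W) \<le> step_const CARD('n) * nn (wgt R)"
  proof -
    define g where "g p = exp (2 * \<mu> * ?d p) * W p" for p
    have "nodal_interp \<T> g \<in> V\<^sub>S"
      using W_fe W_out by (intro nodal_interp_in_V\<^sub>S[of W]) (auto simp: g_def)
    hence "nf (cn_entry \<tau>) W (nodal_interp \<T> g) = nf mass_entry R (nodal_interp \<T> g)"
      by (rule local)
    \<comment> \<open>The forms see nodal values only, so the interpolant may be replaced by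
      \<open>g\<close>, which is not piecewise multilinear.\<close>
    moreover have "nf M x (nodal_interp \<T> g) = nf M x g" for M and x :: "real ^ 'n \<Rightarrow> real"
      by (rule nform_cong) (auto intro!: nodal_interp_vertex simp: mesh_vertices_eq)
    ultimately have "nf (cn_entry \<tau>) W g = nf mass_entry R g" by simp
    hence "nn (wgt W) \<le> 2 * exp \<mu> * real (2 ^ CARD('n)) / mass_const CARD('n) * nn (wgt R)"
      unfolding g_def using cond_const_ge_1 mass_pos cn_entry_sym cn_coercive small \<mu>
      by (intro weighted_solution_bound[where \<kappa> = ?\<kappa> and M = "cn_entry \<tau>" and M' = mass_entry])
         (auto intro!: layer_diff abs_cn_entry order.trans[OF zero_le_one cond_const_ge_1] abs_mass_entry)
    also have "\<dots> \<le> step_const CARD('n) * nn (wgt R)"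
      using \<mu> mass_pos nnorm_nonneg unfolding step_const_def
      by (intro mult_right_mono divide_right_mono) auto
    finally show ?thesis .
  qed
  assume v: "v \<in> fe_space \<Omega> \<T>"
  \<comment> \<open>\<open>v1\<close> keeps the nodal values that a local test function may have;
    \<open>v2\<close> is the rest, on vertices where the layer function takes its maximal
    value.\<close>
  define out where "out = (\<Union>K\<in>\<T> - star (patches \<T> l' \<omega>). verts K)"
  define v1 where "v1 p = (if p \<in> out then 0 else v p)" for p
  define v2 where "v2 p = (if p \<in> out then v p else 0)" for p
  have "nodal_interp \<T> v1 \<in> V\<^sub>S"
    using v by (intro nodal_interp_in_V\<^sub>S[of v]) (auto simp: v1_def out_def)
  hence "nf (cn_entry \<tau>) W (nodal_interp \<T> v1) = nf mass_entry R (nodal_interp \<T> v1)"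
    by (rule local)
  moreover have "nf M x (nodal_interp \<T> v1) = nf M x v1" for M and x :: "real ^ 'n \<Rightarrow> real"
    by (rule nform_cong) (auto intro!: nodal_interp_vertex simp: mesh_vertices_eq)
  ultimately have v1: "nf (cn_entry \<tau>) W v1 = nf mass_entry R v1" by simp
  have "v = (\<lambda>p. 1 * v1 p + 1 * v2 p)" by (auto simp: v1_def v2_def)
  hence split: "nf M x v = nf M x v1 + nf M x v2" for M and x :: "real ^ 'n \<Rightarrow> real"
    using nform_lincomb_right[of \<T> verts M x 1 v1 1 v2] by simp
  have decay: "nn (\<lambda>p. exp (- \<mu> * ?d p) * v2 p) \<le> exp (- \<mu> * real (Suc l')) * nn v"
  proof -
    have "nn (\<lambda>p. exp (- \<mu> * ?d p) * v2 p) \<le> nn (\<lambda>p. exp (- \<mu> * real (Suc l')) * v p)"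
    proof (rule nnorm_mono)
      fix K p assume "K \<in> \<T>" "p \<in> verts K"
      show "\<bar>exp (- \<mu> * ?d p) * v2 p\<bar> \<le> \<bar>exp (- \<mu> * real (Suc l')) * v p\<bar>"
      proof (cases "p \<in> out")
        case True
        then obtain K' where K': "K' \<in> \<T> - star (patches \<T> l' \<omega>)" "p \<in> verts K'"
          by (auto simp: out_def)
        hence "p \<notin> closure (patches \<T> l' \<omega>)"
          using verts_subset[OF para] by (auto simp: star_def)
        hence "?d p = real (Suc l')" by (rule layer_outside[OF \<omega>])
        thus ?thesis using True by (simp add: v2_def)
      qed (simp add: v2_def)
    qed
    thus ?thesis by (simp add: nnorm_scale)
  qed
  have est: "\<bar>nf M x v2\<bar> \<le> ?\<kappa> * exp 1 * 2 ^ CARD('n) * nn (wgt x) * (exp (- \<mu> * real (Suc l')) * nn v)"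
    if M: "\<And>K p q. K \<in> \<T> \<Longrightarrow> p \<in> verts K \<Longrightarrow> q \<in> verts K \<Longrightarrow> \<bar>M K p q\<bar> \<le> ?\<kappa> * measure lebesgue K"
    for M and x :: "real ^ 'n \<Rightarrow> real"
  proof -
    have "\<bar>nf M x v2\<bar> \<le> ?\<kappa> * exp \<mu> * real (2 ^ CARD('n)) * nn (wgt x) * nn (\<lambda>p. exp (- \<mu> * ?d p) * v2 p)"
      using M \<mu> by (intro abs_nform_weighted_le)
        (auto intro!: layer_diff order.trans[OF zero_le_one cond_const_ge_1])
    also have "\<dots> \<le> ?\<kappa> * exp 1 * 2 ^ CARD('n) * nn (wgt x) * (exp (- \<mu> * real (Suc l')) * nn v)"
      using decay \<mu> nnorm_nonneg order.trans[OF zero_le_one cond_const_ge_1[of \<tau>]]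
      by (intro mult_mono mult_nonneg_nonneg) auto
    finally show ?thesis .
  qed
  have mass_le: "\<bar>mass_entry K p q\<bar> \<le> ?\<kappa> * measure lebesgue K" if "K \<in> \<T>" "p \<in> verts K" "q \<in> verts K" for K p q
    using abs_mass_entry[OF that] mult_right_mono[OF cond_const_ge_1[of \<tau>], of "measure lebesgue K"] by simp
  have "\<bar>nf (cn_entry \<tau>) W v2\<bar> \<le> ?\<kappa> * exp 1 * 2 ^ CARD('n) * nn (wgt W) * (exp (- \<mu> * real (Suc l')) * nn v)"
    by (rule est) (rule abs_cn_entry)
  moreover have "\<bar>nf mass_entry R v2\<bar> \<le> ?\<kappa> * exp 1 * 2 ^ CARD('n) * nn (wgt R) * (exp (- \<mu> * real (Suc l')) * nn v)"
    by (rule est) (rule mass_le)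
  ultimately have "\<bar>nf (cn_entry \<tau>) W v - nf mass_entry R v\<bar>
      \<le> ?\<kappa> * exp 1 * 2 ^ CARD('n) * nn (wgt W) * (exp (- \<mu> * real (Suc l')) * nn v)
       + ?\<kappa> * exp 1 * 2 ^ CARD('n) * nn (wgt R) * (exp (- \<mu> * real (Suc l')) * nn v)"
    using v1 unfolding split by linarith
  also have "\<dots> = ?\<kappa> * exp 1 * 2 ^ CARD('n) * exp (- \<mu> * real (Suc l')) * (nn (wgt W) + nn (wgt R)) * nn v"
    by (simp add: algebra_simps)
  finally have "\<bar>nf (cn_entry \<tau>) W v - nf mass_entry R v\<bar> / \<tau>\<^sup>2
      \<le> ?\<kappa> * exp 1 * 2 ^ CARD('n) * exp (- \<mu> * real (Suc l')) * (nn (wgt W) + nn (wgt R)) * nn v / \<tau>\<^sup>2"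
    by (rule divide_right_mono) simp
  thus "\<bar>nf mass_entry (dtt \<tau> w n) v + nf (stiff_entry A) (tavg w n) v - nf mass_entry (tavg f n) v\<bar>
      \<le> ?\<kappa> * exp 1 * 2 ^ CARD('n) * exp (- \<mu> * real (Suc l')) * (nn (wgt W) + nn (wgt R)) * nn v / \<tau>\<^sup>2"
    using cn_residual_eq[of \<tau> w n v f] \<tau> unfolding W_def R_def by simp
qed

lemma weighted_rhs:
  "nn (wgt (\<lambda>x. 4 * w x + \<tau>\<^sup>2 * g x)) \<le> 4 * nn (wgt w) + \<tau>\<^sup>2 * nn (wgt g)"
proof -
  have "wgt (\<lambda>x. 4 * w x + \<tau>\<^sup>2 * g x) = (\<lambda>p. 4 * wgt w p + \<tau>\<^sup>2 * wgt g p)"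
    by (auto simp: algebra_simps)
  thus ?thesis
    using nnorm_triangle[of "\<lambda>p. 4 * wgt w p" "\<lambda>p. \<tau>\<^sup>2 * wgt g p"] nnorm_scale[of 4 "wgt w"]
      nnorm_scale[of "\<tau>\<^sup>2" "wgt g"] by simp
qed

text \<open>A three-term recursion, hence the maximum over two consecutive steps. Exponential growth
  in \<open>j\<close> is acceptable: it costs a number of layers proportional to the steps between
  two resets.\<close>

lemma weighted_growth:
  assumes init: "w m \<in> V\<^sub>S" "w (m + 1) \<in> V\<^sub>S"
    and w: "\<And>n. n \<in> {m + 1..m + N} \<Longrightarrow> w (n + 1) \<in> V\<^sub>S \<and> cn_equation A \<tau> (patches \<T> (Suc l') \<omega>) V\<^sub>S f w n"
    and f: "\<And>n. tavg f n \<in> Q1_space \<T>" and j: "j \<le> N"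
  shows "max (nn (wgt (w (m + j)))) (nn (wgt (w (m + j + 1))))
     \<le> growth_const CARD('n) ^ j * (nn (wgt (w m)) + nn (wgt (w (m + 1)))
        + \<tau>\<^sup>2 * (\<Sum>i=1..j. nn (wgt (tavg f (m + i)))))"
  using j
proof (induction j)
  case 0
  show ?case using nnorm_nonneg[of "wgt (w m)"] nnorm_nonneg[of "wgt (w (m + 1))"] by simp
next
  case (Suc j)
  let ?q = "growth_const CARD('n)" and ?C = "step_const CARD('n)"
  define n where "n = m + Suc j"
  define a where "a i = nn (wgt (w i))" for i
  define F where "F = nn (wgt (tavg f n))"
  define S where "S = a m + a (m + 1) + \<tau>\<^sup>2 * (\<Sum>i=1..j. nn (wgt (tavg f (m + i))))"
  have a0: "0 \<le> a i" for i by (simp add: a_def nnorm_nonneg)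
  have F0: "0 \<le> F" by (simp add: F_def nnorm_nonneg)
  have S0: "0 \<le> S" unfolding S_def using a0 by (intro add_nonneg_nonneg mult_nonneg_nonneg sum_nonneg) (auto simp: nnorm_nonneg)
  have mem: "w i \<in> V\<^sub>S" if "m \<le> i" "i \<le> m + N + 1" for i
  proof (cases "i \<le> m + 1")
    case True
    thus ?thesis using init that by (cases "i = m") (auto simp: le_Suc_eq)
  next
    case False
    hence "i - 1 \<in> {m + 1..m + N}" "i - 1 + 1 = i" using that by auto
    thus ?thesis using w[of "i - 1"] by simp
  qed
  have IH: "max (a (n - 1)) (a n) \<le> ?q ^ j * S"
    using Suc.IH Suc.prems by (simp add: a_def S_def n_def)
  have nm: "n \<in> {m + 1..m + N}" using Suc.prems by (auto simp: n_def)
  let ?W = "\<lambda>x. w (n + 1) x + 2 * w n x + w (n - 1) x"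
  have W: "nn (wgt ?W) \<le> ?C * (4 * a n + \<tau>\<^sup>2 * F)"
  proof -
    have "nn (wgt ?W) \<le> ?C * nn (wgt (\<lambda>x. 4 * w n x + \<tau>\<^sup>2 * tavg f n x))"
      using nm by (intro weighted_step(1) mem f conjunct2[OF w]) auto
    also have "\<dots> \<le> ?C * (4 * a n + \<tau>\<^sup>2 * F)"
      unfolding a_def F_def by (intro mult_left_mono weighted_rhs step_const_nonneg)
    finally show ?thesis .
  qed
  have "a (n + 1) \<le> nn (wgt ?W) + (2 * a n + a (n - 1))"
  proof -
    have "wgt (w (n + 1)) = (\<lambda>p. wgt ?W p + ((-2) * wgt (w n) p + (-1) * wgt (w (n - 1)) p))"
      by (auto simp: algebra_simps)
    hence "a (n + 1) \<le> nn (wgt ?W) + nn (\<lambda>p. (-2) * wgt (w n) p + (-1) * wgt (w (n - 1)) p)"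
      unfolding a_def using nnorm_triangle[of "wgt ?W"] by simp
    moreover have "nn (\<lambda>p. (-2) * wgt (w n) p + (-1) * wgt (w (n - 1)) p) \<le> 2 * a n + a (n - 1)"
      using nnorm_triangle[of "\<lambda>p. (-2) * wgt (w n) p" "\<lambda>p. (-1) * wgt (w (n - 1)) p"]
        nnorm_scale[of "-2" "wgt (w n)"] nnorm_scale[of "-1" "wgt (w (n - 1))"]
      by (simp add: a_def)
    ultimately show ?thesis by linarith
  qed
  also have "\<dots> \<le> ?C * (4 * (?q ^ j * S) + \<tau>\<^sup>2 * F) + (2 * (?q ^ j * S) + ?q ^ j * S)"
    using W IH step_const_nonneg[of "CARD('n)"]
    by (intro add_mono order.trans[OF W] mult_left_mono) auto
  also have "\<dots> = ?q * (?q ^ j * S) + ?C * (\<tau>\<^sup>2 * F)"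
    by (simp add: growth_const_def algebra_simps)
  also have "\<dots> \<le> ?q * (?q ^ j * S) + ?q * (?q ^ j * (\<tau>\<^sup>2 * F))"
  proof -
    have "?C * 1 \<le> ?q * ?q ^ j"
      using step_const_nonneg[of "CARD('n)"] growth_const_ge_1[of "CARD('n)"]
      by (intro mult_mono one_le_power) (auto simp: growth_const_def)
    hence "(?C * 1) * (\<tau>\<^sup>2 * F) \<le> (?q * ?q ^ j) * (\<tau>\<^sup>2 * F)"
      using F0 by (intro mult_right_mono) auto
    thus ?thesis by (simp add: mult.assoc)
  qed
  also have "\<dots> = ?q ^ Suc j * (S + \<tau>\<^sup>2 * F)" by (simp add: algebra_simps)
  finally have up: "a (n + 1) \<le> ?q ^ Suc j * (S + \<tau>\<^sup>2 * F)" .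
  have "a n \<le> ?q ^ j * S" using IH by simp
  also have "\<dots> \<le> ?q ^ Suc j * (S + \<tau>\<^sup>2 * F)"
    using S0 F0 growth_const_ge_1[of "CARD('n)"] by (intro mult_mono power_increasing) auto
  finally have "max (a n) (a (n + 1)) \<le> ?q ^ Suc j * (S + \<tau>\<^sup>2 * F)" using up by simp
  moreover have "S + \<tau>\<^sup>2 * F = a m + a (m + 1) + \<tau>\<^sup>2 * (\<Sum>i=1..Suc j. nn (wgt (tavg f (m + i))))"
    by (simp add: S_def F_def n_def algebra_simps)
  ultimately show ?case by (simp add: a_def n_def)
qed

text \<open>The weight equals 1 where the cut-off function is non-zero, so localized data enter
  without an exponential factor.\<close>

lemma nnorm_weighted_localized:
  assumes \<Lambda>: "\<And>x. 0 \<le> \<Lambda> x" "\<And>x. \<Lambda> x \<le> 1" "\<And>x. \<Lambda> x \<noteq> 0 \<Longrightarrow> x \<in> closure \<omega>"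
    and g: "\<And>p. p \<in> mesh_vertices \<T> \<Longrightarrow> g p = \<Lambda> p * x p"
  shows "nn (wgt g) \<le> nn x"
proof (rule nnorm_mono)
  fix K p assume "K \<in> \<T>" "p \<in> verts K"
  hence gp: "g p = \<Lambda> p * x p" using g by (auto simp: mesh_vertices_eq)
  show "\<bar>exp (\<mu> * layer (Suc l') \<omega> p) * g p\<bar> \<le> \<bar>x p\<bar>"
  proof (cases "\<Lambda> p = 0")
    case False
    hence "layer (Suc l') \<omega> p = 0" using layer_0[OF \<omega> \<Lambda>(3)] by simp
    thus ?thesis using mult_right_mono[OF \<Lambda>(2)[of p], of "\<bar>x p\<bar>"] \<Lambda>(1)[of p]
      by (simp add: gp abs_mult)
  qed (simp add: gp)
qed

text \<open>The solution on a patch, read as a global function, satisfies the global equation up to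
  an exponentially small residual, here in terms of the unlocalized data. Bounding by all
  \<open>N\<close> source terms makes the estimate uniform in the interval.\<close>

lemma local_residual:
  assumes \<Lambda>: "\<And>x. 0 \<le> \<Lambda> x" "\<And>x. \<Lambda> x \<le> 1" "\<And>x. \<Lambda> x \<noteq> 0 \<Longrightarrow> x \<in> closure \<omega>"
  defines "loc \<equiv> (\<lambda>v. nodal_interp \<T> (\<lambda>x. \<Lambda> x * v x))"
  assumes x: "x0 \<in> fe_space \<Omega> \<T>" "x1 \<in> fe_space \<Omega> \<T>" and init: "w m = loc x0" "w (m + 1) = loc x1"
    and w: "\<And>n. n \<in> {m + 1..m + N} \<Longrightarrow> w (n + 1) \<in> V\<^sub>S \<and>
          cn_equation A \<tau> (patches \<T> (Suc l') \<omega>) V\<^sub>S (\<lambda>j. loc (f j)) w n"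
    and f: "\<And>n. f n \<in> fe_space \<Omega> \<T>"
  shows "n \<in> {m..m + N + 1} \<Longrightarrow> w n \<in> V\<^sub>S"
    and "n \<in> {m + 1..m + N} \<Longrightarrow> v \<in> fe_space \<Omega> \<T> \<Longrightarrow>
      \<bar>nf mass_entry (dtt \<tau> w n) v + nf (stiff_entry A) (tavg w n) v
         - nf mass_entry (tavg (\<lambda>j. loc (f j)) n) v\<bar>
      \<le> local_const CARD('n) r \<beta> \<tau> \<mu> (Suc l') N * (nn x0 + nn x1 + \<tau>\<^sup>2 * (\<Sum>i=1..N. nn (tavg f (m + i)))) * nn v"
proof -
  let ?f = "\<lambda>j. loc (f j)"
  have loc_V: "loc y \<in> V\<^sub>S" if y: "y \<in> fe_space \<Omega> \<T>" for y
  proof -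
    have "\<Lambda> p * y p = 0" if K: "K \<in> \<T> - star (patches \<T> l' \<omega>)" and p: "p \<in> verts K" for K p
    proof (rule ccontr)
      assume "\<Lambda> p * y p \<noteq> 0"
      hence "p \<in> closure \<omega>" using \<Lambda>(3) by simp
      hence "p \<in> closure (patches \<T> l' \<omega>)"
        using closure_patches_mono[OF \<omega>, of 0 l'] by (auto simp: patches_def)
      thus False using K p verts_subset[OF para] by (auto simp: star_def)
    qed
    thus ?thesis unfolding loc_def using y by (intro nodal_interp_in_V\<^sub>S[of y]) auto
  qed
  have mem: "w i \<in> V\<^sub>S" if "i \<in> {m..m + N + 1}" for i
  proof -
    consider "i = m" | "i = m + 1" | "i - 1 \<in> {m + 1..m + N}" "i - 1 + 1 = i"
    proof -
      have "i = m \<or> i = m + 1 \<or> (i - 1 \<in> {m + 1..m + N} \<and> i - 1 + 1 = i)"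
        using \<open>i \<in> {m..m + N + 1}\<close> by auto
      thus ?thesis using that by blast
    qed
    thus ?thesis
    proof cases
      case 3
      thus ?thesis using w[of "i - 1"] by simp
    qed (use init loc_V x in auto)
  qed
  thus "n \<in> {m..m + N + 1} \<Longrightarrow> w n \<in> V\<^sub>S" .
  have f_fe: "tavg ?f i \<in> fe_space \<Omega> \<T>" for i
    using loc_V[OF f] by (intro tavg_fe) (auto simp: V\<^sub>S_iff)
  have loc_vertex: "loc y p = \<Lambda> p * y p" if "p \<in> mesh_vertices \<T>" for y p
    unfolding loc_def using that by (rule nodal_interp_vertex)
  have f_le: "nn (wgt (tavg ?f i)) \<le> nn (tavg f i)" for i
    by (rule nnorm_weighted_localized[OF \<Lambda>]) (auto simp: tavg_def loc_vertex algebra_simps)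
  define G where "G = nn x0 + nn x1 + \<tau>\<^sup>2 * (\<Sum>i=1..N. nn (tavg f (m + i)))"
  have G0: "0 \<le> G" unfolding G_def
    by (intro add_nonneg_nonneg mult_nonneg_nonneg sum_nonneg) (auto simp: nnorm_nonneg)
  let ?q = "growth_const CARD('n)" and ?C = "step_const CARD('n)"
  have q: "1 \<le> ?q ^ N" using growth_const_ge_1 by (rule one_le_power)
  assume n: "n \<in> {m + 1..m + N}" and v: "v \<in> fe_space \<Omega> \<T>"
  define j where "j = n - m"
  have j: "n = m + j" "j \<le> N" "1 \<le> j" using n by (auto simp: j_def)
  have "nn (wgt (w n)) \<le> ?q ^ j * (nn (wgt (w m)) + nn (wgt (w (m + 1)))
        + \<tau>\<^sup>2 * (\<Sum>i=1..j. nn (wgt (tavg ?f (m + i)))))"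
    using weighted_growth[of w m N ?f j] mem[of m] mem[of "m + 1"] w f_fe j n by (simp add: fe_space_Q1)
  also have "\<dots> \<le> ?q ^ N * G"
  proof (rule mult_mono)
    show "?q ^ j \<le> ?q ^ N" using j growth_const_ge_1 by (intro power_increasing)
    have "nn (wgt (w m)) \<le> nn x0" "nn (wgt (w (m + 1))) \<le> nn x1"
      unfolding init
      using nnorm_weighted_localized[of \<Lambda> "loc x0" x0, OF \<Lambda> loc_vertex]
        nnorm_weighted_localized[of \<Lambda> "loc x1" x1, OF \<Lambda> loc_vertex] by simp_all
    moreover have "(\<Sum>i=1..j. nn (wgt (tavg ?f (m + i)))) \<le> (\<Sum>i=1..N. nn (tavg f (m + i)))"
      using j f_le nnorm_nonneg by (intro order.trans[OF sum_mono sum_mono2]) auto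
    ultimately show "nn (wgt (w m)) + nn (wgt (w (m + 1))) + \<tau>\<^sup>2 * (\<Sum>i=1..j. nn (wgt (tavg ?f (m + i)))) \<le> G"
      unfolding G_def by (intro add_mono mult_left_mono) auto
    show "0 \<le> nn (wgt (w m)) + nn (wgt (w (m + 1))) + \<tau>\<^sup>2 * (\<Sum>i=1..j. nn (wgt (tavg ?f (m + i))))"
      by (intro add_nonneg_nonneg mult_nonneg_nonneg sum_nonneg) (auto simp: nnorm_nonneg)
  qed (use q in linarith)
  finally have wn: "nn (wgt (w n)) \<le> ?q ^ N * G" .
  have "\<tau>\<^sup>2 * nn (wgt (tavg ?f n)) \<le> \<tau>\<^sup>2 * (\<Sum>i=1..N. nn (tavg f (m + i)))"
  proof (rule mult_left_mono)
    have "nn (wgt (tavg ?f n)) \<le> nn (tavg f (m + j))" using f_le j by simp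
    also have "\<dots> \<le> (\<Sum>i=1..N. nn (tavg f (m + i)))"
      using j nnorm_nonneg by (intro member_le_sum) auto
    finally show "nn (wgt (tavg ?f n)) \<le> (\<Sum>i=1..N. nn (tavg f (m + i)))" .
  qed simp
  also have "\<dots> \<le> 1 * G" unfolding G_def using nnorm_nonneg by simp
  also have "\<dots> \<le> ?q ^ N * G" using q G0 by (rule mult_right_mono)
  finally have fn: "\<tau>\<^sup>2 * nn (wgt (tavg ?f n)) \<le> ?q ^ N * G" .
  let ?W = "\<lambda>x. w (n + 1) x + 2 * w n x + w (n - 1) x" and ?R = "\<lambda>x. 4 * w n x + \<tau>\<^sup>2 * tavg ?f n x"
  have R: "nn (wgt ?R) \<le> 5 * ?q ^ N * G"
    using weighted_rhs[of "w n" "tavg ?f n"] wn fn by simp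
  have memn: "w (n + 1) \<in> V\<^sub>S" "w n \<in> V\<^sub>S" "w (n - 1) \<in> V\<^sub>S"
  proof -
    have "n + 1 \<in> {m..m + N + 1}" "n \<in> {m..m + N + 1}" "n - 1 \<in> {m..m + N + 1}" using n by auto
    thus "w (n + 1) \<in> V\<^sub>S" "w n \<in> V\<^sub>S" "w (n - 1) \<in> V\<^sub>S" by (blast intro: mem)+
  qed
  note step = weighted_step[of w, OF memn fe_space_Q1[OF f_fe] conjunct2[OF w[OF n]]]
  have "nn (wgt ?W) + nn (wgt ?R) \<le> (?C + 1) * nn (wgt ?R)"
    using step(1) by (simp add: algebra_simps)
  also have "\<dots> \<le> (?C + 1) * (5 * ?q ^ N * G)"
    using R step_const_nonneg[of "CARD('n)"] by (intro mult_left_mono) auto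
  finally have WR: "nn (wgt ?W) + nn (wgt ?R) \<le> (?C + 1) * (5 * ?q ^ N * G)" .
  have "cond_const CARD('n) r \<beta> \<tau> * exp 1 * 2 ^ CARD('n) * exp (- \<mu> * real (Suc l'))
         * (nn (wgt ?W) + nn (wgt ?R)) * nn v / \<tau>\<^sup>2
      \<le> cond_const CARD('n) r \<beta> \<tau> * exp 1 * 2 ^ CARD('n) * exp (- \<mu> * real (Suc l'))
         * ((?C + 1) * (5 * ?q ^ N * G)) * nn v / \<tau>\<^sup>2"
    using WR nnorm_nonneg cond_const_ge_1[of \<tau>]
    by (intro divide_right_mono mult_right_mono mult_left_mono) auto
  also have "\<dots> = local_const CARD('n) r \<beta> \<tau> \<mu> (Suc l') N * G * nn v"
    by (simp add: local_const_def)
  finally show "\<bar>nf mass_entry (dtt \<tau> w n) v + nf (stiff_entry A) (tavg w n) v - nf mass_entry (tavg ?f n) v\<bar>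
      \<le> local_const CARD('n) r \<beta> \<tau> \<mu> (Suc l') N * (nn x0 + nn x1 + \<tau>\<^sup>2 * (\<Sum>i=1..N. nn (tavg f (m + i)))) * nn v"
    using step(2)[OF v] unfolding G_def by linarith
qed

end

end


section \<open>Accumulation of the localization errors\<close>

lemma nform_sum_left: "nform \<E> V M (\<lambda>p. \<Sum>i\<in>I. g i p) y = (\<Sum>i\<in>I. nform \<E> V M (g i) y)"
proof (induction I rule: infinite_finite_induct)
  case (insert i I)
  thus ?case using nform_lincomb_left[of \<E> V M 1 "g i" 1 "\<lambda>p. \<Sum>i\<in>I. g i p" y] by simp
qed simp_all

lemma nform_diff_left: "nform \<E> V M (\<lambda>p. x p - x' p) y = nform \<E> V M x y - nform \<E> V M x' y"
  using nform_lincomb_left[of \<E> V M 1 x "-1" x' y] by simp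

text \<open>The increment factor of \<open>energy_step\<close>, times \<open>2 ^ d\<close> from
  Cauchy-Schwarz for the source, times the factor from the L2 to the nodal norm.\<close>

definition source_const :: "nat \<Rightarrow> real" where
  "source_const d = 1 + 2 * 2 ^ d / mass_const d"

lemma source_const_ge_1: "1 \<le> source_const d"
  by (simp add: source_const_def mass_const_def)

context fe_mesh
begin

lemma global_energy_bound:
  assumes \<tau>: "0 < \<tau>" and f: "\<And>n. f n \<in> fe_space \<Omega> \<T>" and u: "global_cn \<Omega> A \<T> \<tau> f u"
  shows "energy_norm \<Omega> A \<tau> u n
    \<le> source_const CARD('n) * (energy_norm \<Omega> A \<tau> u 0 + (\<Sum>j=1..n. \<tau> * l2_norm \<Omega> (tavg f j)))"
proof -
  have ufe: "u n \<in> fe_space \<Omega> \<T>" for n using u by (simp add: global_cn_def)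
  have ffe: "tavg f n \<in> fe_space \<Omega> \<T>" for n using f by (intro tavg_fe)
  let ?c = "2 * 2 ^ CARD('n) / mass_const CARD('n)"
  have step: "energy_norm \<Omega> A \<tau> u n \<le> energy_norm \<Omega> A \<tau> u (n - 1) + ?c * (\<tau> * l2_norm \<Omega> (tavg f n))"
    if n: "1 \<le> n" for n
  proof -
    have "energy_norm \<Omega> A \<tau> u n
        \<le> energy_norm \<Omega> A \<tau> u (n - 1) + 2 * \<tau> / sqrt (mass_const CARD('n)) * (2 ^ CARD('n) * nn (tavg f n))"
    proof (rule energy_step[OF \<tau> n ufe ufe ufe])
      fix v assume v: "v \<in> fe_space \<Omega> \<T>"
      have "l2_inner \<Omega> (dtt \<tau> u n) v + a_form A \<Omega> (tavg u n) v = nf mass_entry (tavg f n) v"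
        using u n v l2_inner_domain[OF fe_space_Q1[OF ffe] fe_space_Q1[OF v]]
        by (simp add: global_cn_def cn_equation_def)
      moreover have "\<bar>nf mass_entry (tavg f n) v\<bar> \<le> 1 * real (2 ^ CARD('n)) * nn (tavg f n) * nn v"
        using abs_mass_entry by (intro abs_nform_le) auto
      ultimately show "\<bar>l2_inner \<Omega> (dtt \<tau> u n) v + a_form A \<Omega> (tavg u n) v\<bar> \<le> 2 ^ CARD('n) * nn (tavg f n) * nn v"
        by simp
    qed (simp add: nnorm_nonneg)
    also have "2 * \<tau> / sqrt (mass_const CARD('n)) * (2 ^ CARD('n) * nn (tavg f n))
        \<le> 2 * \<tau> / sqrt (mass_const CARD('n)) * (2 ^ CARD('n) * (l2_norm \<Omega> (tavg f n) / sqrt (mass_const CARD('n))))"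
      using \<tau> mass_pos nnorm_le_l2_norm[OF fe_space_Q1[OF ffe]] by (intro mult_left_mono) auto
    also have "\<dots> = ?c * (\<tau> * l2_norm \<Omega> (tavg f n))"
      using mass_pos by simp
    finally show ?thesis by simp
  qed
  have "energy_norm \<Omega> A \<tau> u n \<le> energy_norm \<Omega> A \<tau> u 0 + ?c * (\<Sum>j=1..n. \<tau> * l2_norm \<Omega> (tavg f j))"
  proof (induction n)
    case (Suc n)
    thus ?case using step[of "Suc n"] by (simp add: distrib_left)
  qed simp
  also have "\<dots> \<le> source_const CARD('n) * (energy_norm \<Omega> A \<tau> u 0 + (\<Sum>j=1..n. \<tau> * l2_norm \<Omega> (tavg f j)))"
  proof -
    have "0 \<le> ?c * energy_norm \<Omega> A \<tau> u 0" "0 \<le> (\<Sum>j=1..n. \<tau> * l2_norm \<Omega> (tavg f j))"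
      using \<tau> mass_pos l2_norm_nonneg energy_norm_nonneg by (auto intro!: sum_nonneg)
    thus ?thesis by (simp add: source_const_def algebra_simps)
  qed
  finally show ?thesis .
qed

section \<open>Superposition over all coarse vertices\<close>

context
  fixes \<T>H :: "(real ^ 'n) set set" and l' :: nat and \<tau> \<mu> :: real
  assumes coarse: "para_mesh \<T>H" "\<Union>\<T>H = closure \<Omega>" and \<tau>: "0 < \<tau>" and \<mu>: "0 \<le> \<mu>" "\<mu> \<le> 1"
    and small: "(cosh \<mu> - 1) * cond_const CARD('n) r \<beta> \<tau> * real (2 ^ CARD('n)) \<le> mass_const CARD('n) / 2"
begin

interpretation coarse: para_mesh \<T>H by (rule coarse(1))

lemma coarse_basis_support: "closure (supp (nodal_basis \<T>H z)) \<subseteq> closure \<Omega>"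
proof -
  have "{x. nodal_basis \<T>H z x \<noteq> 0} \<subseteq> closure \<Omega>"
    using coarse.nodal_interp_in_Q1_space coarse(2) by (auto simp: nodal_basis_def Q1_space_def)
  thus ?thesis
    unfolding supp_def by (simp add: closure_minimal)
qed

text \<open>Between two resets the superposed functions solve the global scheme up to the sum of the
  local residuals: localized data and sources add up exactly to the original ones at the fine
  vertices, and the equation of \<open>u\<close> cancels the source.\<close>

lemma segment_residual:
  assumes f: "\<And>n. f n \<in> fe_space \<Omega> \<T>" and u: "global_cn \<Omega> A \<T> \<tau> f u"
    and ub: "ub m \<in> fe_space \<Omega> \<T>" "ub (m + 1) \<in> fe_space \<Omega> \<T>"
    and w: "\<And>z. z \<in> mesh_vertices \<T>H \<Longrightarrow>
        w z m = nodal_interp \<T> (\<lambda>x. nodal_basis \<T>H z x * ub m x) \<and>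
        w z (m + 1) = nodal_interp \<T> (\<lambda>x. nodal_basis \<T>H z x * ub (m + 1) x) \<and>
        (\<forall>n\<in>{m + 1..m + N}. w z (n + 1) \<in> fe_space_on \<Omega> \<T> (patches \<T> (Suc l') (supp (nodal_basis \<T>H z))) \<and>
          cn_equation A \<tau> (patches \<T> (Suc l') (supp (nodal_basis \<T>H z)))
            (fe_space_on \<Omega> \<T> (patches \<T> (Suc l') (supp (nodal_basis \<T>H z))))
            (\<lambda>j. nodal_interp \<T> (\<lambda>x. nodal_basis \<T>H z x * f j x)) (w z) n)"
    and ub_sum: "\<And>n. n \<in> {m + 2..m + N + 1} \<Longrightarrow> ub n = (\<lambda>x. \<Sum>z\<in>mesh_vertices \<T>H. w z n x)"
  shows "n \<in> {m..m + N + 1} \<Longrightarrow> ub n \<in> fe_space \<Omega> \<T>"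
    and "n \<in> {m + 1..m + N} \<Longrightarrow> v \<in> fe_space \<Omega> \<T> \<Longrightarrow>
      \<bar>l2_inner \<Omega> (dtt \<tau> (\<lambda>j x. ub j x - u j x) n) v + a_form A \<Omega> (tavg (\<lambda>j x. ub j x - u j x) n) v\<bar>
      \<le> real (card (mesh_vertices \<T>H)) * (local_const CARD('n) r \<beta> \<tau> \<mu> (Suc l') N
          * (nn (ub m) + nn (ub (m + 1)) + \<tau>\<^sup>2 * (\<Sum>i=1..N. nn (tavg f (m + i))))) * nn v"
proof -
  let ?VH = "mesh_vertices \<T>H"
  define loc where "loc z y = nodal_interp \<T> (\<lambda>x. nodal_basis \<T>H z x * y x)" for z and y :: "real ^ 'n \<Rightarrow> real"
  have supp: "nodal_basis \<T>H z x \<noteq> 0 \<Longrightarrow> x \<in> closure (supp (nodal_basis \<T>H z))" for z x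
    unfolding supp_def by (intro subsetD[OF closure_subset]) simp
  have w_mem: "w z n \<in> fe_space \<Omega> \<T>" if "z \<in> ?VH" "n \<in> {m..m + N + 1}" for z n
  proof -
    have "w z n \<in> fe_space_on \<Omega> \<T> (patches \<T> (Suc l') (supp (nodal_basis \<T>H z)))"
      using local_residual(1)[where \<omega> = "supp (nodal_basis \<T>H z)" and \<Lambda> = "nodal_basis \<T>H z" and l' = l'
        and w = "w z" and m = m and N = N and f = f and n = n,
        OF coarse_basis_support \<tau> \<mu> small coarse.nodal_basis_bounds supp ub] w[OF that(1)] f that(2) by blast
    thus ?thesis by (simp add: fe_space_on_def)
  qed
  have partition: "(\<Sum>z\<in>?VH. loc z y p) = y p" if "p \<in> mesh_vertices \<T>" for y p
  proof -
    have "p \<in> \<Union>\<T>H"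
      using that verts_subset[OF para] cover coarse(2) by (auto simp: mesh_vertices_eq)
    thus ?thesis
      using coarse.sum_nodal_basis[of p] that
      by (simp add: loc_def nodal_interp_vertex flip: sum_distrib_right)
  qed
  \<comment> \<open>Interpolation disturbs the partition of unity nowhere, because a function of the
    fine space is determined by its nodal values.\<close>
  have loc_sum: "(\<lambda>x. \<Sum>z\<in>?VH. loc z y x) = y" if "y \<in> fe_space \<Omega> \<T>" for y
  proof (rule Q1_space_eqI)
    show "(\<lambda>x. \<Sum>z\<in>?VH. loc z y x) \<in> Q1_space \<T>"
      unfolding loc_def using that by (intro fe_space_Q1 fe_space_sum nodal_interp_mult_in_fe_space)
  qed (use that partition in \<open>auto simp: fe_space_Q1\<close>)
  have ub_all: "ub n = (\<lambda>x. \<Sum>z\<in>?VH. w z n x)" if n: "n \<in> {m..m + N + 1}" for n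
  proof -
    have "n = m \<or> n = m + 1 \<or> n \<in> {m + 2..m + N + 1}" using n by auto
    moreover have "(\<lambda>x. \<Sum>z\<in>?VH. w z m x) = ub m"
      using loc_sum[OF ub(1)] w by (simp add: loc_def cong: sum.cong)
    moreover have "(\<lambda>x. \<Sum>z\<in>?VH. w z (m + 1) x) = ub (m + 1)"
      using loc_sum[OF ub(2)] w by (simp add: loc_def cong: sum.cong)
    ultimately show ?thesis using ub_sum by metis
  qed
  show ub_fe: "ub n \<in> fe_space \<Omega> \<T>" if "n \<in> {m..m + N + 1}" for n
    unfolding ub_all[OF that] using w_mem that by (intro fe_space_sum) auto
  assume n: "n \<in> {m + 1..m + N}" and v: "v \<in> fe_space \<Omega> \<T>"
  let ?e = "\<lambda>j x. ub j x - u j x"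
  have range: "n + 1 \<in> {m..m + N + 1}" "n \<in> {m..m + N + 1}" "n - 1 \<in> {m..m + N + 1}" using n by auto
  have ufe: "u n \<in> fe_space \<Omega> \<T>" for n using u by (simp add: global_cn_def)
  have efe: "?e j \<in> fe_space \<Omega> \<T>" if "j \<in> {m..m + N + 1}" for j
    using fe_space_lincomb[OF ub_fe[OF that] ufe, of 1 "-1" j] by simp
  have dtt_e: "dtt \<tau> ?e n = (\<lambda>p. (\<Sum>z\<in>?VH. dtt \<tau> (w z) n p) - dtt \<tau> u n p)"
    unfolding dtt_def ub_all[OF range(1)] ub_all[OF range(2)] ub_all[OF range(3)]
    by (auto simp: fun_eq_iff sum_subtractf sum.distrib sum_distrib_left sum_divide_distrib[symmetric]
          algebra_simps diff_divide_distrib add_divide_distrib)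
  have tavg_e: "tavg ?e n = (\<lambda>p. (\<Sum>z\<in>?VH. tavg (w z) n p) - tavg u n p)"
    unfolding tavg_def ub_all[OF range(1)] ub_all[OF range(2)] ub_all[OF range(3)]
    by (auto simp: fun_eq_iff sum_subtractf sum.distrib sum_distrib_left sum_divide_distrib[symmetric]
          algebra_simps diff_divide_distrib add_divide_distrib)
  have rhs: "nf mass_entry (tavg f n) v = (\<Sum>z\<in>?VH. nf mass_entry (tavg (\<lambda>j. loc z (f j)) n) v)"
  proof -
    have "(\<Sum>z\<in>?VH. tavg (\<lambda>j. loc z (f j)) n p) = tavg f n p" if "p \<in> mesh_vertices \<T>" for p
      using partition[OF that]
      by (simp add: tavg_def sum.distrib sum_divide_distrib[symmetric] flip: sum_distrib_left)
    hence "nf mass_entry (tavg f n) v = nf mass_entry (\<lambda>p. \<Sum>z\<in>?VH. tavg (\<lambda>j. loc z (f j)) n p) v"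
      by (intro nform_cong) (metis UN_I mesh_vertices_eq, rule refl)
    thus ?thesis by (simp add: nform_sum_left)
  qed
  have glob: "nf mass_entry (dtt \<tau> u n) v + nf (stiff_entry A) (tavg u n) v = nf mass_entry (tavg f n) v"
  proof -
    have "1 \<le> n" using n by simp
    hence "l2_inner \<Omega> (dtt \<tau> u n) v + a_form A \<Omega> (tavg u n) v = l2_inner \<Omega> (tavg f n) v"
      using u v by (simp add: global_cn_def cn_equation_def)
    thus ?thesis
      using v f ufe by (simp add: l2_inner_domain a_form_domain fe_space_Q1 dtt_fe tavg_fe)
  qed
  define res where "res z = nf mass_entry (dtt \<tau> (w z) n) v + nf (stiff_entry A) (tavg (w z) n) v
      - nf mass_entry (tavg (\<lambda>j. loc z (f j)) n) v" for z
  define G where "G = local_const CARD('n) r \<beta> \<tau> \<mu> (Suc l') N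
          * (nn (ub m) + nn (ub (m + 1)) + \<tau>\<^sup>2 * (\<Sum>i=1..N. nn (tavg f (m + i))))"
  have "l2_inner \<Omega> (dtt \<tau> ?e n) v + a_form A \<Omega> (tavg ?e n) v
      = nf mass_entry (dtt \<tau> ?e n) v + nf (stiff_entry A) (tavg ?e n) v"
    using dtt_fe[of ?e, OF efe efe efe] tavg_fe[of ?e, OF efe efe efe] range v
    by (simp add: l2_inner_domain a_form_domain fe_space_Q1)
  also have "\<dots> = (\<Sum>z\<in>?VH. res z)"
    unfolding dtt_e tavg_e nform_diff_left nform_sum_left res_def sum_subtractf sum.distrib
    using glob rhs by simp
  also have "\<bar>\<dots>\<bar> \<le> (\<Sum>z\<in>?VH. G * nn v)"
  proof (intro order.trans[OF sum_abs] sum_mono)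
    fix z assume z: "z \<in> ?VH"
    show "\<bar>res z\<bar> \<le> G * nn v"
      unfolding res_def G_def loc_def using local_residual(2)[where \<omega> = "supp (nodal_basis \<T>H z)" and \<Lambda> = "nodal_basis \<T>H z" and l' = l'
        and w = "w z" and m = m and N = N and f = f and n = n and v = v,
        OF coarse_basis_support \<tau> \<mu> small coarse.nodal_basis_bounds supp ub] w[OF z] f n v
      by blast
  qed
  finally show "\<bar>l2_inner \<Omega> (dtt \<tau> ?e n) v + a_form A \<Omega> (tavg ?e n) v\<bar> \<le> real (card ?VH) * G * nn v"
    by simp
qed

text \<open>The data of an interval are those of \<open>u\<close> plus the error accumulated so far.
  Hence each step adds at most \<open>\<epsilon> * (E m + Y)\<close>, and \<open>E + Y\<close> is
  multiplied by at most \<open>1 + real nres * \<epsilon>\<close> between resets, starting from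
  \<open>Y\<close>.\<close>

lemma local_superposition_error:
  assumes R: "closure \<Omega> \<subseteq> cball c R" "0 \<le> R"
    and f: "\<And>n. f n \<in> fe_space \<Omega> \<T>" and u: "global_cn \<Omega> A \<T> \<tau> f u"
    and ls: "local_superposition \<Omega> A \<T>H \<T> \<tau> nres nper (Suc l') f (u 0) (u 1) ub"
    and n: "n \<le> nper * nres"
  defines "F \<equiv> energy_norm \<Omega> A \<tau> u 0 + (\<Sum>j=1..nper * nres. \<tau> * l2_norm \<Omega> (tavg f j))"
  defines "\<epsilon> \<equiv> 2 * \<tau> / sqrt (mass_const CARD('n)) * (real (card (mesh_vertices \<T>H))
    * (local_const CARD('n) r \<beta> \<tau> \<mu> (Suc l') nres * data_const CARD('n) r \<alpha> h R \<tau>))"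
  shows "energy_norm \<Omega> A \<tau> (\<lambda>j x. ub j x - u j x) n
    \<le> ((1 + real nres * \<epsilon>) ^ nper - 1) * ((source_const CARD('n) + 1) * F)"
proof -
  let ?e = "\<lambda>j x. ub j x - u j x" and ?VH = "mesh_vertices \<T>H"
  define E where "E i = energy_norm \<Omega> A \<tau> ?e i" for i
  \<comment> \<open>\<open>source_const\<close> times \<open>F\<close> bounds the energy of
    \<open>u\<close> at all times, and one further \<open>F\<close> the source terms of an
    interval.\<close>
  define Y where "Y = (source_const CARD('n) + 1) * F"
  define L where "L = local_const CARD('n) r \<beta> \<tau> \<mu> (Suc l') nres"
  define P where "P = data_const CARD('n) r \<alpha> h R \<tau>"
  define N where "N = nper * nres"
  have L0: "0 \<le> L"
    using order.trans[OF zero_le_one cond_const_ge_1[of \<tau>]] step_const_nonneg[of "CARD('n)"]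
      order.trans[OF zero_le_one growth_const_ge_1[of "CARD('n)"]]
    unfolding L_def local_const_def using \<tau> by (intro divide_nonneg_nonneg mult_nonneg_nonneg zero_le_power) auto
  have P_ge: "\<tau> / sqrt (mass_const CARD('n)) \<le> P" and P0: "0 \<le> P"
  proof -
    have "0 \<le> sqrt (2 ^ CARD('n) * (R / r) ^ CARD('n) / (\<alpha> * mass_const CARD('n))) * (R / r) ^ CARD('n)
        * (2 * real CARD('n) * h)"
      using R r_pos h_pos alpha_pos mass_pos by simp
    thus "\<tau> / sqrt (mass_const CARD('n)) \<le> P" by (simp add: P_def data_const_def)
    moreover have "0 \<le> \<tau> / sqrt (mass_const CARD('n))" using \<tau> mass_pos by simp
    ultimately show "0 \<le> P" by linarith
  qed
  have F0: "0 \<le> F"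
    unfolding F_def using \<tau> energy_norm_nonneg l2_norm_nonneg by (intro add_nonneg_nonneg sum_nonneg) auto
  have E0: "0 \<le> E i" for i by (simp add: E_def energy_norm_nonneg)
  have Y0: "0 \<le> Y" using F0 source_const_ge_1[of "CARD('n)"] by (simp add: Y_def)
  have eps0: "0 \<le> \<epsilon>"
    unfolding \<epsilon>_def L_def[symmetric] P_def[symmetric] using \<tau> mass_pos L0 P0 by simp
  have ufe: "u i \<in> fe_space \<Omega> \<T>" for i using u by (simp add: global_cn_def)
  have ffe: "tavg f i \<in> fe_space \<Omega> \<T>" for i using f by (intro tavg_fe)
  have Eu: "energy_norm \<Omega> A \<tau> u i \<le> source_const CARD('n) * F" if "i \<le> N" for i
  proof -
    have "(\<Sum>j=1..i. \<tau> * l2_norm \<Omega> (tavg f j)) \<le> (\<Sum>j=1..N. \<tau> * l2_norm \<Omega> (tavg f j))"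
      using that \<tau> l2_norm_nonneg by (intro sum_mono2) auto
    hence "source_const CARD('n) * (energy_norm \<Omega> A \<tau> u 0 + (\<Sum>j=1..i. \<tau> * l2_norm \<Omega> (tavg f j)))
        \<le> source_const CARD('n) * F"
      using source_const_ge_1[of "CARD('n)"] unfolding F_def N_def by (intro mult_left_mono) auto
    thus ?thesis using global_energy_bound[OF \<tau> f u, of i] by linarith
  qed
  obtain w where w: "\<And>k z. k < nper \<Longrightarrow> z \<in> ?VH \<Longrightarrow>
        w k z (k * nres) = nodal_interp \<T> (\<lambda>x. nodal_basis \<T>H z x * ub (k * nres) x) \<and>
        w k z (k * nres + 1) = nodal_interp \<T> (\<lambda>x. nodal_basis \<T>H z x * ub (k * nres + 1) x) \<and>
        (\<forall>n\<in>{k * nres + 1..k * nres + nres}.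
          w k z (n + 1) \<in> fe_space_on \<Omega> \<T> (patches \<T> (Suc l') (supp (nodal_basis \<T>H z))) \<and>
          cn_equation A \<tau> (patches \<T> (Suc l') (supp (nodal_basis \<T>H z)))
            (fe_space_on \<Omega> \<T> (patches \<T> (Suc l') (supp (nodal_basis \<T>H z))))
            (\<lambda>j. nodal_interp \<T> (\<lambda>x. nodal_basis \<T>H z x * f j x)) (w k z) n)"
    and ub_sum: "\<And>k n. k < nper \<Longrightarrow> n \<in> {k * nres + 2..k * nres + nres + 1} \<Longrightarrow>
        ub n = (\<lambda>x. \<Sum>z\<in>?VH. w k z n x)"
    using ls unfolding local_superposition_def Let_def by blast
  have segment: "(\<forall>i\<in>{m..m + nres + 1}. ub i \<in> fe_space \<Omega> \<T>) \<and>
      (\<forall>j\<le>nres. E (m + j) \<le> E m + real j * (\<epsilon> * (E m + Y)))"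
    if k: "k < nper" and m: "m = k * nres" and ub: "ub m \<in> fe_space \<Omega> \<T>" "ub (m + 1) \<in> fe_space \<Omega> \<T>" for k m
  proof -
    note res = segment_residual[OF f u ub, where w = "w k" and N = nres]
    have ub_fe: "ub i \<in> fe_space \<Omega> \<T>" if "i \<in> {m..m + nres + 1}" for i
      using w[OF k] ub_sum[OF k] that unfolding m by (intro res(1)[unfolded m]) auto
    have mN: "m + nres \<le> N"
    proof -
      have "(k + 1) * nres \<le> nper * nres" using k by (intro mult_right_mono) auto
      thus ?thesis by (simp add: m N_def)
    qed
    have efe: "?e i \<in> fe_space \<Omega> \<T>" if "i \<in> {m..m + nres + 1}" for i
      using fe_space_lincomb[OF ub_fe[OF that] ufe, of 1 "-1" i] by simp
    define G where "G = nn (ub m) + nn (ub (m + 1)) + \<tau>\<^sup>2 * (\<Sum>i=1..nres. nn (tavg f (m + i)))"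
    have G: "G \<le> P * (E m + Y)"
    proof -
      have tri: "nn (ub i) \<le> nn (?e i) + nn (u i)" for i
        using nnorm_triangle[of "?e i" "u i"] by simp
      have "nn (?e m) + nn (?e (m + 1)) \<le> P * E m"
        unfolding P_def E_def by (rule data_bound[of c R \<tau> ?e m, OF R \<tau>]) (rule efe, simp)+
      moreover have "nn (u m) + nn (u (m + 1)) \<le> P * energy_norm \<Omega> A \<tau> u m"
        unfolding P_def by (rule data_bound[OF R \<tau> ufe ufe])
      moreover have "P * energy_norm \<Omega> A \<tau> u m \<le> P * (source_const CARD('n) * F)"
        using Eu[of m] mN P0 by (intro mult_left_mono) auto
      moreover have "\<tau>\<^sup>2 * (\<Sum>i=1..nres. nn (tavg f (m + i))) \<le> P * F"
      proof -
        have "(\<Sum>i=1..nres. nn (tavg f (m + i))) \<le> (\<Sum>i=1..nres. l2_norm \<Omega> (tavg f (m + i)) / sqrt (mass_const CARD('n)))"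
          by (intro sum_mono nnorm_le_l2_norm fe_space_Q1 ffe)
        hence "\<tau>\<^sup>2 * (\<Sum>i=1..nres. nn (tavg f (m + i)))
            \<le> \<tau>\<^sup>2 * (\<Sum>i=1..nres. l2_norm \<Omega> (tavg f (m + i)) / sqrt (mass_const CARD('n)))"
          by (rule mult_left_mono) simp
        also have "\<dots> = \<tau> / sqrt (mass_const CARD('n)) * (\<Sum>i=1..nres. \<tau> * l2_norm \<Omega> (tavg f (m + i)))"
          by (simp add: sum_distrib_left power2_eq_square mult_ac)
        also have "(\<Sum>i=1..nres. \<tau> * l2_norm \<Omega> (tavg f (m + i))) = (\<Sum>j\<in>(+) m ` {1..nres}. \<tau> * l2_norm \<Omega> (tavg f j))"
          by (subst sum.reindex) (auto simp: o_def)
        also have "\<tau> / sqrt (mass_const CARD('n)) * \<dots> \<le> P * F"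
        proof (rule mult_mono[OF P_ge _ P0])
          have "(\<Sum>j\<in>(+) m ` {1..nres}. \<tau> * l2_norm \<Omega> (tavg f j)) \<le> (\<Sum>j=1..N. \<tau> * l2_norm \<Omega> (tavg f j))"
            using mN \<tau> l2_norm_nonneg by (intro sum_mono2) auto
          thus "(\<Sum>j\<in>(+) m ` {1..nres}. \<tau> * l2_norm \<Omega> (tavg f j)) \<le> F"
            unfolding F_def N_def using energy_norm_nonneg[of \<tau> u 0] by linarith
        qed (use \<tau> l2_norm_nonneg in \<open>auto intro!: sum_nonneg\<close>)
        finally show ?thesis .
      qed
      ultimately have "G \<le> P * E m + P * (source_const CARD('n) * F) + P * F"
        unfolding G_def using tri[of m] tri[of "m + 1"] by linarith
      thus ?thesis by (simp add: Y_def algebra_simps)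
    qed
    have G0: "0 \<le> G" unfolding G_def
      by (intro add_nonneg_nonneg mult_nonneg_nonneg sum_nonneg) (auto simp: nnorm_nonneg)
    have step: "E i \<le> E (i - 1) + \<epsilon> * (E m + Y)" if i: "i \<in> {m + 1..m + nres}" for i
    proof -
      have range: "1 \<le> i" "i + 1 \<in> {m..m + nres + 1}" "i \<in> {m..m + nres + 1}" "i - 1 \<in> {m..m + nres + 1}"
        using i by auto
      have "E i \<le> E (i - 1) + 2 * \<tau> / sqrt (mass_const CARD('n)) * (real (card ?VH) * (L * G))"
        unfolding E_def
      proof (rule energy_step[OF \<tau> range(1)])
        fix v assume "v \<in> fe_space \<Omega> \<T>"
        thus "\<bar>l2_inner \<Omega> (dtt \<tau> ?e i) v + a_form A \<Omega> (tavg ?e i) v\<bar> \<le> real (card ?VH) * (L * G) * nn v"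
          unfolding L_def G_def using w[OF k] ub_sum[OF k] i unfolding m by (intro res(2)[unfolded m]) auto
      qed (use efe[OF range(2)] efe[OF range(3)] efe[OF range(4)] L0 G0 in auto)
      also have "2 * \<tau> / sqrt (mass_const CARD('n)) * (real (card ?VH) * (L * G))
          \<le> 2 * \<tau> / sqrt (mass_const CARD('n)) * (real (card ?VH) * (L * (P * (E m + Y))))"
        using G \<tau> mass_pos L0 by (intro mult_left_mono) auto
      also have "\<dots> = \<epsilon> * (E m + Y)"
        by (simp add: \<epsilon>_def L_def P_def)
      finally show ?thesis by simp
    qed
    have "E (m + j) \<le> E m + real j * (\<epsilon> * (E m + Y))" if "j \<le> nres" for j
      using that
    proof (induction j)
      case (Suc j)
      thus ?case using step[of "m + Suc j"] by (simp add: distrib_right)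
    qed simp
    thus ?thesis using ub_fe by blast
  qed
  have main: "ub (k * nres) \<in> fe_space \<Omega> \<T> \<and> ub (k * nres + 1) \<in> fe_space \<Omega> \<T> \<and>
      (\<forall>i\<le>k * nres. E i + Y \<le> (1 + real nres * \<epsilon>) ^ k * Y)" if "k \<le> nper" for k
    using that
  proof (induction k)
    case 0
    have init: "ub 0 = u 0" "ub 1 = u 1" using ls by (simp_all add: local_superposition_def)
    \<comment> \<open>Both methods share their values at steps 0 and 1, which is all that the first
      half step sees.\<close>
    have "half_diff \<tau> ?e 0 = (\<lambda>x. 0)" "half_step ?e 0 = (\<lambda>x. 0)"
      using init by (simp_all add: half_diff_def half_step_def)
    hence "E 0 = 0"
      by (simp add: E_def energy_norm_def l2_norm_def a_norm_def l2_inner_domain a_form_domain zero_in_Q1_space)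
    thus ?case using init ufe by simp
  next
    case (Suc k)
    define m where "m = k * nres"
    have IH: "ub m \<in> fe_space \<Omega> \<T>" "ub (m + 1) \<in> fe_space \<Omega> \<T>"
      "\<And>i. i \<le> m \<Longrightarrow> E i + Y \<le> (1 + real nres * \<epsilon>) ^ k * Y"
      using Suc by (auto simp: m_def)
    note seg = segment[OF _ m_def IH(1,2)]
    have "E i + Y \<le> (1 + real nres * \<epsilon>) ^ Suc k * Y" if i: "i \<le> Suc k * nres" for i
    proof (cases "i \<le> m")
      case True
      have "E i + Y \<le> (1 + real nres * \<epsilon>) ^ k * Y" using IH(3) True .
      also have "\<dots> \<le> (1 + real nres * \<epsilon>) ^ Suc k * Y"
        using eps0 Y0 by (intro mult_right_mono power_increasing) auto
      finally show ?thesis .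
    next
      case False
      define j where "j = i - m"
      have j: "i = m + j" "j \<le> nres" using False i by (auto simp: j_def m_def)
      have "E i \<le> E m + real j * (\<epsilon> * (E m + Y))"
        using seg Suc.prems j by auto
      also have "\<dots> \<le> E m + real nres * (\<epsilon> * (E m + Y))"
        using j eps0 E0[of m] Y0 by (intro add_left_mono mult_right_mono) auto
      finally have "E i + Y \<le> (1 + real nres * \<epsilon>) * (E m + Y)" by (simp add: algebra_simps)
      also have "\<dots> \<le> (1 + real nres * \<epsilon>) * ((1 + real nres * \<epsilon>) ^ k * Y)"
        using IH(3)[of m] eps0 by (intro mult_left_mono) auto
      finally show ?thesis by (simp add: mult.assoc)
    qed
    moreover have "Suc k * nres = m + nres" by (simp add: m_def)
    \<comment> \<open>A restart needs two values, so the interval has to reach one step beyond the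
      reset time.\<close>
    moreover have "ub (m + nres) \<in> fe_space \<Omega> \<T>" "ub (m + nres + 1) \<in> fe_space \<Omega> \<T>"
      using seg Suc.prems by auto
    ultimately show ?case by metis
  qed
  have "E n + Y \<le> (1 + real nres * \<epsilon>) ^ nper * Y"
    using main[of nper] n by simp
  thus ?thesis by (simp add: E_def Y_def algebra_simps)
qed

end

end


section \<open>Choice of the parameters\<close>

lemma para_mesh_of: "mesh_of \<Omega> \<T> \<Longrightarrow> para_mesh \<T>"
  unfolding mesh_of_def by unfold_locales auto

lemma mesh_size_ge: "mesh_of \<Omega> \<T> \<Longrightarrow> K \<in> \<T> \<Longrightarrow> diameter K \<le> mesh_size \<T>"
  unfolding mesh_of_def mesh_size_def by (intro Max_ge) auto

text \<open>One factor \<open>\<gamma>\<close> passes from the mesh size to the diameter of an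
  element, the other from there to the radius of an inscribed ball.\<close>

lemma ball_mesh_of:
  fixes \<Omega> :: "(real ^ 'n) set"
  assumes mesh: "mesh_of \<Omega> \<T>" and ne: "\<Omega> \<noteq> {}" and reg: "mesh_regular \<gamma> \<T>" and \<gamma>: "0 < \<gamma>"
  shows "0 < mesh_size \<T>" and "ball_mesh \<T> (mesh_size \<T> / \<gamma>\<^sup>2)"
proof -
  interpret para_mesh \<T> using mesh by (rule para_mesh_of)
  obtain K where K: "K \<in> \<T>"
    using mesh ne unfolding mesh_of_def by (metis Union_empty closure_eq_empty ex_in_conv)
  then obtain x \<rho> where \<rho>: "0 < \<rho>" "cball x \<rho> \<subseteq> K"
    using reg unfolding mesh_regular_def by blast
  have "diameter (cball x \<rho>) \<le> diameter K"
    using \<rho> compact_imp_bounded[OF compact_elem[OF para[OF K]]] by (intro diameter_subset)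
  hence "0 < diameter K" using \<rho> by simp
  thus pos: "0 < mesh_size \<T>" using mesh_size_ge[OF mesh K] by linarith
  show "ball_mesh \<T> (mesh_size \<T> / \<gamma>\<^sup>2)"
  proof unfold_locales
    show "0 < mesh_size \<T> / \<gamma>\<^sup>2" using pos \<gamma> by simp
    fix K assume K: "K \<in> \<T>"
    then obtain x \<rho> where \<rho>: "0 < \<rho>" "cball x \<rho> \<subseteq> K" "diameter K \<le> \<gamma> * \<rho>" "mesh_size \<T> \<le> \<gamma> * diameter K"
      using reg unfolding mesh_regular_def by blast
    have "mesh_size \<T> \<le> \<gamma> * (\<gamma> * \<rho>)"
      using \<rho> \<gamma> by (meson mult_left_mono order.strict_implies_order order.trans)
    hence "mesh_size \<T> / \<gamma>\<^sup>2 \<le> \<rho>" using \<gamma> by (simp add: divide_le_eq power2_eq_square mult_ac)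
    thus "\<exists>c. cball c (mesh_size \<T> / \<gamma>\<^sup>2) \<subseteq> K" using \<rho>(2) by (meson subset_cball order.trans)
  qed
qed

lemma mesh_size_refines:
  assumes h: "mesh_of \<Omega> \<T>h" and H: "mesh_of \<Omega> \<T>H" and ne: "\<Omega> \<noteq> {}" and ref: "mesh_refines \<T>h \<T>H"
  shows "mesh_size \<T>h \<le> mesh_size \<T>H"
proof -
  interpret H: para_mesh \<T>H using H by (rule para_mesh_of)
  have "\<T>h \<noteq> {}" "finite \<T>h"
    using h ne unfolding mesh_of_def by (metis Union_empty closure_eq_empty, blast)
  hence "mesh_size \<T>h \<in> diameter ` \<T>h" unfolding mesh_size_def by (intro Max_in) auto
  then obtain K where K: "K \<in> \<T>h" "mesh_size \<T>h = diameter K" by blast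
  then obtain K' where K': "K' \<in> \<T>H" "K \<subseteq> K'" using ref by (auto simp: mesh_refines_def)
  have "diameter K \<le> diameter K'"
    using K'(2) compact_imp_bounded[OF compact_elem[OF H.para[OF K'(1)]]] by (rule diameter_subset)
  thus ?thesis using mesh_size_ge[OF H K'(1)] K by linarith
qed

text \<open>\<open>cond_const\<close> with inscribed radius \<open>h / \<gamma>\<^sup>2\<close>,
  after taking out the square of \<open>X\<close>, the larger of \<open>\<tau> / h\<close> and
  \<open>h / \<tau>\<close>.\<close>

definition kappa_const :: "nat \<Rightarrow> real \<Rightarrow> real \<Rightarrow> real" where
  "kappa_const d \<beta> \<gamma> = 1 + \<beta> * (real d * \<gamma>\<^sup>2)\<^sup>2 / 16"

text \<open>The second entry solves the smallness condition of the weighted coercivity with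
  \<open>\<mu>\<^sup>2\<close> in place of \<open>cosh \<mu> - 1\<close>; the first keeps the rate
  in the range where this replacement is valid.\<close>

definition rate_const :: "nat \<Rightarrow> real \<Rightarrow> real \<Rightarrow> real" where
  "rate_const d \<beta> \<gamma> = min 1 (sqrt (mass_const d / (2 * 2 ^ d * kappa_const d \<beta> \<gamma>)))"

text \<open>What remains of \<open>data_const\<close> after taking out \<open>X\<close> and the
  power \<open>2 * d\<close> of \<open>1 / h\<close>; \<open>\<delta>\<close> serves as the radius
  of a ball around the domain.\<close>

definition domain_const :: "nat \<Rightarrow> real \<Rightarrow> real \<Rightarrow> real \<Rightarrow> real" where
  "domain_const d \<alpha> \<gamma> \<delta> = 4 * real d * (1 + 2 ^ d * (\<delta> * \<gamma>\<^sup>2) ^ d / (\<alpha> * mass_const d)) * (\<delta> * \<gamma>\<^sup>2) ^ d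
     + 1 / sqrt (mass_const d)"

text \<open>The part of the error factor per time step that depends neither on the mesh sizes nor on
  the time step.\<close>

definition total_const :: "nat \<Rightarrow> real \<Rightarrow> real \<Rightarrow> real \<Rightarrow> real \<Rightarrow> real" where
  "total_const d \<alpha> \<beta> \<gamma> \<delta> = 2 / sqrt (mass_const d) * (2 ^ d * (\<delta> * \<gamma>\<^sup>2) ^ d)
     * (kappa_const d \<beta> \<gamma> * exp 1 * 2 ^ d * ((step_const d + 1) * 5)) * domain_const d \<alpha> \<gamma> \<delta>"

section \<open>Explicit dependence of the constants on mesh size and time step\<close>

context
  fixes d :: nat and \<alpha> \<beta> \<gamma> \<delta> :: real
  assumes d: "0 < d" and \<alpha>: "0 < \<alpha>" and \<beta>: "0 < \<beta>" and \<gamma>: "0 < \<gamma>" and \<delta>: "0 < \<delta>"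
begin

lemma kappa_ge_1: "1 \<le> kappa_const d \<beta> \<gamma>"
  using \<beta> by (simp add: kappa_const_def)

lemma rate_pos: "0 < rate_const d \<beta> \<gamma>"
  using kappa_ge_1 mass_const_pos[OF d] by (simp add: rate_const_def)

lemma rate_sq: "(rate_const d \<beta> \<gamma>)\<^sup>2 * kappa_const d \<beta> \<gamma> * 2 ^ d \<le> mass_const d / 2"
proof -
  have "(rate_const d \<beta> \<gamma>)\<^sup>2 \<le> (sqrt (mass_const d / (2 * 2 ^ d * kappa_const d \<beta> \<gamma>)))\<^sup>2"
    using rate_pos by (intro power_mono) (auto simp: rate_const_def)
  also have "\<dots> = mass_const d / (2 * 2 ^ d * kappa_const d \<beta> \<gamma>)"
    using kappa_ge_1 mass_const_pos[OF d] by simp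
  finally show ?thesis
    using kappa_ge_1 by (simp add: field_simps)
qed

lemma domain_const_pos: "0 < domain_const d \<alpha> \<gamma> \<delta>"
  using \<alpha> \<gamma> \<delta> mass_const_pos[OF d] unfolding domain_const_def
  by (intro add_nonneg_pos mult_nonneg_nonneg) (auto intro!: add_nonneg_nonneg)

lemma total_const_pos: "0 < total_const d \<alpha> \<beta> \<gamma> \<delta>"
  unfolding total_const_def using \<gamma> \<delta> mass_const_pos[OF d] kappa_ge_1 step_const_nonneg[of d] domain_const_pos
  by (intro mult_pos_pos divide_pos_pos add_nonneg_pos) auto

context
  fixes \<tau> h X :: real
  assumes \<tau>: "0 < \<tau>" and h: "0 < h" "h < 1" and X: "X = max (\<tau> / h) (h / \<tau>)"
begin

lemma X_bounds: "1 \<le> X" "\<tau> \<le> X * h" "1 / \<tau> \<le> X / h"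
proof -
  have "\<tau> / h \<le> X" "h / \<tau> \<le> X" using X by auto
  thus "\<tau> \<le> X * h" "1 / \<tau> \<le> X / h" using \<tau> h by (auto simp: field_simps)
  show "1 \<le> X"
  proof (cases "h \<le> \<tau>")
    case True
    hence "1 \<le> \<tau> / h" using h by simp
    thus ?thesis using \<open>\<tau> / h \<le> X\<close> by linarith
  next
    case False
    hence "1 \<le> h / \<tau>" using \<tau> by simp
    thus ?thesis using \<open>h / \<tau> \<le> X\<close> by linarith
  qed
qed

lemma cond_const_le: "cond_const d (h / \<gamma>\<^sup>2) \<beta> \<tau> \<le> kappa_const d \<beta> \<gamma> * X\<^sup>2"
proof -
  have "cond_const d (h / \<gamma>\<^sup>2) \<beta> \<tau> = 1 + \<beta> * (real d * \<gamma>\<^sup>2)\<^sup>2 / 16 * (\<tau> / h)\<^sup>2"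
    using h \<gamma> by (simp add: cond_const_def power_mult_distrib power_divide field_simps)
  also have "\<dots> \<le> 1 * X\<^sup>2 + \<beta> * (real d * \<gamma>\<^sup>2)\<^sup>2 / 16 * X\<^sup>2"
    using X X_bounds \<tau> h \<beta> by (intro add_mono mult_left_mono power_mono) auto
  finally show ?thesis by (simp add: kappa_const_def algebra_simps)
qed

text \<open>For the rate \<open>rate_const / X\<close>, the square of \<open>X\<close> in the
  condition number cancels against the quadratic bound for \<open>cosh - 1\<close>.\<close>

lemma rate_small:
  "(cosh (rate_const d \<beta> \<gamma> / X) - 1) * cond_const d (h / \<gamma>\<^sup>2) \<beta> \<tau> * real (2 ^ d) \<le> mass_const d / 2"
proof -
  have \<mu>: "0 \<le> rate_const d \<beta> \<gamma> / X" "rate_const d \<beta> \<gamma> / X \<le> 1"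
    using rate_pos X_bounds by (auto simp: rate_const_def divide_le_eq)
  have "(cosh (rate_const d \<beta> \<gamma> / X) - 1) * cond_const d (h / \<gamma>\<^sup>2) \<beta> \<tau>
      \<le> (rate_const d \<beta> \<gamma> / X)\<^sup>2 * (kappa_const d \<beta> \<gamma> * X\<^sup>2)"
    using cosh_sub_1_le[OF \<mu>] cond_const_le \<beta> by (intro mult_mono) (auto simp: cond_const_def)
  also have "\<dots> = (rate_const d \<beta> \<gamma>)\<^sup>2 * kappa_const d \<beta> \<gamma>"
    using X_bounds by (simp add: power_divide)
  finally have "(cosh (rate_const d \<beta> \<gamma> / X) - 1) * cond_const d (h / \<gamma>\<^sup>2) \<beta> \<tau> * 2 ^ d
      \<le> (rate_const d \<beta> \<gamma>)\<^sup>2 * kappa_const d \<beta> \<gamma> * 2 ^ d"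
    by (rule mult_right_mono) simp
  thus ?thesis using rate_sq unfolding of_nat_power of_nat_numeral by linarith
qed

lemma data_const_le:
  "data_const d (h / \<gamma>\<^sup>2) \<alpha> h \<delta> \<tau> \<le> domain_const d \<alpha> \<gamma> \<delta> * X * ((1 / h) ^ d)\<^sup>2"
proof -
  define y where "y = (1 / h) ^ d"
  define B where "B = (\<delta> * \<gamma>\<^sup>2) ^ d"
  define c where "c = mass_const d"
  have c: "0 < c" using mass_const_pos[OF d] by (simp add: c_def)
  have B: "0 < B" using \<delta> \<gamma> by (simp add: B_def)
  have y: "1 \<le> y" unfolding y_def using h by (intro one_le_power) simp
  have ratio: "(\<delta> / (h / \<gamma>\<^sup>2)) ^ d = B * y"
    by (simp add: B_def y_def power_mult_distrib power_divide)
  \<comment> \<open>The square root is replaced by \<open>1 + t\<close> to keep to integer powers of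
    \<open>1 / h\<close>.\<close>
  have "sqrt (2 ^ d * (B * y) / (\<alpha> * c)) \<le> 1 + 2 ^ d * (B * y) / (\<alpha> * c)"
  proof -
    define t where "t = 2 ^ d * (B * y) / (\<alpha> * c)"
    have "0 \<le> t" using B y c \<alpha> by (simp add: t_def)
    hence "t \<le> (1 + t)\<^sup>2" by (simp add: power2_eq_square algebra_simps)
    hence "sqrt t \<le> 1 + t" using \<open>0 \<le> t\<close> by (intro real_le_lsqrt) auto
    thus ?thesis by (simp only: t_def)
  qed
  also have "\<dots> \<le> (1 + 2 ^ d * B / (\<alpha> * c)) * y"
    using y by (simp add: algebra_simps)
  finally have "sqrt (2 ^ d * (B * y) / (\<alpha> * c)) * (B * y) * (2 * real d * h)
      \<le> ((1 + 2 ^ d * B / (\<alpha> * c)) * y) * (B * y) * (2 * real d * 1)"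
    using B y h c \<alpha> by (intro mult_mono) auto
  also have "\<dots> = (2 * real d * (1 + 2 ^ d * B / (\<alpha> * c)) * B) * y\<^sup>2 * 1"
    by (simp add: power2_eq_square)
  also have "\<dots> \<le> (2 * real d * (1 + 2 ^ d * B / (\<alpha> * c)) * B) * y\<^sup>2 * X"
    using X_bounds B c \<alpha> by (intro mult_left_mono) auto
  finally have 1: "sqrt (2 ^ d * (B * y) / (\<alpha> * c)) * (B * y) * (2 * real d * h)
      \<le> (2 * real d * (1 + 2 ^ d * B / (\<alpha> * c)) * B) * y\<^sup>2 * X" .
  have "\<tau> \<le> X * 1" using X_bounds h by (meson mult_left_mono order.trans less_imp_le order.trans[OF zero_le_one])
  also have "\<dots> \<le> X * y\<^sup>2" using X_bounds y by (intro mult_left_mono one_le_power) auto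
  finally have "\<tau> / sqrt c \<le> X * y\<^sup>2 / sqrt c" using c by (intro divide_right_mono) auto
  hence "data_const d (h / \<gamma>\<^sup>2) \<alpha> h \<delta> \<tau>
      \<le> 2 * ((2 * real d * (1 + 2 ^ d * B / (\<alpha> * c)) * B) * y\<^sup>2 * X) + X * y\<^sup>2 / sqrt c"
    using 1 unfolding data_const_def ratio c_def[symmetric] by linarith
  also have "\<dots> = domain_const d \<alpha> \<gamma> \<delta> * X * y\<^sup>2"
    unfolding domain_const_def B_def[symmetric] c_def[symmetric] by (simp add: algebra_simps)
  finally show ?thesis by (simp add: y_def)
qed

text \<open>Powers of \<open>1 / h\<close>: d from the number of coarse vertices,
  \<open>2 * d\<close> from \<open>data_const\<close>, and 1 from
  \<open>1 / \<tau> \<le> X / h\<close>, since the time step enters as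
  \<open>\<tau> / \<tau>\<^sup>2\<close>. Powers of \<open>X\<close>: 2 from
  \<open>cond_const\<close>, 1 from \<open>data_const\<close> and 1 from
  \<open>1 / \<tau>\<close>.\<close>

lemma error_factor_le:
  assumes M: "0 \<le> M" "M \<le> 2 ^ d * (\<delta> * \<gamma>\<^sup>2 / h) ^ d"
  shows "2 * \<tau> / sqrt (mass_const d) * (M * (local_const d (h / \<gamma>\<^sup>2) \<beta> \<tau> \<mu> l N * data_const d (h / \<gamma>\<^sup>2) \<alpha> h \<delta> \<tau>))
    \<le> total_const d \<alpha> \<beta> \<gamma> \<delta> * growth_const d ^ N * X ^ 4 * (1 / h) ^ (3 * d + 1) * exp (- \<mu> * real l)"
proof -
  define y where "y = (1 / h) ^ d"
  define B where "B = (\<delta> * \<gamma>\<^sup>2) ^ d"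
  define c where "c = mass_const d"
  define k where "k = cond_const d (h / \<gamma>\<^sup>2) \<beta> \<tau>"
  define k0 where "k0 = kappa_const d \<beta> \<gamma>"
  define S where "S = (step_const d + 1) * 5"
  define q where "q = growth_const d ^ N"
  define e where "e = exp (- \<mu> * real l)"
  define P where "P = data_const d (h / \<gamma>\<^sup>2) \<alpha> h \<delta> \<tau>"
  define P0 where "P0 = domain_const d \<alpha> \<gamma> \<delta>"
  have pos: "0 < c" "0 < B" "0 < y" "0 \<le> k" "0 \<le> k0" "0 \<le> S" "0 \<le> q" "0 < e" "0 < P0"
    using mass_const_pos[OF d] \<delta> \<gamma> h \<beta> kappa_ge_1 step_const_nonneg[of d] growth_const_ge_1[of d] domain_const_pos
    by (auto simp: c_def B_def y_def k_def cond_const_def k0_def S_def q_def e_def P0_def)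
  have P: "0 \<le> P" "P \<le> P0 * X * y\<^sup>2"
    using data_const_le \<tau> h \<alpha> \<delta> mass_const_pos[OF d] by (auto simp: P_def P0_def y_def data_const_def)
  have M': "M \<le> 2 ^ d * (B * y)"
    using M(2) by (simp add: B_def y_def power_mult_distrib power_divide)
  have "2 * \<tau> / sqrt c * (M * (local_const d (h / \<gamma>\<^sup>2) \<beta> \<tau> \<mu> l N * P))
      = 2 / sqrt c * M * (k * exp 1 * 2 ^ d * S) * q * e * P * (1 / \<tau>)"
    using \<tau> by (simp add: local_const_def k_def S_def q_def e_def power2_eq_square)
  also have "\<dots> \<le> 2 / sqrt c * (2 ^ d * (B * y)) * ((k0 * X\<^sup>2) * exp 1 * 2 ^ d * S) * q * e * (P0 * X * y\<^sup>2) * (X / h)"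
    using pos P M' M(1) X_bounds cond_const_le \<tau> h
    by (intro mult_mono mult_nonneg_nonneg divide_nonneg_nonneg) (auto simp: k_def k0_def)
  also have "\<dots> = (2 / sqrt c * (2 ^ d * B) * (k0 * exp 1 * 2 ^ d * S) * P0) * q * X ^ 4 * (y ^ 3 * (1 / h)) * e"
    by (simp add: power2_eq_square power3_eq_cube power4_eq_xxxx)
  also have "y ^ 3 * (1 / h) = (1 / h) ^ (3 * d + 1)"
    by (simp add: y_def power_mult[symmetric] mult.commute)
  finally show ?thesis
    by (simp only: total_const_def c_def B_def k0_def S_def P0_def q_def e_def P_def)
qed

end

end

text \<open>The choice of the constant \<open>c\<^sub>0\<close>: every factor in the error bound is absorbed by one of the terms
  in the lower bound for the number of layers.\<close>

lemma decay_beats_growth: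
  fixes q D X h \<theta> H H0 :: real and nres nper a :: nat
  assumes q: "1 \<le> q" and D: "0 < D" and X: "1 \<le> X" and h: "0 < h" "h \<le> H" and H: "H \<le> H0" "0 < H0" "H0 < 1"
    and \<theta>: "0 < \<theta>" and nres: "1 \<le> nres"
    and Q: "Q = (1 + ln q) + 4 + real a + \<bar>ln D\<bar> / \<bar>ln H0\<bar> + 1 + 1 / \<bar>ln H0\<bar>"
    and L: "L = real nres * ln (exp 1 * X * real nres) + \<bar>ln h\<bar> + \<bar>ln \<theta>\<bar> + real nper * \<bar>ln H\<bar>"
    and x: "Q * L \<le> x"
  shows "real nper * (real nres * (D * q ^ nres * X ^ 4 * (1 / h) ^ a * exp (- x))) \<le> min 1 \<theta>"
proof -
  \<comment> \<open>A fixed positive lower bound for the logarithms of both mesh sizes; it pays for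
    the constant \<open>D\<close> and for the number of resets.\<close>
  define g where "g = \<bar>ln H0\<bar>"
  have g: "0 < g" using H by (simp add: g_def)
  have lnH: "g \<le> \<bar>ln H\<bar>" and lnh: "g \<le> \<bar>ln h\<bar>"
  proof -
    have "ln H \<le> ln H0" "ln h \<le> ln H0" "ln H0 < 0" using h H by auto
    thus "g \<le> \<bar>ln H\<bar>" "g \<le> \<bar>ln h\<bar>" by (auto simp: g_def)
  qed
  have lnX: "0 \<le> ln X" and lnq: "0 \<le> ln q" using X q by auto
  \<comment> \<open>The factor \<open>exp 1\<close> in the logarithm supplies
    \<open>real nres\<close> itself; without it this term would vanish for \<open>X = 1\<close> and
    \<open>nres = 1\<close>.\<close>
  have first: "real nres + ln X \<le> real nres * ln (exp 1 * X * real nres)"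
  proof -
    have "ln (exp 1 * X * real nres) = 1 + ln X + ln (real nres)"
      using X nres by (simp add: ln_mult)
    moreover have "0 \<le> ln (real nres)" using nres by simp
    ultimately have "real nres * (1 + ln X) \<le> real nres * ln (exp 1 * X * real nres)"
      by (intro mult_left_mono) auto
    moreover have "1 * ln X \<le> real nres * ln X" using nres lnX by (intro mult_right_mono) auto
    ultimately show ?thesis by (simp add: algebra_simps)
  qed
  have Hn: "real nper * g \<le> real nper * \<bar>ln H\<bar>" using lnH by (intro mult_left_mono) auto
  have L_ge: "real nres \<le> L" "ln X \<le> L" "\<bar>ln h\<bar> \<le> L" "\<bar>ln \<theta>\<bar> \<le> L" "real nper * g \<le> L" "g \<le> L"
  proof -
    have "0 \<le> real nper * g" "0 \<le> \<bar>ln \<theta>\<bar>" "0 \<le> real nres" using g by auto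
    thus "real nres \<le> L" "ln X \<le> L" "\<bar>ln h\<bar> \<le> L" "\<bar>ln \<theta>\<bar> \<le> L" "real nper * g \<le> L" "g \<le> L"
      using first Hn lnX lnh g unfolding L by linarith+
  qed
  \<comment> \<open>The summands of \<open>Q\<close> pay, in order, for \<open>nres\<close> and the
    growth, for \<open>X ^ 4\<close>, for the power of \<open>1 / h\<close>, for \<open>D\<close>,
    for \<open>\<theta>\<close> and for \<open>nper\<close>.\<close>
  have "(1 + ln q) * real nres + 4 * ln X + real a * \<bar>ln h\<bar> + \<bar>ln D\<bar> + \<bar>ln \<theta>\<bar> + real nper \<le> Q * L"
  proof -
    have "(1 + ln q) * real nres \<le> (1 + ln q) * L" "real a * \<bar>ln h\<bar> \<le> real a * L"
      using L_ge lnq by (auto intro!: mult_left_mono)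
    moreover have "\<bar>ln D\<bar> \<le> \<bar>ln D\<bar> / g * L"
    proof -
      have "\<bar>ln D\<bar> / g * g \<le> \<bar>ln D\<bar> / g * L" using L_ge g by (intro mult_left_mono) auto
      thus ?thesis using g by simp
    qed
    moreover have "real nper \<le> 1 / g * L"
      using L_ge(5) g by (simp add: field_simps)
    ultimately show ?thesis
      using L_ge unfolding Q g_def[symmetric] by (simp add: distrib_right)
  qed
  hence expo: "real nper + real nres + \<bar>ln D\<bar> + real nres * ln q + 4 * ln X + real a * \<bar>ln h\<bar> - x \<le> - \<bar>ln \<theta>\<bar>"
    using x by (simp add: algebra_simps)
  have "real n \<le> exp (real n)" for n
    using exp_ge_add_one_self[of "real n"] by linarith
  moreover have "D \<le> exp \<bar>ln D\<bar>" using D by (metis abs_ge_self exp_le_cancel_iff exp_ln)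
  moreover have "q ^ nres = exp (real nres * ln q)" using q by (simp add: exp_of_nat_mult)
  moreover have "X ^ 4 = exp (4 * ln X)" using X exp_of_nat_mult[of 4 "ln X"] by simp
  moreover have "(1 / h) ^ a = exp (real a * \<bar>ln h\<bar>)"
  proof -
    have "h < 1" using h H by linarith
    hence "\<bar>ln h\<bar> = - ln h" using h by simp
    hence "exp \<bar>ln h\<bar> = 1 / h" using h by (simp add: exp_minus inverse_eq_divide)
    thus ?thesis by (simp add: exp_of_nat_mult)
  qed
  ultimately have "real nper * (real nres * (D * q ^ nres * X ^ 4 * (1 / h) ^ a * exp (- x)))
      \<le> exp (real nper) * (exp (real nres) * (exp \<bar>ln D\<bar> * exp (real nres * ln q) * exp (4 * ln X) * exp (real a * \<bar>ln h\<bar>) * exp (- x)))"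
    using D by (intro mult_mono) auto
  also have "\<dots> = exp (real nper + real nres + \<bar>ln D\<bar> + real nres * ln q + 4 * ln X + real a * \<bar>ln h\<bar> - x)"
    by (simp add: exp_add exp_diff exp_minus field_simps)
  also have "\<dots> \<le> exp (- \<bar>ln \<theta>\<bar>)" using expo by simp
  also have "\<dots> \<le> min 1 \<theta>"
  proof -
    have "exp (- \<bar>ln \<theta>\<bar>) \<le> exp (ln \<theta>)" by (subst exp_le_cancel_iff) linarith
    thus ?thesis using \<theta> by simp
  qed
  finally show ?thesis .
qed

text \<open>\<open>\<gamma>\<close> and \<open>\<delta>\<close> carry the mesh regularity and the
  normalization of the diameter, and \<open>H\<^sub>0\<close> keeps the logarithms of the mesh sizes
  away from 0. The constants are fixed before domain, coefficient, meshes and discretization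
  parameters are chosen.\<close>

theorem theorem4p1:
  fixes \<alpha> \<beta> \<gamma> \<delta> H\<^sub>0 :: real
  assumes "0 < \<alpha>" and "\<alpha> \<le> \<beta>" and "0 < \<gamma>" and "0 < \<delta>" and "0 < H\<^sub>0" and "H\<^sub>0 < 1"
  shows "\<exists>c\<^sub>0 C c\<^sub>1 c\<^sub>2 :: real. \<exists>C\<tau>h :: real \<Rightarrow> real \<Rightarrow> real.
    0 < c\<^sub>0 \<and> 0 < C \<and> 0 < c\<^sub>1 \<and> 0 < c\<^sub>2 \<and>
    (\<forall>\<tau>>0. \<forall>h>0. c\<^sub>1 * max (\<tau> / h) (h / \<tau>) \<le> C\<tau>h \<tau> h \<and> C\<tau>h \<tau> h \<le> c\<^sub>2 * max (\<tau> / h) (h / \<tau>)) \<and>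
    (\<forall>(\<Omega> :: (real ^ 'n) set) (A :: real ^ 'n \<Rightarrow> real) \<T>H \<T>h H h
       tfin T \<tau> (nres :: nat) (nper :: nat) (N :: nat) \<theta> (l :: nat)
       (f :: nat \<Rightarrow> real ^ 'n \<Rightarrow> real) u ub.
       lipschitz_polytope \<Omega> \<and> 1 / \<delta> \<le> diameter \<Omega> \<and> diameter \<Omega> \<le> \<delta> \<and>
       A \<in> borel_measurable (lebesgue_on \<Omega>) \<and>
       (AE x in lebesgue_on \<Omega>. \<alpha> \<le> A x \<and> A x \<le> \<beta>) \<and>
       mesh_of \<Omega> \<T>H \<and> mesh_regular \<gamma> \<T>H \<and> H = mesh_size \<T>H \<and> H \<le> H\<^sub>0 \<and>
       mesh_of \<Omega> \<T>h \<and> mesh_regular \<gamma> \<T>h \<and> h = mesh_size \<T>h \<and>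
       mesh_refines \<T>h \<T>H \<and> H / h \<in> \<nat> \<and>
       0 < tfin \<and> 0 < T \<and> 0 < \<tau> \<and>
       T / \<tau> = real nres \<and> tfin / T = real nper \<and> tfin / \<tau> = real N \<and>
       0 < \<theta> \<and> 1 \<le> l \<and>
       real l \<ge> c\<^sub>0 * C\<tau>h \<tau> h *
         (T / \<tau> * ln (C\<tau>h \<tau> h * (T / \<tau>)) + \<bar>ln h\<bar> + \<bar>ln \<theta>\<bar> + tfin / T * \<bar>ln H\<bar>) \<and>
       (\<forall>n. f n \<in> fe_space \<Omega> \<T>h) \<and>
       global_cn \<Omega> A \<T>h \<tau> f u \<and>
       local_superposition \<Omega> A \<T>H \<T>h \<tau> nres nper l f (u 0) (u 1) ub
       \<longrightarrow>
       (\<forall>n\<le>N. energy_norm \<Omega> A \<tau> (\<lambda>j x. ub j x - u j x) n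
          \<le> C * \<theta> * (energy_norm \<Omega> A \<tau> u 0 + (\<Sum>j = 1..N. \<tau> * l2_norm \<Omega> (tavg f j)))))"
proof -
  define d where "d = CARD('n)"
  define D where "D = total_const d \<alpha> \<beta> \<gamma> \<delta>"
  define q where "q = growth_const d"
  define Q where "Q = (1 + ln q) + 4 + real (3 * d + 1) + \<bar>ln D\<bar> / \<bar>ln H\<^sub>0\<bar> + 1 + 1 / \<bar>ln H\<^sub>0\<bar>"
  define \<mu>\<^sub>0 where "\<mu>\<^sub>0 = rate_const d \<beta> \<gamma>"
  \<comment> \<open>Chosen so that the decay rate times \<open>c\<^sub>0 * C\<tau>h \<tau> h\<close>
    is exactly \<open>Q\<close>.\<close>
  define c\<^sub>0 where "c\<^sub>0 = Q / (\<mu>\<^sub>0 * exp 1)"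
  define C where "C = 2 * (source_const d + 1)"
  \<comment> \<open>The factor \<open>exp 1\<close> keeps the logarithm in the condition on
    \<open>l\<close> at least 1.\<close>
  define C\<tau>h where "C\<tau>h \<tau> h = exp 1 * max (\<tau> / h) (h / \<tau>)" for \<tau> h :: real
  have \<beta>: "0 < \<beta>" using assms by simp
  have d: "0 < d" by (simp add: d_def)
  note params = d assms(1) \<beta> assms(3,4)
  have \<mu>\<^sub>0: "0 < \<mu>\<^sub>0" "\<mu>\<^sub>0 \<le> 1" using rate_pos[OF params] by (auto simp: \<mu>\<^sub>0_def rate_const_def)
  have D: "0 < D" unfolding D_def by (rule total_const_pos[OF params])
  have q: "1 \<le> q" unfolding q_def by (rule growth_const_ge_1)
  have Q: "0 < Q" unfolding Q_def using q by (intro add_pos_nonneg add_nonneg_pos add_nonneg_nonneg) auto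
  have c\<^sub>0: "0 < c\<^sub>0" using Q \<mu>\<^sub>0 by (simp add: c\<^sub>0_def)
  have C: "0 < C" using source_const_ge_1[of d] by (simp add: C_def)
  have main: "energy_norm \<Omega> A \<tau> (\<lambda>j x. ub j x - u j x) n
          \<le> C * \<theta> * (energy_norm \<Omega> A \<tau> u 0 + (\<Sum>j = 1..N. \<tau> * l2_norm \<Omega> (tavg f j)))"
    if pol: "lipschitz_polytope \<Omega>" and diam\<Omega>: "1 / \<delta> \<le> diameter \<Omega>" "diameter \<Omega> \<le> \<delta>"
      and A: "A \<in> borel_measurable (lebesgue_on \<Omega>)" "AE x in lebesgue_on \<Omega>. \<alpha> \<le> A x \<and> A x \<le> \<beta>"
      and meshH: "mesh_of \<Omega> \<T>H" "mesh_regular \<gamma> \<T>H" "H = mesh_size \<T>H" "H \<le> H\<^sub>0"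
      and meshh: "mesh_of \<Omega> \<T>h" "mesh_regular \<gamma> \<T>h" "h = mesh_size \<T>h"
      and ref: "mesh_refines \<T>h \<T>H"
      and pos: "0 < tfin" "0 < T" "0 < \<tau>" and ratios: "T / \<tau> = real nres" "tfin / T = real nper" "tfin / \<tau> = real N"
      and \<theta>: "0 < \<theta>" and l1: "1 \<le> l"
      and l: "real l \<ge> c\<^sub>0 * C\<tau>h \<tau> h *
         (T / \<tau> * ln (C\<tau>h \<tau> h * (T / \<tau>)) + \<bar>ln h\<bar> + \<bar>ln \<theta>\<bar> + tfin / T * \<bar>ln H\<bar>)"
      and f: "\<forall>n. f n \<in> fe_space \<Omega> \<T>h" and u: "global_cn \<Omega> A \<T>h \<tau> f u"
      and ls: "local_superposition \<Omega> A \<T>H \<T>h \<tau> nres nper l f (u 0) (u 1) ub" and n: "n \<le> N"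
    for \<Omega> :: "(real ^ 'n) set" and A :: "real ^ 'n \<Rightarrow> real" and \<T>H \<T>h H h
       tfin T \<tau> and nres nper N :: nat and \<theta> and l :: nat
       and f :: "nat \<Rightarrow> real ^ 'n \<Rightarrow> real" and u ub n
  proof -
    have ne: "\<Omega> \<noteq> {}"
    proof
      assume "\<Omega> = {}"
      hence "1 / \<delta> \<le> 0" using diam\<Omega>(1) by simp
      thus False using assms(4) by simp
    qed
    have \<Omega>: "open \<Omega>" "bounded \<Omega>" "connected \<Omega>" "lipschitz_domain \<Omega>"
      using pol by (auto simp: lipschitz_polytope_def)
    have h0: "0 < h" and H0: "0 < H"
      using ball_mesh_of(1)[OF meshh(1) ne meshh(2) assms(3)] ball_mesh_of(1)[OF meshH(1) ne meshH(2) assms(3)]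
      by (simp_all add: meshh(3) meshH(3))
    have hH: "h \<le> H"
      unfolding meshh(3) meshH(3) by (rule mesh_size_refines[OF meshh(1) meshH(1) ne ref])
    have h1: "h < 1" using hH meshH(4) assms(6) by linarith
    interpret bh: ball_mesh \<T>h "h / \<gamma>\<^sup>2"
      unfolding meshh(3) by (rule ball_mesh_of(2)[OF meshh(1) ne meshh(2) assms(3)])
    interpret bH: ball_mesh \<T>H "H / \<gamma>\<^sup>2"
      unfolding meshH(3) by (rule ball_mesh_of(2)[OF meshH(1) ne meshH(2) assms(3)])
    have coverH: "\<Union>\<T>H = closure \<Omega>" using meshH(1) by (simp add: mesh_of_def)
    interpret fe_mesh \<T>h "h / \<gamma>\<^sup>2" \<Omega> A \<alpha> \<beta> h
    proof unfold_locales
      show "interior (closure \<Omega>) = \<Omega>" by (rule interior_closure_lipschitz_domain[OF \<Omega>(1,4)])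
      show "\<Union>\<T>h = closure \<Omega>" using meshh(1) by (simp add: mesh_of_def)
      show "\<And>K. K \<in> \<T>h \<Longrightarrow> diameter K \<le> h" using mesh_size_ge[OF meshh(1)] meshh(3) by simp
    qed (use \<Omega> ne A assms in auto)
    obtain c where c: "c \<in> \<Omega>" using ne by blast
    have R: "closure \<Omega> \<subseteq> cball c \<delta>"
    proof (rule closure_minimal)
      show "\<Omega> \<subseteq> cball c \<delta>"
        using diameter_bounded_bound[OF \<Omega>(2) c] diam\<Omega>(2) by force
    qed simp
    have \<delta>0: "0 \<le> \<delta>" using assms(4) by simp
    define X where "X = max (\<tau> / h) (h / \<tau>)"
    note tp = pos(3) h0 h1 X_def
    define \<mu> where "\<mu> = \<mu>\<^sub>0 / X"
    have X1: "1 \<le> X" by (rule X_bounds(1)[OF params tp])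
    have \<mu>: "0 \<le> \<mu>" "\<mu> \<le> 1" using \<mu>\<^sub>0 X1 by (auto simp: \<mu>_def divide_le_eq)
    obtain l' where l': "l = Suc l'" using l1 by (cases l) auto
    have small: "(cosh \<mu> - 1) * cond_const CARD('n) (h / \<gamma>\<^sup>2) \<beta> \<tau> * real (2 ^ CARD('n)) \<le> mass_const CARD('n) / 2"
      unfolding \<mu>_def \<mu>\<^sub>0_def d_def[symmetric] by (rule rate_small[OF params tp])
    have nres: "1 \<le> nres"
    proof -
      have "0 < T / \<tau>" using pos by simp
      thus ?thesis unfolding ratios(1) by simp
    qed
    have N: "N = nper * nres"
    proof -
      have "real N = (tfin / T) * (T / \<tau>)" using ratios(3) pos by simp
      hence "real N = real (nper * nres)" using ratios by simp
      thus ?thesis by (simp only: of_nat_eq_iff)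
    qed
    define F where "F = energy_norm \<Omega> A \<tau> u 0 + (\<Sum>j=1..nper * nres. \<tau> * l2_norm \<Omega> (tavg f j))"
    define \<epsilon> where "\<epsilon> = 2 * \<tau> / sqrt (mass_const d) * (real (card (mesh_vertices \<T>H))
      * (local_const d (h / \<gamma>\<^sup>2) \<beta> \<tau> \<mu> l nres * data_const d (h / \<gamma>\<^sup>2) \<alpha> h \<delta> \<tau>))"
    have F0: "0 \<le> F"
      unfolding F_def using pos energy_norm_nonneg l2_norm_nonneg by (intro add_nonneg_nonneg sum_nonneg) auto
    have err: "energy_norm \<Omega> A \<tau> (\<lambda>j x. ub j x - u j x) n
        \<le> ((1 + real nres * \<epsilon>) ^ nper - 1) * ((source_const d + 1) * F)"
      unfolding \<epsilon>_def F_def d_def l'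
      using local_superposition_error[OF bH.para_mesh_axioms coverH pos(3) \<mu> small R \<delta>0 _ u ls[unfolded l'] n[unfolded N]] f
      by blast
    have card: "real (card (mesh_vertices \<T>H)) \<le> 2 ^ d * (\<delta> * \<gamma>\<^sup>2 / h) ^ d"
    proof -
      \<comment> \<open>Every coarse vertex belongs to an element with \<open>2 ^ d\<close>
        vertices. Passing from \<open>H\<close> to the smaller \<open>h\<close> leaves a single mesh
        size in the bound.\<close>
      have "card (mesh_vertices \<T>H) \<le> (\<Sum>K\<in>\<T>H. card (verts K))"
        unfolding bH.mesh_vertices_eq by (rule card_UN_le[OF bH.finite_mesh])
      also have "\<dots> = card \<T>H * 2 ^ d" by (simp add: card_verts[OF bH.para] d_def)
      finally have "real (card (mesh_vertices \<T>H)) \<le> real (card \<T>H) * 2 ^ d"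
        by (metis of_nat_le_iff of_nat_mult of_nat_numeral of_nat_power)
      also have "\<dots> \<le> (\<delta> / (H / \<gamma>\<^sup>2)) ^ d * 2 ^ d"
        using bH.card_mesh_le[of c \<delta>] R \<delta>0 coverH unfolding d_def by (intro mult_right_mono) auto
      also have "\<dots> \<le> (\<delta> * \<gamma>\<^sup>2 / h) ^ d * 2 ^ d"
      proof (intro mult_right_mono power_mono)
        show "\<delta> / (H / \<gamma>\<^sup>2) \<le> \<delta> * \<gamma>\<^sup>2 / h"
          using hH h0 \<delta>0 by (simp add: frac_le)
      qed (use \<delta>0 H0 in auto)
      finally show ?thesis by (simp add: mult.commute)
    qed
    have eps0: "0 \<le> \<epsilon>"
      unfolding \<epsilon>_def local_const_def data_const_def cond_const_def
      using pos h0 assms \<beta> mass_const_pos[OF d] step_const_nonneg[of d] growth_const_ge_1[of d]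
      by (intro mult_nonneg_nonneg divide_nonneg_nonneg add_nonneg_nonneg zero_le_power real_sqrt_ge_zero) auto
    define L where "L = real nres * ln (exp 1 * X * real nres) + \<bar>ln h\<bar> + \<bar>ln \<theta>\<bar> + real nper * \<bar>ln H\<bar>"
    have QL: "Q * L \<le> \<mu> * real l"
    proof -
      have "c\<^sub>0 * (exp 1 * X) * L \<le> real l"
        using l unfolding C\<tau>h_def ratios X_def[symmetric] L_def .
      hence "\<mu> * (c\<^sub>0 * (exp 1 * X) * L) \<le> \<mu> * real l" using \<mu> by (intro mult_left_mono)
      moreover have "\<mu> * (c\<^sub>0 * (exp 1 * X) * L) = Q * L"
        using \<mu>\<^sub>0 X1 by (simp add: \<mu>_def c\<^sub>0_def)
      ultimately show ?thesis by simp
    qed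
    have "\<epsilon> \<le> D * q ^ nres * X ^ 4 * (1 / h) ^ (3 * d + 1) * exp (- (\<mu> * real l))"
      unfolding \<epsilon>_def D_def q_def using error_factor_le[OF params tp _ card, of \<mu> l nres] by simp
    hence "real nper * (real nres * \<epsilon>)
        \<le> real nper * (real nres * (D * q ^ nres * X ^ 4 * (1 / h) ^ (3 * d + 1) * exp (- (\<mu> * real l))))"
      by (intro mult_left_mono) auto
    also have "\<dots> \<le> min 1 \<theta>"
      by (rule decay_beats_growth[OF q D X1 h0 hH meshH(4) assms(5,6) \<theta> nres Q_def L_def QL])
    finally have t: "real nper * (real nres * \<epsilon>) \<le> 1" "real nper * (real nres * \<epsilon>) \<le> \<theta>" by auto
    define t where "t = real nper * (real nres * \<epsilon>)"
    have t0: "0 \<le> t" using eps0 by (simp add: t_def)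
    \<comment> \<open>With \<open>t\<close> at most 1, compounding over all resets costs at most
      \<open>exp t - 1 \<le> 2 * t\<close>, the origin of the factor 2 in \<open>C\<close>.\<close>
    have "(1 + real nres * \<epsilon>) ^ nper \<le> exp (real nres * \<epsilon>) ^ nper"
      using exp_ge_add_one_self[of "real nres * \<epsilon>"] eps0 by (intro power_mono) auto
    also have "\<dots> = exp t" by (simp add: t_def exp_of_nat_mult)
    also have "\<dots> \<le> 1 + t + t\<^sup>2" using t0 t by (intro exp_bound) (auto simp: t_def)
    also have "t\<^sup>2 \<le> t" using t0 t(1) mult_left_le[of t t] by (simp add: t_def power2_eq_square)
    finally have "(1 + real nres * \<epsilon>) ^ nper - 1 \<le> 2 * \<theta>" using t(2) unfolding t_def[symmetric] by linarith
    hence "((1 + real nres * \<epsilon>) ^ nper - 1) * ((source_const d + 1) * F) \<le> (2 * \<theta>) * ((source_const d + 1) * F)"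
      using F0 source_const_ge_1[of d] by (intro mult_right_mono) auto
    also have "\<dots> = C * \<theta> * F" by (simp add: C_def)
    finally show ?thesis using err unfolding F_def N by linarith
  qed
  show ?thesis
  proof (rule exI[of _ c\<^sub>0], rule exI[of _ C], rule exI[of _ "exp 1"], rule exI[of _ "exp 1"],
      rule exI[of _ C\<tau>h], intro conjI allI impI, goal_cases)
    case (7 \<Omega> A \<T>H \<T>h H h tfin T \<tau> nres nper N \<theta> l f u ub n)
    from 7(1) show ?case
      by (elim conjE, intro main[where \<Omega> = \<Omega> and A = A and \<T>H = \<T>H and \<T>h = \<T>h and H = H and h = h
          and tfin = tfin and T = T and \<tau> = \<tau> and nres = nres and nper = nper and N = N and \<theta> = \<theta>
          and l = l and f = f and u = u and ub = ub and n = n] 7(2)) assumption+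
  qed (use c\<^sub>0 C in \<open>simp_all add: C\<tau>h_def\<close>)
qed

end
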